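(* A sequence $\mathbf{A}=(A_n)_{n\ge0}$ in $\mathcal{S}_\eta(\mathcal{O}_N)$ is stable if and only if the operator $\widetilde{W}(\mathbf{A}+\mathcal{G}_\eta)$ on $l^2(\mathbb{Z}^+,l^2(\mathbb{Z}^+))$ is invertible.
   Context: Let $N\ge 2$ be an integer, $\mathbb{Z}^+=\{0,1,2,\dots\}$. For $n\ge 1$, $P_n$ is the orthogonal projection of $l^2(\mathbb{Z}^+)$ onto the span of the first $n$ standard basis vectors, and $R_n : (x_k)_{k\ge0}\mapsto (x_{n-1},x_{n-2},\dots,x_0,0,0,\dots)$. For $i\in\{0,\dots,N-1\}$, $S_i\in L(l^2(\mathbb{Z}^+))$ is the isometry $(S_i x)_{rN+i}=x_r$ for $r\ge 0$, with all other components of $S_ix$ equal to $0$. The concrete Cuntz algebra $\mathcal{O}_N$ is the smallest $C^*$-subalgebra of $L(l^2(\mathbb{Z}^+))$ containing $S_0,\dots,S_{N-1}$. Let $\mathcal{F}_\eta$ (with $\eta(n)=N^n$) be the $C^*$-algebra of all bounded sequences $(A_n)_{n\ge 0}$ with $A_n\in\mathbb{C}^{N^n\times N^n}$ (identified with operators on $\mathrm{im}\,P_{N^n}$), with entrywise operations and supremum norm, and $\mathcal{G}_\eta$ its closed ideal of sequences with $\|A_n\|\to 0$. A sequence $(A_n)\in\mathcal{F}_\eta$ is stable if there is an $n_0$ such that $A_n$ is invertible for all $n\ge n_0$ and $\sup_{n\ge n_0}\|A_n^{-1}\|<\infty$. $\mathcal{S}_\eta(\mathcal{O}_N)$ is the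 smallest $C^*$-subalgebra of $\mathcal{F}_\eta$ containing all sequences $(P_{N^n}AP_{N^n})_{n\ge0}$ with $A\in\mathcal{O}_N$; it contains $\mathcal{G}_\eta$, and $\mathcal{S}_N:=\mathcal{S}_\eta(\mathcal{O}_N)/\mathcal{G}_\eta$. Let $e$ be the identity of $\mathcal{S}_N$, $s_0:=(P_{N^n}S_0P_{N^n})_{n\ge0}+\mathcal{G}_\eta$, and $p_1:=s_0^*s_0$. Definition of $\widetilde W$: for $a\in\mathcal{S}_N$ write $(e-p_1)a(e-p_1)=(A_n)_{n\ge0}+\mathcal{G}_\eta$ and let $W_{00}(a):=\mathrm{s\text{-}lim}_{n\to\infty} R_{N^n}A_nR_{N^n}$ (this strong limit exists and is independent of the representative). For $i,j\in\mathbb{Z}^+$ let $$W_{ij}(a):=(S_{N-1}^* )^i\, W_{00}\big((e-p_1)s_0^i\,a\,(s_0^* )^j(e-p_1)\big)\,S_{N-1}^j,$$ and $\widetilde W(a):=(W_{ij}(a))_{i,j\ge0}$. This infinite matrix defines a bounded operator on $l^2(\mathbb{Z}^+,l^2(\mathbb{Z}^+))$ by $(\widetilde W(a)x)_i=\sum_j W_{ij}(a)x_j$. *)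

theory Defs
  imports "HOL-Analysis.Analysis" "HOL-Algebra.QuotRing"
begin

section \<open>Complex normed spaces\<close>

class complex_normed_vector = real_normed_vector +
  fixes scaleC :: "complex \<Rightarrow> 'a \<Rightarrow> 'a"  (infixr "*\<^sub>C" 75)
  assumes scaleC_add_right: "c *\<^sub>C (x + y) = c *\<^sub>C x + c *\<^sub>C y"
    and scaleC_add_left: "(c + d) *\<^sub>C x = c *\<^sub>C x + d *\<^sub>C x"
    and scaleC_scaleC: "c *\<^sub>C (d *\<^sub>C x) = (c * d) *\<^sub>C x"
    and scaleC_of_real: "complex_of_real r *\<^sub>C x = r *\<^sub>R x"
    and norm_scaleC: "norm (c *\<^sub>C x) = cmod c * norm x"

instantiation complex :: complex_normed_vector
begin
definition scaleC_complex :: "complex \<Rightarrow> complex \<Rightarrow> complex"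
  where "scaleC_complex c x = c * x"
instance
  by standard
    (simp_all add: scaleC_complex_def algebra_simps norm_mult scaleR_conv_of_real)
end


section \<open>The spaces \<open>l\<^sup>2(\<int>\<^sup>+, X)\<close>\<close>

typedef (overloaded) 'a ell2 =
  "{x :: nat \<Rightarrow> 'a::complex_normed_vector. summable (\<lambda>k. (norm (x k))\<^sup>2)}"
  morphisms ell2_nth Abs_ell2
  by (rule exI[of _ "\<lambda>_. 0"]) simp

setup_lifting type_definition_ell2

lemma ell2_eqI: "(\<And>k. ell2_nth x k = ell2_nth y k) \<Longrightarrow> x = y"
  by (metis ell2_nth_inject ext)

lemma summable_norm_sq_ell2: "summable (\<lambda>k. (norm (ell2_nth x k))\<^sup>2)"
  using ell2_nth[of x] by simp

lemma summable_norm_sq_add: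
  fixes x y :: "nat \<Rightarrow> 'a::real_normed_vector"
  assumes "summable (\<lambda>k. (norm (x k))\<^sup>2)" "summable (\<lambda>k. (norm (y k))\<^sup>2)"
  shows "summable (\<lambda>k. (norm (x k + y k))\<^sup>2)"
proof (rule summable_comparison_test')
  show "summable (\<lambda>k. 2 * (norm (x k))\<^sup>2 + 2 * (norm (y k))\<^sup>2)"
    using assms by (intro summable_add summable_mult)
  fix k :: nat assume "k \<ge> 0"
  have "(norm (x k + y k))\<^sup>2 \<le> (norm (x k) + norm (y k))\<^sup>2"
    by (intro power_mono norm_triangle_ineq) simp
  also have "\<dots> \<le> 2 * (norm (x k))\<^sup>2 + 2 * (norm (y k))\<^sup>2"
    using zero_le_power2[of "norm (x k) - norm (y k)"]
    by (simp add: power2_eq_square algebra_simps)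
  finally show "norm ((norm (x k + y k))\<^sup>2) \<le> 2 * (norm (x k))\<^sup>2 + 2 * (norm (y k))\<^sup>2"
    by simp
qed

lemma sqrt_suminf_triangle:
  fixes x y :: "nat \<Rightarrow> 'a::real_normed_vector"
  assumes x: "summable (\<lambda>k. (norm (x k))\<^sup>2)" and y: "summable (\<lambda>k. (norm (y k))\<^sup>2)"
  shows "sqrt (\<Sum>k. (norm (x k + y k))\<^sup>2)
           \<le> sqrt (\<Sum>k. (norm (x k))\<^sup>2) + sqrt (\<Sum>k. (norm (y k))\<^sup>2)"
proof -
  let ?X = "\<Sum>k. (norm (x k))\<^sup>2" and ?Y = "\<Sum>k. (norm (y k))\<^sup>2"
  have nonneg: "0 \<le> ?X" "0 \<le> ?Y"
    by (simp_all add: suminf_nonneg x y)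
  have fin: "(\<Sum>k<n. (norm (x k + y k))\<^sup>2) \<le> (sqrt ?X + sqrt ?Y)\<^sup>2" for n
  proof -
    have "sqrt (\<Sum>k<n. (norm (x k + y k))\<^sup>2) \<le> L2_set (\<lambda>k. norm (x k) + norm (y k)) {..<n}"
      unfolding L2_set_def
      by (intro real_sqrt_le_mono sum_mono power_mono norm_triangle_ineq) simp
    also have "\<dots> \<le> L2_set (\<lambda>k. norm (x k)) {..<n} + L2_set (\<lambda>k. norm (y k)) {..<n}"
      by (rule L2_set_triangle_ineq)
    also have "\<dots> \<le> sqrt ?X + sqrt ?Y"
      unfolding L2_set_def
      by (intro add_mono real_sqrt_le_mono sum_le_suminf x y) auto
    finally have "sqrt (\<Sum>k<n. (norm (x k + y k))\<^sup>2) \<le> sqrt ?X + sqrt ?Y" .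
    then show ?thesis
      by (rule sqrt_le_D)
  qed
  have "(\<Sum>k. (norm (x k + y k))\<^sup>2) \<le> (sqrt ?X + sqrt ?Y)\<^sup>2"
    by (intro suminf_le_const summable_norm_sq_add x y fin)
  then have "sqrt (\<Sum>k. (norm (x k + y k))\<^sup>2) \<le> sqrt ((sqrt ?X + sqrt ?Y)\<^sup>2)"
    by (rule real_sqrt_le_mono)
  then show ?thesis
    using nonneg by simp
qed

instantiation ell2 :: (complex_normed_vector) complex_normed_vector
begin

lift_definition zero_ell2 :: "'a ell2" is "\<lambda>_. 0" by simp

lift_definition plus_ell2 :: "'a ell2 \<Rightarrow> 'a ell2 \<Rightarrow> 'a ell2" is "\<lambda>x y k. x k + y k"
  by (rule summable_norm_sq_add)

lift_definition uminus_ell2 :: "'a ell2 \<Rightarrow> 'a ell2" is "\<lambda>x k. - x k" by simp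

lift_definition minus_ell2 :: "'a ell2 \<Rightarrow> 'a ell2 \<Rightarrow> 'a ell2" is "\<lambda>x y k. x k - y k"
  subgoal for x y using summable_norm_sq_add[of x "\<lambda>k. - y k"] by simp
  done

lift_definition scaleC_ell2 :: "complex \<Rightarrow> 'a ell2 \<Rightarrow> 'a ell2" is "\<lambda>c x k. c *\<^sub>C x k"
  by (simp add: norm_scaleC power_mult_distrib summable_mult)

lift_definition scaleR_ell2 :: "real \<Rightarrow> 'a ell2 \<Rightarrow> 'a ell2" is "\<lambda>r x k. r *\<^sub>R x k"
  by (simp add: power_mult_distrib summable_mult)

lift_definition norm_ell2 :: "'a ell2 \<Rightarrow> real" is "\<lambda>x. sqrt (\<Sum>k. (norm (x k))\<^sup>2)" .

definition dist_ell2 :: "'a ell2 \<Rightarrow> 'a ell2 \<Rightarrow> real"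
  where "dist_ell2 x y = norm (x - y)"

definition sgn_ell2 :: "'a ell2 \<Rightarrow> 'a ell2"
  where "sgn_ell2 x = inverse (norm x) *\<^sub>R x"

definition uniformity_ell2 :: "('a ell2 \<times> 'a ell2) filter"
  where "uniformity_ell2 = (INF e\<in>{0 <..}. principal {(x, y). dist x y < e})"

definition open_ell2 :: "'a ell2 set \<Rightarrow> bool"
  where "open_ell2 U = (\<forall>x\<in>U. eventually (\<lambda>(x', y). x' = x \<longrightarrow> y \<in> U) uniformity)"

instance
proof
  fix x y z :: "'a ell2" and r s :: real and c d :: complex
  show "x + y + z = x + (y + z)" by transfer (simp add: add.assoc)
  show "x + y = y + x" by transfer (simp add: add.commute)
  show "0 + x = x" by transfer simp
  show "- x + x = 0" by transfer simp
  show "x - y = x + - y" by transfer simp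
  show "r *\<^sub>R (x + y) = r *\<^sub>R x + r *\<^sub>R y" by transfer (simp add: scaleR_add_right)
  show "(r + s) *\<^sub>R x = r *\<^sub>R x + s *\<^sub>R x" by transfer (simp add: scaleR_add_left)
  show "r *\<^sub>R s *\<^sub>R x = (r * s) *\<^sub>R x" by transfer simp
  show "1 *\<^sub>R x = x" by transfer simp
  show "dist x y = norm (x - y)" by (rule dist_ell2_def)
  show "sgn x = inverse (norm x) *\<^sub>R x" by (rule sgn_ell2_def)
  show "(uniformity :: ('a ell2 \<times> 'a ell2) filter) = (INF e\<in>{0 <..}. principal {(x, y). dist x y < e})"
    by (rule uniformity_ell2_def)
  show "open U = (\<forall>x\<in>U. \<forall>\<^sub>F (x', y) in uniformity. x' = x \<longrightarrow> y \<in> U)" for U :: "'a ell2 set"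
    by (rule open_ell2_def)
  show "(norm x = 0) = (x = 0)"
    by transfer (auto simp: suminf_eq_zero_iff)
  show "norm (x + y) \<le> norm x + norm y"
    by transfer (simp add: sqrt_suminf_triangle)
  show "norm (r *\<^sub>R x) = \<bar>r\<bar> * norm x"
    by transfer (simp add: power_mult_distrib suminf_mult real_sqrt_mult)
  show "c *\<^sub>C (x + y) = c *\<^sub>C x + c *\<^sub>C y" by transfer (simp add: scaleC_add_right)
  show "(c + d) *\<^sub>C x = c *\<^sub>C x + d *\<^sub>C x" by transfer (simp add: scaleC_add_left)
  show "c *\<^sub>C d *\<^sub>C x = (c * d) *\<^sub>C x" by transfer (simp add: scaleC_scaleC)
  show "complex_of_real r *\<^sub>C x = r *\<^sub>R x" by transfer (simp add: scaleC_of_real)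
  show "norm (c *\<^sub>C x) = cmod c * norm x"
    by transfer (simp add: norm_scaleC power_mult_distrib suminf_mult real_sqrt_mult)
qed

end

type_synonym l2 = "complex ell2"
type_synonym op = "l2 \<Rightarrow>\<^sub>L l2"

definition cinner :: "l2 \<Rightarrow> l2 \<Rightarrow> complex"
  where "cinner x y = (\<Sum>k. ell2_nth x k * cnj (ell2_nth y k))"


section \<open>Bounded operators\<close>

text \<open>The type \<^typ>\<open>'a \<Rightarrow>\<^sub>L 'a\<close> consists of the bounded real-linear maps;
  \<open>L(X)\<close> is its subset of complex-linear maps.\<close>

definition bounded_ops :: "('a::complex_normed_vector \<Rightarrow>\<^sub>L 'a) set"
  where "bounded_ops = {A :: 'a \<Rightarrow>\<^sub>L 'a. \<forall>c x. A (c *\<^sub>C x) = c *\<^sub>C A x}"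

definition invertible_op :: "('a::complex_normed_vector \<Rightarrow>\<^sub>L 'a) \<Rightarrow> bool"
  where "invertible_op A \<longleftrightarrow>
    (\<exists>B\<in>bounded_ops. A o\<^sub>L B = id_blinfun \<and> B o\<^sub>L A = id_blinfun)"

definition op_pow :: "('a::real_normed_vector \<Rightarrow>\<^sub>L 'a) \<Rightarrow> nat \<Rightarrow> ('a \<Rightarrow>\<^sub>L 'a)"
  where "op_pow A i = (((o\<^sub>L) A) ^^ i) id_blinfun"

text \<open>For \<^term>\<open>A \<in> bounded_ops\<close> the description below is proper: by the Riesz theorem there
  is exactly one adjoint, and it is again complex-linear.\<close>

definition adj :: "op \<Rightarrow> op"
  where "adj A = (THE B :: op. \<forall>x y. cinner (A x) y = cinner x (B y))"

definition op_scaleC :: "complex \<Rightarrow> op \<Rightarrow> op"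
  where "op_scaleC c A = Blinfun (\<lambda>x. c *\<^sub>C A x)"

lemma op_scaleC_apply: "op_scaleC c A x = c *\<^sub>C A x"
proof -
  have "bounded_linear (\<lambda>x::l2. c *\<^sub>C x)"
  proof (rule bounded_linear_intro[of _ "cmod c"])
    show "c *\<^sub>C (r *\<^sub>R x) = r *\<^sub>R c *\<^sub>C x" for r and x :: l2
      by (simp add: scaleC_of_real[symmetric] scaleC_scaleC mult.commute)
  qed (auto simp: scaleC_add_right norm_scaleC mult.commute)
  from bounded_linear_compose[OF this blinfun.bounded_linear_right[of A]]
  show ?thesis
    by (simp add: op_scaleC_def bounded_linear_Blinfun_apply)
qed

lemma bounded_linear_reindex:
  fixes g :: "nat \<Rightarrow> nat"
  assumes g: "inj_on g {k. Q k}"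
  shows "\<And>x::l2. summable (\<lambda>k. (norm (if Q k then ell2_nth x (g k) else 0))\<^sup>2)"
    and "bounded_linear (\<lambda>x::l2. Abs_ell2 (\<lambda>k. if Q k then ell2_nth x (g k) else 0))"
proof -
  have part: "(\<Sum>k<n. (norm (if Q k then ell2_nth x (g k) else 0))\<^sup>2)
      \<le> (\<Sum>k. (norm (ell2_nth x k))\<^sup>2)" for n and x :: l2
  proof -
    have "(\<Sum>k<n. (norm (if Q k then ell2_nth x (g k) else 0))\<^sup>2)
        = (\<Sum>k\<in>{k. k < n \<and> Q k}. (norm (ell2_nth x (g k)))\<^sup>2)"
      by (rule sum.mono_neutral_cong_right) auto
    also have "\<dots> = (\<Sum>k\<in>g ` {k. k < n \<and> Q k}. (norm (ell2_nth x k))\<^sup>2)"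
      by (subst sum.reindex) (auto intro: inj_on_subset[OF g])
    also have "\<dots> \<le> (\<Sum>k. (norm (ell2_nth x k))\<^sup>2)"
      by (intro sum_le_suminf summable_norm_sq_ell2) auto
    finally show ?thesis .
  qed
  show sm: "summable (\<lambda>k. (norm (if Q k then ell2_nth x (g k) else 0))\<^sup>2)" for x :: l2
    by (rule bounded_imp_summable[of _ "\<Sum>k. (norm (ell2_nth x k))\<^sup>2"])
      (use part[where x = x and n = "Suc n" for n] in \<open>auto simp: lessThan_Suc_atMost\<close>)
  have nth: "ell2_nth (Abs_ell2 (\<lambda>k. if Q k then ell2_nth x (g k) else 0))
      = (\<lambda>k. if Q k then ell2_nth x (g k) else 0)" for x :: l2
    by (rule Abs_ell2_inverse) (use sm in simp)
  show "bounded_linear (\<lambda>x::l2. Abs_ell2 (\<lambda>k. if Q k then ell2_nth x (g k) else 0))"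
  proof (rule bounded_linear_intro[of _ 1])
    fix x y :: l2 and r :: real
    show "Abs_ell2 (\<lambda>k. if Q k then ell2_nth (x + y) (g k) else 0)
        = Abs_ell2 (\<lambda>k. if Q k then ell2_nth x (g k) else 0)
        + Abs_ell2 (\<lambda>k. if Q k then ell2_nth y (g k) else 0)"
      by (rule ell2_eqI) (simp add: nth plus_ell2.rep_eq)
    show "Abs_ell2 (\<lambda>k. if Q k then ell2_nth (r *\<^sub>R x) (g k) else 0)
        = r *\<^sub>R Abs_ell2 (\<lambda>k. if Q k then ell2_nth x (g k) else 0)"
      by (rule ell2_eqI) (simp add: nth scaleR_ell2.rep_eq)
    show "norm (Abs_ell2 (\<lambda>k. if Q k then ell2_nth x (g k) else 0)) \<le> norm x * 1"
      unfolding norm_ell2.rep_eq nth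
      using suminf_le_const[OF sm part] by simp
  qed
qed

definition trunc :: "nat \<Rightarrow> op"
  where "trunc n = Blinfun (\<lambda>x. Abs_ell2 (\<lambda>k. if k < n then ell2_nth x k else 0))"

definition reflection :: "nat \<Rightarrow> op"
  where "reflection n = Blinfun (\<lambda>x. Abs_ell2 (\<lambda>k. if k < n then ell2_nth x (n - 1 - k) else 0))"

definition cuntz_isom :: "nat \<Rightarrow> nat \<Rightarrow> op"
  where "cuntz_isom N i =
    Blinfun (\<lambda>x. Abs_ell2 (\<lambda>k. if k mod N = i then ell2_nth x (k div N) else 0))"

lemma trunc_nth: "ell2_nth (trunc n x) k = (if k < n then ell2_nth x k else 0)"
proof -
  have inj: "inj_on (\<lambda>k. k) {k. k < n}" by simp
  show ?thesis
    unfolding trunc_def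
    using bounded_linear_reindex[OF inj]
    by (simp add: bounded_linear_Blinfun_apply Abs_ell2_inverse)
qed

lemma reflection_nth:
  "ell2_nth (reflection n x) k = (if k < n then ell2_nth x (n - 1 - k) else 0)"
proof -
  have inj: "inj_on (\<lambda>k. n - 1 - k) {k. k < n}" by (auto simp: inj_on_def)
  show ?thesis
    unfolding reflection_def
    using bounded_linear_reindex[OF inj]
    by (simp add: bounded_linear_Blinfun_apply Abs_ell2_inverse)
qed

lemma cuntz_isom_nth:
  "ell2_nth (cuntz_isom N i x) k = (if k mod N = i then ell2_nth x (k div N) else 0)"
proof -
  have inj: "inj_on (\<lambda>k. k div N) {k. k mod N = i}"
    by (rule inj_onI) (metis div_mod_decomp mem_Collect_eq)
  show ?thesis
    unfolding cuntz_isom_def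
    using bounded_linear_reindex[OF inj]
    by (simp add: bounded_linear_Blinfun_apply Abs_ell2_inverse)
qed


section \<open>The Cuntz algebra\<close>

definition cstar_subalgebra :: "op set \<Rightarrow> bool"
  where "cstar_subalgebra X \<longleftrightarrow>
    X \<subseteq> bounded_ops \<and> 0 \<in> X \<and>
    (\<forall>A\<in>X. \<forall>B\<in>X. A + B \<in> X \<and> A o\<^sub>L B \<in> X) \<and>
    (\<forall>c. \<forall>A\<in>X. op_scaleC c A \<in> X) \<and>
    (\<forall>A\<in>X. adj A \<in> X) \<and> closed X"

definition cuntz_algebra :: "nat \<Rightarrow> op set"
  where "cuntz_algebra N = \<Inter>{X. cstar_subalgebra X \<and> cuntz_isom N ` {..<N} \<subseteq> X}"


section \<open>Algebras of matrix sequences\<close>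

text \<open>An \<open>m \<times> m\<close> matrix is identified with the operator it induces on the image of
  \<^term>\<open>trunc m\<close>, extended by zero to \<open>l\<^sup>2\<close>. The identity matrix becomes \<^term>\<open>trunc m\<close>;
  norms, products and adjoints are those of operators on \<open>l\<^sup>2\<close>.\<close>

definition matrix_ops :: "nat \<Rightarrow> op set"
  where "matrix_ops m = {A \<in> bounded_ops. trunc m o\<^sub>L A o\<^sub>L trunc m = A}"

definition matrix_inverse :: "nat \<Rightarrow> op \<Rightarrow> op \<Rightarrow> bool"
  where "matrix_inverse m A B \<longleftrightarrow>
    B \<in> matrix_ops m \<and> A o\<^sub>L B = trunc m \<and> B o\<^sub>L A = trunc m"

definition F_eta :: "nat \<Rightarrow> (nat \<Rightarrow> op) set"
  where "F_eta N = {A. (\<forall>n. A n \<in> matrix_ops (N ^ n)) \<and> bounded (range A)}"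

definition G_eta :: "nat \<Rightarrow> (nat \<Rightarrow> op) set"
  where "G_eta N = {A \<in> F_eta N. (\<lambda>n. norm (A n)) \<longlonglongrightarrow> 0}"

definition stable_seq :: "nat \<Rightarrow> (nat \<Rightarrow> op) \<Rightarrow> bool"
  where "stable_seq N A \<longleftrightarrow>
    (\<exists>n0 M. \<forall>n\<ge>n0. \<exists>B. matrix_inverse (N ^ n) (A n) B \<and> norm B \<le> M)"

text \<open>Closedness with respect to the supremum norm is closedness under uniform limits.\<close>

definition seq_cstar_subalgebra :: "nat \<Rightarrow> (nat \<Rightarrow> op) set \<Rightarrow> bool"
  where "seq_cstar_subalgebra N X \<longleftrightarrow>
    X \<subseteq> F_eta N \<and> (\<lambda>n. 0) \<in> X \<and>
    (\<forall>A\<in>X. \<forall>B\<in>X. (\<lambda>n. A n + B n) \<in> X \<and> (\<lambda>n. A n o\<^sub>L B n) \<in> X) \<and>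
    (\<forall>c. \<forall>A\<in>X. (\<lambda>n. op_scaleC c (A n)) \<in> X) \<and>
    (\<forall>A\<in>X. (\<lambda>n. adj (A n)) \<in> X) \<and>
    (\<forall>B A. (\<forall>k. B k \<in> X) \<and> uniform_limit UNIV B A sequentially \<longrightarrow> A \<in> X)"

definition compressions :: "nat \<Rightarrow> op \<Rightarrow> nat \<Rightarrow> op"
  where "compressions N A n = trunc (N ^ n) o\<^sub>L A o\<^sub>L trunc (N ^ n)"

definition S_eta :: "nat \<Rightarrow> (nat \<Rightarrow> op) set"
  where "S_eta N =
    \<Inter>{X. seq_cstar_subalgebra N X \<and> compressions N ` cuntz_algebra N \<subseteq> X}"

definition S_eta_ring :: "nat \<Rightarrow> (nat \<Rightarrow> op) ring"
  where "S_eta_ring N =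
    \<lparr>carrier = S_eta N, mult = (\<lambda>A B n. A n o\<^sub>L B n), one = (\<lambda>n. trunc (N ^ n)),
     zero = (\<lambda>n. 0), add = (\<lambda>A B n. A n + B n)\<rparr>"


section \<open>The quotient algebra and the representation \<open>W\<close>\<close>

definition S_quot :: "nat \<Rightarrow> (nat \<Rightarrow> op) set ring"
  where "S_quot N = S_eta_ring N Quot G_eta N"

definition seq_class :: "nat \<Rightarrow> (nat \<Rightarrow> op) \<Rightarrow> (nat \<Rightarrow> op) set"
  where "seq_class N A = G_eta N +>\<^bsub>S_eta_ring N\<^esub> A"

definition quot_adj :: "(nat \<Rightarrow> op) set \<Rightarrow> (nat \<Rightarrow> op) set"
  where "quot_adj a = (\<lambda>A n. adj (A n)) ` a"

definition s0 :: "nat \<Rightarrow> (nat \<Rightarrow> op) set"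
  where "s0 N = seq_class N (compressions N (cuntz_isom N 0))"

definition p1 :: "nat \<Rightarrow> (nat \<Rightarrow> op) set"
  where "p1 N = quot_adj (s0 N) \<otimes>\<^bsub>S_quot N\<^esub> s0 N"

text \<open>The projection \<open>e - p\<^sub>1\<close>.\<close>

definition q1 :: "nat \<Rightarrow> (nat \<Rightarrow> op) set"
  where "q1 N = \<one>\<^bsub>S_quot N\<^esub> \<ominus>\<^bsub>S_quot N\<^esub> p1 N"

definition slim :: "(nat \<Rightarrow> op) \<Rightarrow> op"
  where "slim A = (THE V :: op. \<forall>x. (\<lambda>n. A n x) \<longlonglongrightarrow> V x)"

definition W00 :: "nat \<Rightarrow> (nat \<Rightarrow> op) set \<Rightarrow> op"
  where "W00 N a =
    (let A = (SOME A. A \<in> S_eta N \<and>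
                seq_class N A = q1 N \<otimes>\<^bsub>S_quot N\<^esub> a \<otimes>\<^bsub>S_quot N\<^esub> q1 N)
     in slim (\<lambda>n. reflection (N ^ n) o\<^sub>L A n o\<^sub>L reflection (N ^ n)))"

definition W :: "nat \<Rightarrow> nat \<Rightarrow> nat \<Rightarrow> (nat \<Rightarrow> op) set \<Rightarrow> op"
  where "W N i j a =
    op_pow (adj (cuntz_isom N (N - 1))) i
    o\<^sub>L W00 N (q1 N \<otimes>\<^bsub>S_quot N\<^esub> (s0 N [^]\<^bsub>S_quot N\<^esub> i) \<otimes>\<^bsub>S_quot N\<^esub> a
             \<otimes>\<^bsub>S_quot N\<^esub> (quot_adj (s0 N) [^]\<^bsub>S_quot N\<^esub> j) \<otimes>\<^bsub>S_quot N\<^esub> q1 N)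
    o\<^sub>L op_pow (cuntz_isom N (N - 1)) j"

text \<open>The operator on \<open>l\<^sup>2(\<int>\<^sup>+, l\<^sup>2(\<int>\<^sup>+))\<close> acting by the matrix \<^term>\<open>\<lambda>i j. W N i j a\<close>.\<close>

definition W_tilde :: "nat \<Rightarrow> (nat \<Rightarrow> op) set \<Rightarrow> (l2 ell2 \<Rightarrow>\<^sub>L l2 ell2)"
  where "W_tilde N a =
    (THE T :: l2 ell2 \<Rightarrow>\<^sub>L l2 ell2. \<forall>x i. (\<lambda>j. W N i j a (ell2_nth x j)) sums ell2_nth (T x) i)"

end

theory Submission
  imports Defs
begin

text \<open>Let \<open>T\<^sub>i\<close> be the operator on \<open>l\<^sup>2(\<int>\<^sup>+, l\<^sup>2(\<int>\<^sup>+))\<close> that shifts the outer index backwards and applies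
  \<open>S\<^sub>N\<^sub>-\<^sub>1\<^sub>-\<^sub>i\<close> to the entries. There are isometries \<open>U\<^sub>n\<close> from the image of \<open>P\<^bsub>N^n\<^esub>\<close> into this space which
  asymptotically (in norm) intertwine the compression of \<open>S\<^sub>i\<close> with \<open>T\<^sub>i\<close>, and that of \<open>S\<^sub>i\<^sup>*\<close> with \<open>T\<^sub>i\<^sup>*\<close>.
  The sequences \<open>A\<close> with \<open>\<parallel>U\<^sub>n A\<^sub>n - X U\<^sub>n\<parallel> \<rightarrow> 0\<close> for some \<open>X\<close> therefore include all of \<open>S\<^sub>\<eta>\<close>. On basis vectors
  with large index \<open>U\<^sub>n\<close> is the identification underlying the definition of \<open>W\<^sub>i\<^sub>j\<close>, which forces
  \<open>X = W_tilde\<close>. If \<open>X\<close> is invertible, then \<open>\<parallel>A\<^sub>n x\<parallel> = \<parallel>U\<^sub>n A\<^sub>n x\<parallel> \<approx> \<parallel>X U\<^sub>n x\<parallel>\<close> bounds the matrices \<open>A\<^sub>n\<close> from below,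
  so they have uniformly bounded inverses. Conversely, every vector is a limit of vectors
  \<open>U\<^sub>n y\<^sub>n\<close>; for stable \<open>A\<close> this makes \<open>X\<close> bounded from below, and \<open>X U\<^sub>n A\<^sub>n\<^sup>-\<^sup>1 y\<^sub>n \<approx> U\<^sub>n y\<^sub>n\<close> makes its range
  dense.\<close>

section \<open>The Banach space \<open>l\<^sup>2(\<int>\<^sup>+, X)\<close>\<close>

text \<open>The obstacle is the zero word. Cutting off all leading zeros intertwines the compression
  of \<open>S_i\<close> with the shift exactly, except that \<open>S_0\<close> fixes the index 0,
  while the corresponding shift has no nonzero fixed vector, its powers tending strongly to 0. The
  zero word can therefore only be sent to an approximate fixed vector, spread over many outer
  indices; uniform weights on K of them give an error of order 1 / sqrt K. Words of nearly full
  length must stay unspread, because \<open>W\<close> is read off from them exactly. The weights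
  pass from one regime to the other in about n / 2 steps of equal size, each with an error of the
  same order, and K = n div 2 balances both effects: every error is at most sqrt (2 / (n div 2)).
  Convergence in norm matters for the way back: strong convergence carries bounds from the matrices
  to X, but a lower bound of X reaches all vectors of the single matrices only through a uniform
  estimate.\<close>

lemma norm_ell2_sq: "(norm x)\<^sup>2 = (\<Sum>k. (norm (ell2_nth x k))\<^sup>2)"
  by (simp add: norm_ell2.rep_eq suminf_nonneg summable_norm_sq_ell2)

lemma sum_norm_sq_le:
  assumes "finite F"
  shows "(\<Sum>k\<in>F. (norm (ell2_nth x k))\<^sup>2) \<le> (norm x)\<^sup>2"
  unfolding norm_ell2_sq
  by (intro sum_le_suminf summable_norm_sq_ell2 assms) auto

lemma norm_ell2_nth_le: "norm (ell2_nth x k) \<le> norm x"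
proof (rule power2_le_imp_le)
  show "(norm (ell2_nth x k))\<^sup>2 \<le> (norm x)\<^sup>2"
    using sum_norm_sq_le[of "{k}" x] by simp
qed simp

lemma norm_ell2_le:
  assumes "\<And>n. (\<Sum>k<n. (norm (ell2_nth x k))\<^sup>2) \<le> C\<^sup>2" "0 \<le> C"
  shows "norm x \<le> C"
proof (rule power2_le_imp_le)
  show "(norm x)\<^sup>2 \<le> C\<^sup>2"
    unfolding norm_ell2_sq by (intro suminf_le_const summable_norm_sq_ell2 assms)
qed fact

lemma norm_ell2_finite:
  assumes "\<And>k. k \<ge> n \<Longrightarrow> ell2_nth x k = 0"
  shows "(norm x)\<^sup>2 = (\<Sum>k<n. (norm (ell2_nth x k))\<^sup>2)"
  unfolding norm_ell2_sq by (rule suminf_finite) (use assms in \<open>auto simp: not_less\<close>)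

lemma ell2_nth_Abs:
  assumes "\<And>n. (\<Sum>k<n. (norm (f k))\<^sup>2) \<le> C"
  shows "ell2_nth (Abs_ell2 f) = f"
proof (rule Abs_ell2_inverse)
  have "summable (\<lambda>k. (norm (f k))\<^sup>2)"
    by (rule bounded_imp_summable[of _ C]) (use assms[of "Suc n" for n] in \<open>auto simp: lessThan_Suc_atMost\<close>)
  then show "f \<in> {x. summable (\<lambda>k. (norm (x k))\<^sup>2)}" by simp
qed

lemma bounded_linear_ell2_nth: "bounded_linear (\<lambda>x. ell2_nth x k)"
  by (rule bounded_linear_intro[of _ 1])
    (auto simp: plus_ell2.rep_eq scaleR_ell2.rep_eq norm_ell2_nth_le)

lemmas ell2_nth_tendsto = bounded_linear.tendsto[OF bounded_linear_ell2_nth]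

lemmas ell2_nth_simps = zero_ell2.rep_eq plus_ell2.rep_eq minus_ell2.rep_eq uminus_ell2.rep_eq
  scaleC_ell2.rep_eq scaleR_ell2.rep_eq

lemma ell2_nth_sum: "ell2_nth (sum f A) k = (\<Sum>a\<in>A. ell2_nth (f a) k)"
  by (induction A rule: infinite_finite_induct) (auto simp: ell2_nth_simps)

lemma scaleC_zero [simp]: "c *\<^sub>C (0::'a::complex_normed_vector) = 0"
  using norm_scaleC[of c "0::'a"] by simp

lemma zero_scaleC [simp]: "0 *\<^sub>C (x::'a::complex_normed_vector) = 0"
  using norm_scaleC[of 0 x] by simp

lemma scaleC_minus_one: "(-1) *\<^sub>C x = - (x::'a::complex_normed_vector)"
  using scaleC_of_real[of "-1" x] by simp

lemma bounded_linear_scaleC: "bounded_linear (\<lambda>x::'a::complex_normed_vector. c *\<^sub>C x)"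
proof (rule bounded_linear_intro[of _ "cmod c"])
  show "c *\<^sub>C (r *\<^sub>R x) = r *\<^sub>R c *\<^sub>C x" for r and x :: 'a
    by (simp add: scaleC_of_real[symmetric] scaleC_scaleC mult.commute)
qed (auto simp: scaleC_add_right norm_scaleC mult.commute)

text \<open>The Cauchy estimate passes to every finite partial sum of the coordinatewise limit,
  hence to the norm. Completeness serves twice later: for limits of the intertwined operators, and
  to turn a dense range into surjectivity. Applied to itself, the instance covers the iterated
  space.\<close>

instance ell2 :: ("{complex_normed_vector, banach}") banach
proof
  fix X :: "nat \<Rightarrow> 'a ell2"
  assume X: "Cauchy X"
  have "Cauchy (\<lambda>n. ell2_nth (X n) k)" for k
    by (rule bounded_linear.Cauchy[OF bounded_linear_ell2_nth X])
  then have "\<exists>l. (\<lambda>n. ell2_nth (X n) k) \<longlonglongrightarrow> l" for k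
    by (simp add: Cauchy_convergent_iff convergent_def)
  then obtain l where l: "\<And>k. (\<lambda>n. ell2_nth (X n) k) \<longlonglongrightarrow> l k" by metis
  have tail: "(\<Sum>k<m. (norm (ell2_nth (X n) k - l k))\<^sup>2) \<le> e\<^sup>2"
    if M: "\<And>n n'. n \<ge> M \<Longrightarrow> n' \<ge> M \<Longrightarrow> norm (X n - X n') \<le> e" and "n \<ge> M" for m n M e
  proof (rule tendsto_upperbound)
    show "(\<lambda>n'. \<Sum>k<m. (norm (ell2_nth (X n) k - ell2_nth (X n') k))\<^sup>2)
        \<longlonglongrightarrow> (\<Sum>k<m. (norm (ell2_nth (X n) k - l k))\<^sup>2)"
      by (intro tendsto_intros l)
    have "(\<Sum>k<m. (norm (ell2_nth (X n) k - ell2_nth (X n') k))\<^sup>2) \<le> e\<^sup>2" if "n' \<ge> M" for n'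
    proof -
      have "(\<Sum>k<m. (norm (ell2_nth (X n) k - ell2_nth (X n') k))\<^sup>2) \<le> (norm (X n - X n'))\<^sup>2"
        using sum_norm_sq_le[of "{..<m}" "X n - X n'"] by (simp add: ell2_nth_simps)
      also have "\<dots> \<le> e\<^sup>2" using M[OF \<open>n \<ge> M\<close> that] by (intro power_mono) auto
      finally show ?thesis .
    qed
    then show "\<forall>\<^sub>F n' in sequentially.
        (\<Sum>k<m. (norm (ell2_nth (X n) k - ell2_nth (X n') k))\<^sup>2) \<le> e\<^sup>2"
      by (auto simp: eventually_sequentially)
  qed simp
  have Cau: "\<exists>M. \<forall>n\<ge>M. \<forall>n'\<ge>M. norm (X n - X n') \<le> e" if "e > 0" for e
    using CauchyD[OF X that] by (meson less_imp_le)
  obtain M where M: "\<And>n n'. n \<ge> M \<Longrightarrow> n' \<ge> M \<Longrightarrow> norm (X n - X n') \<le> 1"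
    using Cau[of 1] by auto
  \<comment> \<open>Square summability of \<open>l\<close> is not known yet. The difference from one
    late member \<open>X M\<close> is square summable by \<open>tail\<close>, and subtracting it
    from \<open>X M\<close> leaves a vector with coordinates \<open>l\<close>.\<close>
  define d where "d = Abs_ell2 (\<lambda>k. ell2_nth (X M) k - l k)"
  have d: "ell2_nth d = (\<lambda>k. ell2_nth (X M) k - l k)"
    unfolding d_def by (rule ell2_nth_Abs[where C = "1\<^sup>2"]) (rule tail[OF M order_refl])
  define x where "x = X M - d"
  have x: "ell2_nth x k = l k" for k by (simp add: x_def d ell2_nth_simps)
  have "X \<longlonglongrightarrow> x"
  proof (rule LIMSEQ_I)
    fix r :: real assume "r > 0"
    then obtain M' where M': "\<And>n n'. n \<ge> M' \<Longrightarrow> n' \<ge> M' \<Longrightarrow> norm (X n - X n') \<le> r / 2"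
      using Cau[of "r / 2"] by auto
    have "norm (X n - x) \<le> r / 2" if "n \<ge> M'" for n
      using tail[OF M' that] \<open>r > 0\<close> by (intro norm_ell2_le) (auto simp: x ell2_nth_simps)
    then show "\<exists>no. \<forall>n\<ge>no. norm (X n - x) < r"
      using \<open>r > 0\<close> by (intro exI[of _ M']) force
  qed
  then show "convergent X" by (auto simp: convergent_def)
qed

section \<open>Vectors with a single entry, and expansions in them\<close>

lift_definition ell2_single :: "nat \<Rightarrow> 'a::complex_normed_vector \<Rightarrow> 'a ell2"
  is "\<lambda>j v k. if k = j then v else 0"
proof -
  fix j :: nat and v :: 'a
  show "summable (\<lambda>k. (norm (if k = j then v else 0))\<^sup>2)"
    by (rule summable_finite[of "{j}"]) auto
qed

lemma bounded_linear_ell2_single: "bounded_linear (ell2_single j)"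
proof (rule bounded_linear_intro[of _ 1])
  fix x :: 'a
  have "(norm (ell2_single j x))\<^sup>2 = (norm x)\<^sup>2"
    unfolding norm_ell2_sq ell2_single.rep_eq by (subst suminf_finite[of "{j}"]) auto
  then have "norm (ell2_single j x) \<le> norm x"
    by (rule power2_le_imp_le[OF eq_refl]) simp
  then show "norm (ell2_single j x) \<le> norm x * 1" by simp
qed (auto intro!: ell2_eqI simp: ell2_single.rep_eq ell2_nth_simps)

text \<open>Pythagoras for the orthogonal splitting into the first \<open>n\<close> entries and the
  tail.\<close>

lemma norm_ell2_split:
  "(norm (x - (\<Sum>j<n. ell2_single j (ell2_nth x j))))\<^sup>2 = (norm x)\<^sup>2 - (\<Sum>j<n. (norm (ell2_nth x j))\<^sup>2)"
proof -
  have nth: "ell2_nth (x - (\<Sum>j<n. ell2_single j (ell2_nth x j))) k = (if k < n then 0 else ell2_nth x k)" for k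
    by (auto simp: ell2_nth_simps ell2_nth_sum ell2_single.rep_eq)
  have "(\<Sum>k. (norm (ell2_nth x k))\<^sup>2)
      = (\<Sum>k. (norm (ell2_nth x (k + n)))\<^sup>2) + (\<Sum>j<n. (norm (ell2_nth x j))\<^sup>2)"
    by (rule suminf_split_initial_segment[OF summable_norm_sq_ell2])
  moreover have "(norm (x - (\<Sum>j<n. ell2_single j (ell2_nth x j))))\<^sup>2 = (\<Sum>k. (norm (ell2_nth x (k + n)))\<^sup>2)"
    using suminf_split_initial_segment[OF summable_norm_sq_ell2, of "x - (\<Sum>j<n. ell2_single j (ell2_nth x j))" n]
    by (simp add: norm_ell2_sq nth)
  ultimately show ?thesis by (simp add: norm_ell2_sq)
qed

lemma ell2_single_sums: "(\<lambda>j. ell2_single j (ell2_nth x j)) sums x"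
  unfolding sums_def
proof (rule LIM_zero_cancel)
  have "(\<lambda>n. \<Sum>j<n. (norm (ell2_nth x j))\<^sup>2) \<longlonglongrightarrow> (norm x)\<^sup>2"
    unfolding norm_ell2_sq using summable_norm_sq_ell2 by (rule summable_LIMSEQ)
  then have "(\<lambda>n. sqrt ((norm x)\<^sup>2 - (\<Sum>j<n. (norm (ell2_nth x j))\<^sup>2))) \<longlonglongrightarrow> sqrt ((norm x)\<^sup>2 - (norm x)\<^sup>2)"
    by (intro tendsto_intros)
  then have "(\<lambda>n. norm (x - (\<Sum>j<n. ell2_single j (ell2_nth x j)))) \<longlonglongrightarrow> 0"
    by (simp add: norm_ell2_split[symmetric])
  then show "(\<lambda>n. (\<Sum>j<n. ell2_single j (ell2_nth x j)) - x) \<longlonglongrightarrow> 0"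
    by (subst (asm) norm_minus_commute) (rule tendsto_norm_zero_cancel)
qed

text \<open>Constructs an operator from its coordinate functions: one bound on all partial sums
  yields both square summability and the operator norm. The adjoint and the two outer shifts are
  obtained this way.\<close>

lemma blinfun_ell2_exists:
  fixes f :: "'a::real_normed_vector \<Rightarrow> nat \<Rightarrow> 'b::complex_normed_vector"
  assumes add: "\<And>x y k. f (x + y) k = f x k + f y k"
    and scale: "\<And>r x k. f (r *\<^sub>R x) k = r *\<^sub>R f x k"
    and le: "\<And>x n. (\<Sum>k<n. (norm (f x k))\<^sup>2) \<le> (C * norm x)\<^sup>2" and C: "0 \<le> C"
  shows "\<exists>B :: 'a \<Rightarrow>\<^sub>L 'b ell2. norm B \<le> C \<and> (\<forall>x k. ell2_nth (blinfun_apply B x) k = f x k)"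
proof -
  have nth: "ell2_nth (Abs_ell2 (f x)) = f x" for x
    by (rule ell2_nth_Abs[OF le])
  have nrm: "norm (Abs_ell2 (f x)) \<le> C * norm x" for x
    using le C by (intro norm_ell2_le) (auto simp: nth)
  have bl: "bounded_linear (\<lambda>x. Abs_ell2 (f x))"
    by (rule bounded_linear_intro[of _ C])
      (use nrm in \<open>auto intro!: ell2_eqI simp: nth add scale ell2_nth_simps mult.commute\<close>)
  show ?thesis
  proof (intro exI[of _ "Blinfun (\<lambda>x. Abs_ell2 (f x))"] conjI allI)
    show "norm (Blinfun (\<lambda>x. Abs_ell2 (f x))) \<le> C"
      by (rule norm_blinfun_bound[OF C]) (simp add: bounded_linear_Blinfun_apply[OF bl] nrm)
    show "ell2_nth (Blinfun (\<lambda>x. Abs_ell2 (f x)) x) k = f x k" for x k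
      by (simp add: bounded_linear_Blinfun_apply[OF bl] nth)
  qed
qed

section \<open>Adjoints\<close>

lemma abs_summable_cinner: "summable (\<lambda>k. norm (ell2_nth x k * cnj (ell2_nth y k)))"
proof (rule summable_comparison_test')
  show "summable (\<lambda>k. (norm (ell2_nth x k))\<^sup>2 + (norm (ell2_nth y k))\<^sup>2)"
    by (intro summable_add summable_norm_sq_ell2)
  have "a * b \<le> a\<^sup>2 + b\<^sup>2" for a b :: real
    using zero_le_power2[of "a - b"] zero_le_power2[of "a + b"]
    unfolding power2_diff power2_sum by linarith
  then show "norm (norm (ell2_nth x k * cnj (ell2_nth y k)))
      \<le> (norm (ell2_nth x k))\<^sup>2 + (norm (ell2_nth y k))\<^sup>2" for k
    by (simp add: norm_mult)
qed

lemma summable_cinner: "summable (\<lambda>k. ell2_nth x k * cnj (ell2_nth y k))"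
  using abs_summable_cinner by (rule summable_norm_cancel)

lemma norm_cinner_le: "cmod (cinner x y) \<le> norm x * norm y"
proof -
  have "cmod (cinner x y) \<le> (\<Sum>k. norm (ell2_nth x k * cnj (ell2_nth y k)))"
    unfolding cinner_def by (rule summable_norm[OF abs_summable_cinner])
  also have "\<dots> \<le> norm x * norm y"
  proof (rule suminf_le_const[OF abs_summable_cinner])
    fix n
    have "(\<Sum>k<n. norm (ell2_nth x k * cnj (ell2_nth y k)))
        \<le> L2_set (\<lambda>k. norm (ell2_nth x k)) {..<n} * L2_set (\<lambda>k. norm (ell2_nth y k)) {..<n}"
      using L2_set_mult_ineq[of "\<lambda>k. norm (ell2_nth x k)" "\<lambda>k. norm (ell2_nth y k)" "{..<n}"]
      by (simp add: norm_mult)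
    also have "\<dots> \<le> norm x * norm y"
      unfolding L2_set_def
      by (intro mult_mono real_le_lsqrt sum_norm_sq_le) (auto simp: sum_nonneg)
    finally show "(\<Sum>k<n. norm (ell2_nth x k * cnj (ell2_nth y k))) \<le> norm x * norm y" .
  qed
  finally show ?thesis .
qed

lemma cinner_add_left: "cinner (x + y) z = cinner x z + cinner y z"
  unfolding cinner_def
  by (subst suminf_add) (auto simp: ell2_nth_simps algebra_simps summable_cinner)

lemma cinner_scaleC_left: "cinner (c *\<^sub>C x) y = c * cinner x y"
  unfolding cinner_def
  by (subst suminf_mult[symmetric]) (auto simp: ell2_nth_simps scaleC_complex_def mult.assoc summable_cinner)

lemma cinner_commute: "cinner y x = cnj (cinner x y)"
  unfolding cinner_def
  by (subst bounded_linear.suminf[OF bounded_linear_cnj summable_cinner]) (simp add: mult.commute)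

lemma cinner_add_right: "cinner z (x + y) = cinner z x + cinner z y"
  by (metis cinner_commute cinner_add_left complex_cnj_add)

lemma cinner_scaleC_right: "cinner x (c *\<^sub>C y) = cnj c * cinner x y"
  by (metis cinner_commute cinner_scaleC_left complex_cnj_mult)

lemma cinner_self: "cinner x x = of_real ((norm x)\<^sup>2)"
proof -
  have "cinner x x = (\<Sum>k. of_real ((norm (ell2_nth x k))\<^sup>2))"
    unfolding cinner_def by (simp add: complex_norm_square[symmetric] del: of_real_power)
  also have "\<dots> = of_real ((norm x)\<^sup>2)"
    unfolding norm_ell2_sq
    by (rule bounded_linear.suminf[OF bounded_linear_of_real summable_norm_sq_ell2, symmetric])
  finally show ?thesis .
qed

lemma bounded_linear_cinner_left: "bounded_linear (\<lambda>x. cinner x y)"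
proof (rule bounded_linear_intro[of _ "norm y"])
  show "cinner (r *\<^sub>R x) y = r *\<^sub>R cinner x y" for r x
    by (simp add: scaleC_of_real[symmetric] cinner_scaleC_left scaleC_complex_def)
qed (auto simp: cinner_add_left norm_cinner_le)

lemma bounded_linear_cinner_right: "bounded_linear (\<lambda>y. cinner x y)"
proof (rule bounded_linear_intro[of _ "norm x"])
  show "cinner x (r *\<^sub>R y) = r *\<^sub>R cinner x y" for r y
    by (simp add: scaleC_of_real[symmetric] cinner_scaleC_right scaleC_complex_def)
qed (auto simp: cinner_add_right norm_cinner_le mult.commute[of _ "norm x"])

lemmas cinner_diff_left = linear_diff[OF bounded_linear.linear[OF bounded_linear_cinner_left]]
lemmas cinner_diff_right = linear_diff[OF bounded_linear.linear[OF bounded_linear_cinner_right]]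

lemma cinner_single_left: "cinner (ell2_single k c) y = c * cnj (ell2_nth y k)"
  unfolding cinner_def by (subst suminf_finite[of "{k}"]) (auto simp: ell2_single.rep_eq)

lemma ell2_single_scaleC: "ell2_single k c = c *\<^sub>C ell2_single k (1::complex)"
  by (rule ell2_eqI) (simp add: ell2_single.rep_eq ell2_nth_simps scaleC_complex_def)

lemma cinner_right_eqI:
  assumes "\<And>x. cinner x y = cinner x z"
  shows "y = z"
  by (rule ell2_eqI) (use assms[of "ell2_single k 1" for k] in \<open>simp add: cinner_single_left\<close>)

section \<open>The closed algebra of complex-linear operators\<close>

lemma bounded_opsI: "(\<And>c x. blinfun_apply A (c *\<^sub>C x) = c *\<^sub>C A x) \<Longrightarrow> A \<in> bounded_ops"
  by (simp add: bounded_ops_def)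

lemma bounded_opsD: "A \<in> bounded_ops \<Longrightarrow> A (c *\<^sub>C x) = c *\<^sub>C A x"
  by (simp add: bounded_ops_def)

lemma zero_bounded_ops: "0 \<in> bounded_ops"
  by (rule bounded_opsI) simp

lemma id_bounded_ops: "id_blinfun \<in> bounded_ops"
  by (rule bounded_opsI) simp

lemma add_bounded_ops: "A \<in> bounded_ops \<Longrightarrow> B \<in> bounded_ops \<Longrightarrow> A + B \<in> bounded_ops"
  by (rule bounded_opsI) (simp add: blinfun.add_left bounded_opsD scaleC_add_right)

lemma uminus_bounded_ops: "A \<in> bounded_ops \<Longrightarrow> - A \<in> bounded_ops"
  by (rule bounded_opsI)
    (simp add: blinfun.minus_left bounded_opsD linear_neg[OF bounded_linear.linear[OF bounded_linear_scaleC]])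

lemma diff_bounded_ops: "A \<in> bounded_ops \<Longrightarrow> B \<in> bounded_ops \<Longrightarrow> A - B \<in> bounded_ops"
  using add_bounded_ops[OF _ uminus_bounded_ops] by fastforce

lemma compose_bounded_ops: "A \<in> bounded_ops \<Longrightarrow> B \<in> bounded_ops \<Longrightarrow> A o\<^sub>L B \<in> bounded_ops"
  by (rule bounded_opsI) (simp add: bounded_opsD)

lemma scaleC_bounded_ops: "A \<in> bounded_ops \<Longrightarrow> op_scaleC c A \<in> bounded_ops"
  by (rule bounded_opsI) (simp add: op_scaleC_apply bounded_opsD scaleC_scaleC mult.commute)

lemma closed_bounded_ops: "closed (bounded_ops :: ('a::complex_normed_vector \<Rightarrow>\<^sub>L 'a) set)"
  unfolding closed_sequential_limits
proof safe
  fix X :: "nat \<Rightarrow> 'a \<Rightarrow>\<^sub>L 'a" and A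
  assume X: "\<forall>n. X n \<in> bounded_ops" and lim: "X \<longlonglongrightarrow> A"
  show "A \<in> bounded_ops"
  proof (rule bounded_opsI, rule LIMSEQ_unique)
    fix c and x :: 'a
    show "(\<lambda>n. X n (c *\<^sub>C x)) \<longlonglongrightarrow> A (c *\<^sub>C x)"
      by (intro blinfun.tendsto lim tendsto_const)
    have "(\<lambda>n. c *\<^sub>C X n x) \<longlonglongrightarrow> c *\<^sub>C A x"
      by (intro bounded_linear.tendsto[OF bounded_linear_scaleC] blinfun.tendsto lim tendsto_const)
    then show "(\<lambda>n. X n (c *\<^sub>C x)) \<longlonglongrightarrow> c *\<^sub>C A x"
      using X by (simp add: bounded_opsD)
  qed
qed

lemmas bounded_ops_intros = zero_bounded_ops id_bounded_ops add_bounded_ops uminus_bounded_ops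
  diff_bounded_ops compose_bounded_ops scaleC_bounded_ops

section \<open>Existence and calculus of adjoints\<close>

lemma adj_eqI:
  fixes A B :: op
  assumes "\<And>x y. cinner (A x) y = cinner x (B y)"
  shows "adj A = B"
  unfolding adj_def
proof (rule the_equality)
  fix B' :: op assume "\<forall>x y. cinner (A x) y = cinner x (B' y)"
  then have "B' y = B y" for y
    by (intro cinner_right_eqI) (metis assms)
  then show "B' = B" by (rule blinfun_eqI)
qed (use assms in blast)

text \<open>The coordinates of the adjoint are forced to be the inner products of \<open>y\<close>
  with \<open>A (e k)\<close>; what needs proof is that they are square summable with the right
  bound, which follows by duality.\<close>

lemma adj_exists:
  fixes A :: op
  assumes A: "A \<in> bounded_ops"
  shows "\<exists>B\<in>bounded_ops. norm B \<le> norm A \<and> (\<forall>x y. cinner (blinfun_apply A x) y = cinner x (blinfun_apply B y))"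
proof -
  define e where "e k = ell2_single k (1::complex)" for k
  define f where "f y k = cinner y (A (e k))" for y k
  have "\<exists>B :: op. norm B \<le> norm A \<and> (\<forall>y k. ell2_nth (blinfun_apply B y) k = f y k)"
  proof (rule blinfun_ell2_exists)
    show "f (r *\<^sub>R x) k = r *\<^sub>R f x k" for r x k
      unfolding f_def by (rule linear_scale[OF bounded_linear.linear[OF bounded_linear_cinner_left]])
    fix y n
    \<comment> \<open>The truncated candidate for \<open>B y\<close> is its own test vector: its
      squared norm equals \<open>cinner y (A z)\<close>, and cancelling one factor
      \<open>norm z\<close> leaves a bound independent of \<open>n\<close>.\<close>
    define z where "z = (\<Sum>k<n. ell2_single k (f y k))"
    have z_nth: "ell2_nth z k = (if k < n then f y k else 0)" for k
      by (auto simp: z_def ell2_nth_sum ell2_single.rep_eq)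
    have nz: "(norm z)\<^sup>2 = (\<Sum>k<n. (norm (f y k))\<^sup>2)"
      by (subst norm_ell2_finite[of n]) (auto simp: z_nth)
    have "A z = (\<Sum>k<n. f y k *\<^sub>C A (e k))"
      unfolding z_def blinfun.sum_right by (subst ell2_single_scaleC) (simp add: bounded_opsD[OF A] e_def)
    then have "cinner y (A z) = (\<Sum>k<n. cnj (f y k) * f y k)"
      by (simp add: linear_sum[OF bounded_linear.linear[OF bounded_linear_cinner_right]] cinner_scaleC_right f_def)
    also have "\<dots> = of_real ((norm z)\<^sup>2)"
      unfolding nz of_real_sum by (intro sum.cong) (auto simp: complex_norm_square mult.commute simp del: of_real_power)
    finally have "(norm z)\<^sup>2 \<le> norm y * norm (A z)"
      using norm_cinner_le[of y "A z"] by (simp add: norm_power)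
    also have "\<dots> \<le> norm y * (norm A * norm z)"
      by (intro mult_left_mono norm_blinfun) auto
    finally have "norm z * norm z \<le> (norm A * norm y) * norm z"
      by (simp add: power2_eq_square mult_ac)
    then have "norm z \<le> norm A * norm y"
      by (cases "z = 0") auto
    then show "(\<Sum>k<n. (norm (f y k))\<^sup>2) \<le> (norm A * norm y)\<^sup>2"
      unfolding nz[symmetric] by (rule power_mono) simp
  qed (auto simp: f_def cinner_add_left)
  then obtain B :: op where nB: "norm B \<le> norm A" and B: "\<And>y k. ell2_nth (B y) k = f y k" by blast
  have "cinner (A x) y = cinner x (B y)" for x y
  proof -
    have "(\<lambda>k. cinner (A (ell2_single k (ell2_nth x k))) y) sums cinner (A x) y"
      by (intro bounded_linear.sums[OF bounded_linear_cinner_left] bounded_linear.sums[OF blinfun.bounded_linear_right]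
          ell2_single_sums)
    moreover have "cinner (A (ell2_single k (ell2_nth x k))) y = ell2_nth x k * cnj (ell2_nth (B y) k)" for k
    proof -
      have "cinner (A (e k)) y = cnj (ell2_nth (B y) k)"
        unfolding B f_def by (rule cinner_commute)
      then show ?thesis
        by (subst ell2_single_scaleC) (simp add: bounded_opsD[OF A] cinner_scaleC_left e_def)
    qed
    ultimately show ?thesis
      unfolding cinner_def[of x] by (simp add: sums_iff)
  qed
  moreover have "B \<in> bounded_ops"
    by (intro bounded_opsI ell2_eqI) (simp add: B f_def cinner_scaleC_left ell2_nth_simps scaleC_complex_def)
  ultimately show ?thesis using nB by blast
qed

context
  fixes A :: op
  assumes A: "A \<in> bounded_ops"
begin

lemma
  shows cinner_adj: "cinner (A x) y = cinner x (adj A y)"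
    and adj_bounded_ops: "adj A \<in> bounded_ops"
    and norm_adj_le: "norm (adj A) \<le> norm A"
proof -
  obtain B where B: "B \<in> bounded_ops" "norm B \<le> norm A" "\<And>x y. cinner (A x) y = cinner x (B y)"
    using adj_exists[OF A] by blast
  moreover have "adj A = B" by (rule adj_eqI) (rule B)
  ultimately show "cinner (A x) y = cinner x (adj A y)" "adj A \<in> bounded_ops" "norm (adj A) \<le> norm A"
    by auto
qed

lemma adj_adj: "adj (adj A) = A"
  by (rule adj_eqI) (metis cinner_commute cinner_adj)

lemma adj_scaleC: "adj (op_scaleC c A) = op_scaleC (cnj c) (adj A)"
  by (rule adj_eqI) (simp add: op_scaleC_apply cinner_scaleC_left cinner_scaleC_right cinner_adj)

end

lemma adj_add: "A \<in> bounded_ops \<Longrightarrow> B \<in> bounded_ops \<Longrightarrow> adj (A + B) = adj A + adj B"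
  by (rule adj_eqI) (simp add: blinfun.add_left cinner_add_left cinner_add_right cinner_adj)

lemma adj_diff: "A \<in> bounded_ops \<Longrightarrow> B \<in> bounded_ops \<Longrightarrow> adj (A - B) = adj A - adj B"
  by (rule adj_eqI) (simp add: blinfun.diff_left cinner_diff_left cinner_diff_right cinner_adj)

lemma adj_compose: "A \<in> bounded_ops \<Longrightarrow> B \<in> bounded_ops \<Longrightarrow> adj (A o\<^sub>L B) = adj B o\<^sub>L adj A"
  by (rule adj_eqI) (simp add: cinner_adj)

lemma adj_zero: "adj 0 = 0"
  by (rule adj_eqI) (simp add: cinner_def zero_ell2.rep_eq)

lemma adj_id: "adj id_blinfun = id_blinfun"
  by (rule adj_eqI) simp

section \<open>Truncations and norm estimates for operators\<close>

lemma trunc_bounded_ops: "trunc n \<in> bounded_ops"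
  by (intro bounded_opsI ell2_eqI) (simp add: trunc_nth ell2_nth_simps)

lemma trunc_trunc: "trunc m o\<^sub>L trunc n = trunc (min m n)"
  by (intro blinfun_eqI ell2_eqI) (simp add: trunc_nth)

lemma adj_trunc: "adj (trunc n) = trunc n"
proof (rule adj_eqI)
  show "cinner (trunc n x) y = cinner x (trunc n y)" for x y
    unfolding cinner_def by (rule arg_cong[where f = suminf]) (auto simp: trunc_nth)
qed

lemma norm_trunc_le: "norm (trunc n) \<le> 1"
proof (rule norm_blinfun_bound)
  fix x :: l2
  show "norm (trunc n x) \<le> 1 * norm x"
  proof (intro norm_ell2_le)
    fix m
    have "(\<Sum>k<m. (norm (ell2_nth (trunc n x) k))\<^sup>2) \<le> (\<Sum>k<m. (norm (ell2_nth x k))\<^sup>2)"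
      by (intro sum_mono) (auto simp: trunc_nth)
    also have "\<dots> \<le> (norm x)\<^sup>2" by (rule sum_norm_sq_le) simp
    finally show "(\<Sum>k<m. (norm (ell2_nth (trunc n x) k))\<^sup>2) \<le> (1 * norm x)\<^sup>2" by simp
  qed simp
qed simp

lemma norm_compose_le:
  assumes "norm A \<le> a" "norm B \<le> b"
  shows "norm (A o\<^sub>L B) \<le> a * b"
  using norm_blinfun_compose[of A B] mult_mono[OF assms(1,2)] norm_ge_zero[of A] norm_ge_zero[of B] assms
  by (smt (verit))

lemma norm_apply_le: "norm A \<le> a \<Longrightarrow> norm (blinfun_apply A x) \<le> a * norm x"
  using norm_blinfun[of A x] mult_right_mono[of "norm A" a "norm x"] by simp

lemma norm_op_scaleC_le: "norm (op_scaleC c A) \<le> cmod c * norm A"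
proof (rule norm_blinfun_bound)
  show "norm (op_scaleC c A x) \<le> cmod c * norm A * norm x" for x
    using mult_left_mono[OF norm_blinfun[of A x], of "cmod c"]
    by (simp add: op_scaleC_apply norm_scaleC mult_ac)
qed simp

lemma op_scaleC_bounded_linear: "bounded_linear (op_scaleC c)"
proof (rule bounded_linear_intro[of _ "cmod c"])
  show "norm (op_scaleC c A) \<le> norm A * cmod c" for A
    using norm_op_scaleC_le[of c A] by (simp add: mult.commute)
qed (auto intro!: blinfun_eqI simp: op_scaleC_apply blinfun.add_left blinfun.scaleR_left scaleC_add_right
      linear_scale[OF bounded_linear.linear[OF bounded_linear_scaleC]])

section \<open>Words in the Cuntz isometries\<close>

lemma cuntz_isom_bounded_ops: "cuntz_isom N i \<in> bounded_ops"
  by (intro bounded_opsI ell2_eqI) (simp add: cuntz_isom_nth ell2_nth_simps)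

lemma ell2_nth_adj:
  assumes "A \<in> bounded_ops"
  shows "ell2_nth (adj A y) k = cinner y (A (ell2_single k 1))"
proof -
  have "cinner (A (ell2_single k 1)) y = cnj (ell2_nth (adj A y) k)"
    by (simp add: cinner_adj[OF assms] cinner_single_left)
  then show ?thesis by (metis cinner_commute complex_cnj_cnj)
qed

lemma cuntz_adj_nth:
  assumes "i < N"
  shows "ell2_nth (adj (cuntz_isom N i) x) k = ell2_nth x (k * N + i)"
proof -
  have "cuntz_isom N i (ell2_single k 1) = ell2_single (k * N + i) 1"
  proof (rule ell2_eqI)
    fix m
    have "m mod N = i \<and> m div N = k \<longleftrightarrow> m = k * N + i"
      using assms by auto
    then show "ell2_nth (cuntz_isom N i (ell2_single k 1)) m = ell2_nth (ell2_single (k * N + i) 1) m"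
      by (auto simp: cuntz_isom_nth ell2_single.rep_eq)
  qed
  then have "ell2_nth (adj (cuntz_isom N i) x) k = cinner x (ell2_single (k * N + i) 1)"
    by (simp add: ell2_nth_adj[OF cuntz_isom_bounded_ops])
  also have "\<dots> = ell2_nth x (k * N + i)"
    by (subst cinner_commute) (simp add: cinner_single_left)
  finally show ?thesis .
qed

lemma cuntz_adj_isom:
  assumes "i < N" "j < N"
  shows "adj (cuntz_isom N i) o\<^sub>L cuntz_isom N j = (if i = j then id_blinfun else 0)"
  using assms
  by (auto intro!: blinfun_eqI ell2_eqI simp: cuntz_adj_nth cuntz_isom_nth zero_ell2.rep_eq)

lemma norm_cuntz_isom:
  assumes "i < N"
  shows "norm (cuntz_isom N i x) = norm x"
proof -
  have "complex_of_real ((norm (cuntz_isom N i x))\<^sup>2) = cinner x ((adj (cuntz_isom N i) o\<^sub>L cuntz_isom N i) x)"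
    unfolding cinner_self[symmetric] by (simp add: cinner_adj[OF cuntz_isom_bounded_ops])
  also have "\<dots> = complex_of_real ((norm x)\<^sup>2)"
    using cuntz_adj_isom[OF assms assms] by (simp add: cinner_self)
  finally have "(norm (cuntz_isom N i x))\<^sup>2 = (norm x)\<^sup>2"
    by (simp only: of_real_eq_iff)
  then show ?thesis by (simp add: power2_eq_iff_nonneg)
qed

lemma norm_cuntz_isom_le: "i < N \<Longrightarrow> norm (cuntz_isom N i) \<le> 1"
  by (rule norm_blinfun_bound) (auto simp: norm_cuntz_isom)

lemma norm_cuntz_adj_le: "i < N \<Longrightarrow> norm (adj (cuntz_isom N i)) \<le> 1"
  using norm_adj_le[OF cuntz_isom_bounded_ops] norm_cuntz_isom_le order_trans by blast

text \<open>Closing only under \<open>S\<^sub>i\<close> on the left and \<open>S\<^sub>i\<^sup>*\<close> on the right suffices to generate a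
  \<open>*\<close>-algebra, and it is what makes compressions factor: the compression of \<open>B S\<^sub>i\<close> or \<open>S\<^sub>i\<^sup>* B\<close>
  is not the product of the compressions.\<close>

inductive_set cuntz_poly :: "nat \<Rightarrow> op set" for N where
  one: "id_blinfun \<in> cuntz_poly N"
| left: "i < N \<Longrightarrow> B \<in> cuntz_poly N \<Longrightarrow> cuntz_isom N i o\<^sub>L B \<in> cuntz_poly N"
| right: "i < N \<Longrightarrow> B \<in> cuntz_poly N \<Longrightarrow> B o\<^sub>L adj (cuntz_isom N i) \<in> cuntz_poly N"
| add: "B \<in> cuntz_poly N \<Longrightarrow> C \<in> cuntz_poly N \<Longrightarrow> B + C \<in> cuntz_poly N"
| scale: "B \<in> cuntz_poly N \<Longrightarrow> op_scaleC c B \<in> cuntz_poly N"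

lemma cuntz_poly_bounded_ops: "B \<in> cuntz_poly N \<Longrightarrow> B \<in> bounded_ops"
  by (induction rule: cuntz_poly.induct)
    (auto intro!: bounded_ops_intros cuntz_isom_bounded_ops adj_bounded_ops)

lemma op_scaleC_zero: "op_scaleC 0 B = 0"
  by (rule blinfun_eqI) (simp add: op_scaleC_apply)

lemma op_scaleC_compose_left: "op_scaleC c A o\<^sub>L B = op_scaleC c (A o\<^sub>L B)"
  by (rule blinfun_eqI) (simp add: op_scaleC_apply)

lemma op_scaleC_compose_right: "A \<in> bounded_ops \<Longrightarrow> A o\<^sub>L op_scaleC c B = op_scaleC c (A o\<^sub>L B)"
  by (rule blinfun_eqI) (simp add: op_scaleC_apply bounded_opsD)

lemma blinfun_compose_add_left: "(A + B) o\<^sub>L C = (A o\<^sub>L C) + (B o\<^sub>L C)"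
  by (rule blinfun_eqI) (simp add: blinfun.add_left)

lemma blinfun_compose_add_right: "A o\<^sub>L (B + C) = (A o\<^sub>L B) + (A o\<^sub>L C)"
  by (rule blinfun_eqI) (simp add: blinfun.add_left blinfun.add_right)

lemma blinfun_compose_diff_left: "(A - B) o\<^sub>L C = (A o\<^sub>L C) - (B o\<^sub>L C)"
  by (rule blinfun_eqI) (simp add: blinfun.diff_left)

lemma blinfun_compose_diff_right: "A o\<^sub>L (B - C) = (A o\<^sub>L B) - (A o\<^sub>L C)"
  by (rule blinfun_eqI) (simp add: blinfun.diff_left blinfun.diff_right)

lemma blinfun_compose_id [simp]: "id_blinfun o\<^sub>L A = A" "A o\<^sub>L id_blinfun = A"
  by (auto intro: blinfun_eqI)

lemma blinfun_compose_assoc: "(A o\<^sub>L B) o\<^sub>L C = A o\<^sub>L (B o\<^sub>L C)"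
  by (rule blinfun_eqI) simp

lemma zero_cuntz_poly: "0 \<in> cuntz_poly N"
  using cuntz_poly.scale[OF cuntz_poly.one, of 0] by (simp add: op_scaleC_zero)

text \<open>An adjoint generator multiplied from the left cancels against a leading isometry by
  orthogonality of the ranges, and passes by everything appended on the right. This relation turns
  the one-sided closure rules into closure under products.\<close>

lemma cuntz_poly_adj_left:
  assumes "i < N"
  shows "B \<in> cuntz_poly N \<Longrightarrow> adj (cuntz_isom N i) o\<^sub>L B \<in> cuntz_poly N"
proof (induction rule: cuntz_poly.induct)
  case one
  then show ?case using cuntz_poly.right[OF assms cuntz_poly.one] by simp
next
  case (left j B)
  then show ?case
    using assms by (simp add: blinfun_compose_assoc[symmetric] cuntz_adj_isom zero_cuntz_poly)
next
  case (right j B)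
  then show ?case
    using cuntz_poly.right by (simp add: blinfun_compose_assoc[symmetric])
qed (auto intro: cuntz_poly.intros
      simp: blinfun_compose_add_right op_scaleC_compose_right adj_bounded_ops cuntz_isom_bounded_ops)

lemma cuntz_poly_compose:
  assumes C: "C \<in> cuntz_poly N" and "B \<in> cuntz_poly N"
  shows "B o\<^sub>L C \<in> cuntz_poly N"
  using assms(2) C
proof (induction arbitrary: C rule: cuntz_poly.induct)
  case (right i B)
  then show ?case by (simp add: blinfun_compose_assoc cuntz_poly_adj_left)
qed (auto intro: cuntz_poly.intros
      simp: blinfun_compose_assoc blinfun_compose_add_left op_scaleC_compose_left)

lemma cuntz_poly_adj: "B \<in> cuntz_poly N \<Longrightarrow> adj B \<in> cuntz_poly N"
proof (induction rule: cuntz_poly.induct)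
  case (right i B)
  then show ?case
    using cuntz_poly.left[of i N "adj B"]
    by (simp add: adj_compose adj_adj adj_bounded_ops cuntz_isom_bounded_ops cuntz_poly_bounded_ops)
qed (auto intro: cuntz_poly.intros
      simp: adj_id adj_compose adj_add adj_scaleC cuntz_isom_bounded_ops cuntz_poly_bounded_ops)

lemma closure_sequentialI:
  fixes l :: "'a::first_countable_topology"
  shows "(\<And>n. f n \<in> S) \<Longrightarrow> f \<longlonglongrightarrow> l \<Longrightarrow> l \<in> closure S"
  unfolding closure_sequential by (intro exI[of _ f]) simp

lemma cstar_subalgebra_closure_cuntz_poly: "cstar_subalgebra (closure (cuntz_poly N))"
proof -
  have sub: "closure (cuntz_poly N) \<subseteq> bounded_ops"
    using cuntz_poly_bounded_ops by (intro closure_minimal closed_bounded_ops) blast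
  have add: "A + B \<in> closure (cuntz_poly N)"
    if A: "A \<in> closure (cuntz_poly N)" and B: "B \<in> closure (cuntz_poly N)" for A B
  proof -
    obtain a b where "\<And>n. a n \<in> cuntz_poly N" "a \<longlonglongrightarrow> A" "\<And>n. b n \<in> cuntz_poly N" "b \<longlonglongrightarrow> B"
      using A B unfolding closure_sequential by blast
    then have "\<And>n. a n + b n \<in> cuntz_poly N" "(\<lambda>n. a n + b n) \<longlonglongrightarrow> A + B"
      by (auto intro: cuntz_poly.add tendsto_add)
    then show ?thesis by (rule closure_sequentialI)
  qed
  have mult: "A o\<^sub>L B \<in> closure (cuntz_poly N)"
    if A: "A \<in> closure (cuntz_poly N)" and B: "B \<in> closure (cuntz_poly N)" for A B
  proof -
    obtain a b where "\<And>n. a n \<in> cuntz_poly N" "a \<longlonglongrightarrow> A" "\<And>n. b n \<in> cuntz_poly N" "b \<longlonglongrightarrow> B"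
      using A B unfolding closure_sequential by blast
    then have "\<And>n. a n o\<^sub>L b n \<in> cuntz_poly N" "(\<lambda>n. a n o\<^sub>L b n) \<longlonglongrightarrow> (A o\<^sub>L B)"
      by (auto intro: cuntz_poly_compose bounded_bilinear.tendsto[OF bounded_bilinear_blinfun_compose])
    then show ?thesis by (rule closure_sequentialI)
  qed
  have scale: "op_scaleC c A \<in> closure (cuntz_poly N)" if A: "A \<in> closure (cuntz_poly N)" for c A
  proof -
    obtain a where "\<And>n. a n \<in> cuntz_poly N" "a \<longlonglongrightarrow> A"
      using A unfolding closure_sequential by blast
    then have "\<And>n. op_scaleC c (a n) \<in> cuntz_poly N" "(\<lambda>n. op_scaleC c (a n)) \<longlonglongrightarrow> op_scaleC c A"
      by (auto intro: cuntz_poly.scale bounded_linear.tendsto[OF op_scaleC_bounded_linear])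
    then show ?thesis by (rule closure_sequentialI)
  qed
  have adj: "adj A \<in> closure (cuntz_poly N)" if A: "A \<in> closure (cuntz_poly N)" for A
  proof -
    obtain a where a: "\<And>n. a n \<in> cuntz_poly N" "a \<longlonglongrightarrow> A"
      using A unfolding closure_sequential by blast
    have "norm (adj (a n) - adj A) \<le> norm (a n - A)" for n
    proof -
      have "a n \<in> bounded_ops" "A \<in> bounded_ops"
        using a(1) A sub cuntz_poly_bounded_ops by auto
      then show ?thesis
        using norm_adj_le[of "a n - A"] by (simp add: adj_diff diff_bounded_ops)
    qed
    then have "(\<lambda>n. adj (a n) - adj A) \<longlonglongrightarrow> 0"
      by (rule Lim_null_comparison[OF always_eventually[OF allI] tendsto_norm_zero[OF LIM_zero[OF a(2)]]])
    then have "(\<lambda>n. adj (a n)) \<longlonglongrightarrow> adj A" by (rule LIM_zero_cancel)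
    then show ?thesis by (rule closure_sequentialI[OF cuntz_poly_adj[OF a(1)]])
  qed
  show ?thesis
    unfolding cstar_subalgebra_def
    using sub add mult scale adj subsetD[OF closure_subset zero_cuntz_poly] by simp
qed

lemma cuntz_algebra_subset: "cuntz_algebra N \<subseteq> closure (cuntz_poly N)"
proof -
  have "cuntz_isom N i \<in> closure (cuntz_poly N)" if "i < N" for i
    using cuntz_poly.left[OF that cuntz_poly.one] closure_subset[of "cuntz_poly N"] by auto
  then show ?thesis
    unfolding cuntz_algebra_def
    by (intro Inter_lower) (use cstar_subalgebra_closure_cuntz_poly in auto)
qed

lemma cuntz_isom_algebra:
  assumes "i < N"
  shows "cuntz_isom N i \<in> cuntz_algebra N" "id_blinfun \<in> cuntz_algebra N"
proof -
  show "cuntz_isom N i \<in> cuntz_algebra N" using assms by (auto simp: cuntz_algebra_def)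
  have "adj (cuntz_isom N i) o\<^sub>L cuntz_isom N i \<in> X"
    if "cstar_subalgebra X" "cuntz_isom N ` {..<N} \<subseteq> X" for X
    using that assms unfolding cstar_subalgebra_def by blast
  then show "id_blinfun \<in> cuntz_algebra N"
    using cuntz_adj_isom[OF assms assms] by (simp add: cuntz_algebra_def)
qed

section \<open>Compressions and the algebra \<open>S\<^sub>\<eta>\<close>\<close>

text \<open>Entry \<open>k\<close> of the image is read from entry \<open>k div N\<close>, which is
  not larger than \<open>k\<close>. Hence entries beyond the truncation cannot influence the output
  below it.\<close>

lemma trunc_cuntz_isom: "trunc (N ^ n) o\<^sub>L cuntz_isom N i o\<^sub>L trunc (N ^ n) = trunc (N ^ n) o\<^sub>L cuntz_isom N i"
proof (intro blinfun_eqI ell2_eqI)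
  fix x k
  have "k div N \<le> k" by simp
  then show "ell2_nth ((trunc (N ^ n) o\<^sub>L cuntz_isom N i o\<^sub>L trunc (N ^ n)) x) k
      = ell2_nth ((trunc (N ^ n) o\<^sub>L cuntz_isom N i) x) k"
    by (auto simp: trunc_nth cuntz_isom_nth simp del: div_le_dividend)
qed

lemma adj_compression: "B \<in> bounded_ops \<Longrightarrow> adj (compressions N B n) = compressions N (adj B) n"
  by (simp add: compressions_def adj_compose adj_trunc trunc_bounded_ops compose_bounded_ops blinfun_compose_assoc)

lemma trunc_cuntz_adj: "trunc (N ^ n) o\<^sub>L adj (cuntz_isom N i) o\<^sub>L trunc (N ^ n) = adj (cuntz_isom N i) o\<^sub>L trunc (N ^ n)"
  using arg_cong[OF trunc_cuntz_isom[of N n i], of adj]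
  by (simp add: adj_compose adj_trunc trunc_bounded_ops compose_bounded_ops blinfun_compose_assoc cuntz_isom_bounded_ops)

lemma trunc_idem: "trunc n o\<^sub>L trunc n = trunc n"
  by (simp add: trunc_trunc)

lemma compression_left:
  "compressions N (cuntz_isom N i o\<^sub>L B) n = compressions N (cuntz_isom N i) n o\<^sub>L compressions N B n"
proof -
  let ?P = "trunc (N ^ n)" and ?S = "cuntz_isom N i"
  have "compressions N ?S n o\<^sub>L compressions N B n = (?P o\<^sub>L ?S o\<^sub>L (?P o\<^sub>L ?P)) o\<^sub>L B o\<^sub>L ?P"
    by (simp only: compressions_def blinfun_compose_assoc)
  also have "\<dots> = (?P o\<^sub>L ?S o\<^sub>L ?P) o\<^sub>L B o\<^sub>L ?P" by (simp only: trunc_idem)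
  also have "\<dots> = compressions N (?S o\<^sub>L B) n"
    by (subst trunc_cuntz_isom) (simp only: compressions_def blinfun_compose_assoc)
  finally show ?thesis by simp
qed

lemma compression_right:
  "compressions N (B o\<^sub>L adj (cuntz_isom N i)) n = compressions N B n o\<^sub>L compressions N (adj (cuntz_isom N i)) n"
proof -
  let ?P = "trunc (N ^ n)" and ?S = "adj (cuntz_isom N i)"
  have "compressions N B n o\<^sub>L compressions N ?S n = ?P o\<^sub>L B o\<^sub>L (?P o\<^sub>L ?P) o\<^sub>L ?S o\<^sub>L ?P"
    by (simp only: compressions_def blinfun_compose_assoc)
  also have "\<dots> = ?P o\<^sub>L B o\<^sub>L (?P o\<^sub>L ?S o\<^sub>L ?P)" by (simp only: trunc_idem blinfun_compose_assoc)
  also have "\<dots> = compressions N (B o\<^sub>L ?S) n"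
    by (subst trunc_cuntz_adj) (simp only: compressions_def blinfun_compose_assoc)
  finally show ?thesis by simp
qed

lemma norm_compression_le: "norm (compressions N B n) \<le> norm B"
  unfolding compressions_def
  using norm_compose_le[OF norm_compose_le[OF norm_trunc_le order_refl] norm_trunc_le] by simp

lemma compression_diff: "compressions N (A - B) n = compressions N A n - compressions N B n"
  by (simp add: compressions_def blinfun_compose_diff_left blinfun_compose_diff_right)

text \<open>Induction principle for \<open>S_eta\<close>. Compressions of words factor into
  compressions of generators, so polynomials land in \<open>Y\<close>; since compressing is
  contractive with a bound independent of \<open>n\<close>, norm limits in the Cuntz algebra become
  uniform limits of sequences.\<close>

lemma S_eta_least:
  assumes Y: "seq_cstar_subalgebra N Y" and one: "compressions N id_blinfun \<in> Y"
    and gen: "\<And>i. i < N \<Longrightarrow> compressions N (cuntz_isom N i) \<in> Y"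
  shows "S_eta N \<subseteq> Y"
proof -
  have Y_mult: "A \<in> Y \<Longrightarrow> B \<in> Y \<Longrightarrow> (\<lambda>n. A n o\<^sub>L B n) \<in> Y"
    and Y_add: "A \<in> Y \<Longrightarrow> B \<in> Y \<Longrightarrow> (\<lambda>n. A n + B n) \<in> Y"
    and Y_scale: "A \<in> Y \<Longrightarrow> (\<lambda>n. op_scaleC c (A n)) \<in> Y"
    and Y_adj: "A \<in> Y \<Longrightarrow> (\<lambda>n. adj (A n)) \<in> Y"
    and Y_lim: "(\<And>k. C k \<in> Y) \<Longrightarrow> uniform_limit UNIV C A sequentially \<Longrightarrow> A \<in> Y" for A B C c
    using Y unfolding seq_cstar_subalgebra_def by blast+
  have gen': "compressions N (adj (cuntz_isom N i)) \<in> Y" if "i < N" for i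
    using Y_adj[OF gen[OF that]] by (simp add: adj_compression[OF cuntz_isom_bounded_ops] cong: if_cong)
  have poly: "compressions N B \<in> Y" if "B \<in> cuntz_poly N" for B
    using that
  proof induction
    case (left i B)
    have "compressions N (cuntz_isom N i o\<^sub>L B) = (\<lambda>n. compressions N (cuntz_isom N i) n o\<^sub>L compressions N B n)"
      by (rule ext) (rule compression_left)
    then show ?case using Y_mult[OF gen[OF left.hyps(1)] left.IH] by simp
  next
    case (right i B)
    have "compressions N (B o\<^sub>L adj (cuntz_isom N i)) = (\<lambda>n. compressions N B n o\<^sub>L compressions N (adj (cuntz_isom N i)) n)"
      by (rule ext) (rule compression_right)
    then show ?case using Y_mult[OF right.IH gen'[OF right.hyps(1)]] by simp
  next
    case (add B C)
    have "compressions N (B + C) = (\<lambda>n. compressions N B n + compressions N C n)"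
      by (simp add: fun_eq_iff compressions_def blinfun_compose_add_left blinfun_compose_add_right)
    then show ?case using Y_add add.IH by simp
  next
    case (scale B c)
    have "compressions N (op_scaleC c B) = (\<lambda>n. op_scaleC c (compressions N B n))"
      by (simp add: fun_eq_iff compressions_def op_scaleC_compose_left op_scaleC_compose_right trunc_bounded_ops)
    then show ?case using Y_scale scale.IH by simp
  qed (rule one)
  have "compressions N A \<in> Y" if A: "A \<in> cuntz_algebra N" for A
  proof -
    obtain a where a: "\<And>k. a k \<in> cuntz_poly N" "a \<longlonglongrightarrow> A"
      using subsetD[OF cuntz_algebra_subset A] unfolding closure_sequential by blast
    show ?thesis
    proof (rule Y_lim)
      show "compressions N (a k) \<in> Y" for k by (rule poly) (rule a)
      show "uniform_limit UNIV (\<lambda>k. compressions N (a k)) (compressions N A) sequentially"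
      proof (rule uniform_limitI)
        fix e :: real assume "e > 0"
        with a(2) have "\<forall>\<^sub>F k in sequentially. dist (a k) A < e" by (rule tendstoD)
        then show "\<forall>\<^sub>F k in sequentially. \<forall>n\<in>UNIV. dist (compressions N (a k) n) (compressions N A n) < e"
        proof eventually_elim
          case (elim k)
          have "dist (compressions N (a k) n) (compressions N A n) \<le> dist (a k) A" for n
            using norm_compression_le[of N "a k - A" n] by (simp add: dist_norm compression_diff)
          then show ?case using elim order_le_less_trans by blast
        qed
      qed
    qed
  qed
  then show ?thesis unfolding S_eta_def using Y by blast
qed

lemma compression_S_eta: "A \<in> cuntz_algebra N \<Longrightarrow> compressions N A \<in> S_eta N"
  by (auto simp: S_eta_def)

lemma
  assumes "A \<in> S_eta N"
  shows S_eta_mult: "B \<in> S_eta N \<Longrightarrow> (\<lambda>n. A n o\<^sub>L B n) \<in> S_eta N"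
    and S_eta_add: "B \<in> S_eta N \<Longrightarrow> (\<lambda>n. A n + B n) \<in> S_eta N"
    and S_eta_scale: "(\<lambda>n. op_scaleC c (A n)) \<in> S_eta N"
    and S_eta_adj: "(\<lambda>n. adj (A n)) \<in> S_eta N"
  using assms unfolding S_eta_def seq_cstar_subalgebra_def by blast+

section \<open>Almost intertwining isometries\<close>

definition digits :: "nat \<Rightarrow> nat \<Rightarrow> nat"
  where "digits N I = (LEAST l. I < N ^ l)"

lemma digits_le_iff:
  assumes "N \<ge> 2"
  shows "digits N I \<le> l \<longleftrightarrow> I < N ^ l"
proof
  have ex: "I < N ^ I"
    using less_exp[of I] power_mono[OF assms, of I] by linarith
  assume "digits N I \<le> l"
  moreover have "I < N ^ digits N I"
    unfolding digits_def by (rule LeastI) (rule ex)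
  moreover have "N ^ digits N I \<le> N ^ l" if "digits N I \<le> l"
    using that assms by (intro power_increasing) auto
  ultimately show "I < N ^ l" by linarith
qed (auto simp: digits_def intro: Least_le)

text \<open>The index 0 has no digits, and truncated subtraction lets the equation hold for it as
  well. The zero word thus needs no separate case in the intertwining computations, only in the
  estimate of the weights.\<close>

lemma digits_div:
  assumes "N \<ge> 2"
  shows "digits N (I div N) = digits N I - 1"
proof -
  have "digits N (I div N) \<le> l \<longleftrightarrow> digits N I - 1 \<le> l" for l
  proof -
    have "digits N (I div N) \<le> l \<longleftrightarrow> I < N ^ l * N"
      using assms by (simp add: digits_le_iff less_mult_imp_div_less div_less_iff_less_mult)
    also have "\<dots> \<longleftrightarrow> digits N I \<le> Suc l"
      using digits_le_iff[OF assms, of I "Suc l"] by (simp add: mult.commute)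
    finally show ?thesis by auto
  qed
  then show ?thesis by (meson order_antisym order_refl)
qed

text \<open>An index \<open>I < N ^ n\<close> is a word of \<open>n\<close> digits with \<open>n - l\<close> leading zeros, \<open>l = digits N I\<close>.
  \<open>spread\<close> below cuts off the first \<open>m\<close> of them in superposition over \<open>m\<close>, leaving
  \<open>c = n - l - m\<close> zeros with probability \<open>mass n l c\<close>. For \<open>l \<ge> n - n div 2\<close> all zeros are cut off; as \<open>l\<close>
  decreases to \<open>0\<close> the distribution moves linearly to the uniform one on \<open>{1..n div 2}\<close>. So it
  varies slowly in \<open>l\<close>, and at \<open>l = 0\<close> also in \<open>c\<close>, which is needed because the compression of
  \<open>S\<^sub>0\<close> fixes the zero word.\<close>

definition mass :: "nat \<Rightarrow> nat \<Rightarrow> nat \<Rightarrow> real"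
  where "mass n l c =
    (let t = min 1 (real l / real (n - n div 2))
     in if c = 0 then t else if c \<le> n div 2 then (1 - t) / real (n div 2) else 0)"

text \<open>The square root makes the squares sum to one, so that \<open>spread\<close> is
  isometric. Here \<open>m\<close> counts the zeros cut off and \<open>n - l - m\<close> those kept;
  the guard excludes values where this subtraction would truncate.\<close>

definition amplitude :: "nat \<Rightarrow> nat \<Rightarrow> nat \<Rightarrow> real"
  where "amplitude n l m = (if l + m \<le> n then sqrt (mass n l (n - l - m)) else 0)"

lemma mass_nonneg: "0 \<le> mass n l c"
  by (auto simp: mass_def Let_def)

lemma mass_top:
  assumes "n \<ge> 2" "l \<ge> n - n div 2"
  shows "mass n l c = (if c = 0 then 1 else 0)"
proof -
  have "1 \<le> real l / real (n - n div 2)"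
    using assms by (subst le_divide_eq_1_pos) auto
  then show ?thesis by (simp add: mass_def Let_def min_def)
qed

lemma amplitude_top:
  assumes "n \<ge> 2" "l \<ge> n - n div 2" "l \<le> n"
  shows "amplitude n l m = (if m = n - l then 1 else 0)"
  using assms by (auto simp: amplitude_def mass_top)

text \<open>As long as some mass is away from \<open>c = 0\<close>, the number of kept zeros is at
  most \<open>n div 2\<close>, which is less than \<open>n - l\<close>; otherwise all zeros are cut
  off. Either way a word with a leading zero loses at least one. The adjoint shift never reaches
  outer index 0, so the images of words shortened by one digit have to vanish there.\<close>

lemma amplitude_0:
  assumes "n \<ge> 2" "l < n"
  shows "amplitude n l 0 = 0"
proof (cases "l \<ge> n - n div 2")
  case False
  then have "n - l \<noteq> 0" "\<not> n - l \<le> n div 2" using assms by auto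
  then show ?thesis by (simp add: amplitude_def mass_def)
qed (use assms amplitude_top[of n l 0] in auto)

lemma sum_atMost_flip: "(\<Sum>m\<le>M. f (M - m)) = (\<Sum>c\<le>M. f c)" for M :: nat
  using sum.nat_diff_reindex[of f "Suc M"] by (simp add: lessThan_Suc_atMost)

lemma sum_amplitude_eq:
  fixes g :: "nat \<Rightarrow> real"
  assumes "l \<le> n" "\<And>m. l + m > n \<Longrightarrow> g m = 0"
  shows "(\<Sum>m\<le>n. g m) = (\<Sum>c\<le>n - l. g (n - l - c))"
proof -
  have "(\<Sum>m\<le>n. g m) = (\<Sum>m\<le>n - l. g m)"
    using assms(1) by (intro sum.mono_neutral_right) (auto intro!: assms(2))
  also have "\<dots> = (\<Sum>m\<le>n - l. g (n - l - m))" by (rule sum_atMost_flip[symmetric])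
  finally show ?thesis .
qed

text \<open>Sums a profile of the shape of \<open>mass\<close>: one value at 0, a plateau of height
  \<open>b\<close> on \<open>1..K\<close>, zero beyond. The inequality covers ranges that end inside
  the plateau.\<close>

lemma sum_mass_le:
  fixes g :: "nat \<Rightarrow> real"
  assumes "\<And>c. c > K \<Longrightarrow> g c = 0" "\<And>c. 0 < c \<Longrightarrow> c \<le> K \<Longrightarrow> g c = b" "\<And>c. g c \<ge> 0"
  shows "(\<Sum>c\<le>M. g c) \<le> g 0 + real K * b"
    and "K \<le> M \<Longrightarrow> (\<Sum>c\<le>M. g c) = g 0 + real K * b"
proof -
  have K: "(\<Sum>c\<le>K. g c) = g 0 + real K * b"
    using assms(2) by (subst sum.atMost_shift) (simp add: lessThan_Suc_atMost)
  show eq: "K \<le> M \<Longrightarrow> (\<Sum>c\<le>M. g c) = g 0 + real K * b" for M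
    unfolding K[symmetric] by (rule sum.mono_neutral_right) (use assms(1) in auto)
  have "(\<Sum>c\<le>M. g c) \<le> (\<Sum>c\<le>max K M. g c)"
    using assms(3) by (intro sum_mono2) auto
  then show "(\<Sum>c\<le>M. g c) \<le> g 0 + real K * b"
    using eq[of "max K M"] by simp
qed

lemma sum_amplitude_sq:
  assumes "n \<ge> 2" "l \<le> n"
  shows "(\<Sum>m\<le>n. (amplitude n l m)\<^sup>2) = 1"
proof -
  have "(\<Sum>m\<le>n. (amplitude n l m)\<^sup>2) = (\<Sum>c\<le>n - l. (amplitude n l (n - l - c))\<^sup>2)"
    using assms by (intro sum_amplitude_eq) (auto simp: amplitude_def)
  also have "\<dots> = (\<Sum>c\<le>n - l. mass n l c)"
    using assms by (intro sum.cong) (auto simp: amplitude_def mass_nonneg)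
  also have "\<dots> = 1"
  proof (cases "l \<ge> n - n div 2")
    case True
    then show ?thesis using assms by (simp add: mass_top)
  next
    case False
    then have "(\<Sum>c\<le>n - l. mass n l c) = mass n l 0 + real (n div 2) * mass n l 1"
      using assms by (intro sum_mass_le) (auto simp: mass_nonneg, auto simp: mass_def)
    also have "\<dots> = 1" using assms by (simp add: mass_def Let_def)
    finally show ?thesis .
  qed
  finally show ?thesis .
qed

text \<open>Summed over \<open>c\<close>, this bounds the squared Hellinger distance of two
  distributions by their l1 distance, and so reduces the variation of amplitudes to that of
  masses.\<close>

lemma sqrt_diff_sq_le:
  fixes a b :: real
  assumes "0 \<le> a" "0 \<le> b"
  shows "(sqrt a - sqrt b)\<^sup>2 \<le> \<bar>a - b\<bar>"
proof -
  have "(sqrt a - sqrt b)\<^sup>2 = \<bar>sqrt a - sqrt b\<bar> * \<bar>sqrt a - sqrt b\<bar>"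
    by (simp add: power2_eq_square)
  also have "\<dots> \<le> \<bar>sqrt a - sqrt b\<bar> * \<bar>sqrt a + sqrt b\<bar>"
    using real_sqrt_ge_zero[OF assms(1)] real_sqrt_ge_zero[OF assms(2)]
    by (intro mult_left_mono) linarith+
  also have "\<dots> = \<bar>a - b\<bar>"
  proof -
    have "(sqrt a - sqrt b) * (sqrt a + sqrt b) = a - b"
      using assms by (simp add: algebra_simps)
    then show ?thesis by (metis abs_mult)
  qed
  finally show ?thesis .
qed

text \<open>The intertwining error at a word with \<open>l\<close> digits. Appending a digit raises
  \<open>l\<close> by one and the shift lowers \<open>m\<close> by one, so both amplitudes belong to
  the same number of kept zeros. For \<open>l = 0\<close> the truncated \<open>l - 1\<close> is
  again 0, in accordance with \<open>S_0\<close> fixing the zero word.\<close>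

definition slope :: "nat \<Rightarrow> nat \<Rightarrow> nat \<Rightarrow> real"
  where "slope n l m = amplitude n l m - amplitude n (l - 1) (m + 1)"

text \<open>For a nonzero word, one step moves the weight \<open>t\<close> by at most
  \<open>1 / (n - n div 2)\<close>, and the masses by at most twice that in l1. For the zero word it
  is \<open>c\<close> that moves by one, and a uniform distribution differs from its translate only
  at the two ends. Both effects are within the same bound.\<close>

lemma sum_slope_sq:
  assumes n: "n \<ge> 2"
  shows "(\<Sum>m\<le>n. (slope n l m)\<^sup>2) \<le> 2 / real (n div 2)"
proof (cases "l = 0 \<or> l > n")
  case False
  then have l: "1 \<le> l" "l \<le> n" by auto
  define t where "t = (\<lambda>l. min 1 (real l / real (n - n div 2)))"
  define d where "d = \<bar>t l - t (l - 1)\<bar>"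
  have "(\<Sum>m\<le>n. (slope n l m)\<^sup>2) = (\<Sum>c\<le>n - l. (slope n l (n - l - c))\<^sup>2)"
    using l by (intro sum_amplitude_eq) (auto simp: slope_def amplitude_def)
  also have "\<dots> \<le> (\<Sum>c\<le>n - l. \<bar>mass n l c - mass n (l - 1) c\<bar>)"
  proof (rule sum_mono)
    fix c assume "c \<in> {..n - l}"
    then have "slope n l (n - l - c) = sqrt (mass n l c) - sqrt (mass n (l - 1) c)"
      using l by (auto simp: slope_def amplitude_def)
    then show "(slope n l (n - l - c))\<^sup>2 \<le> \<bar>mass n l c - mass n (l - 1) c\<bar>"
      by (simp add: sqrt_diff_sq_le mass_nonneg)
  qed
  also have "\<dots> \<le> \<bar>mass n l 0 - mass n (l - 1) 0\<bar> + real (n div 2) * (d / real (n div 2))"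
  proof (intro sum_mass_le)
    fix c :: nat assume "0 < c" "c \<le> n div 2"
    then have "mass n l c - mass n (l - 1) c = (t (l - 1) - t l) / real (n div 2)"
      by (simp add: mass_def t_def diff_divide_distrib)
    then show "\<bar>mass n l c - mass n (l - 1) c\<bar> = d / real (n div 2)"
      by (simp add: d_def abs_divide abs_minus_commute)
  qed (auto simp: mass_def)
  also have "\<dots> = 2 * d"
    using n by (simp add: mass_def d_def t_def Let_def)
  also have "d \<le> 1 / real (n - n div 2)"
  proof -
    have "real l / real (n - n div 2) = real (l - 1) / real (n - n div 2) + 1 / real (n - n div 2)"
      using l by (simp add: add_divide_distrib[symmetric])
    moreover have "0 \<le> 1 / real (n - n div 2)" by simp
    ultimately show ?thesis unfolding d_def t_def by linarith
  qed
  also have "1 / real (n - n div 2) \<le> 1 / real (n div 2)"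
    using n by (intro divide_left_mono) auto
  finally show ?thesis by simp
next
  case True
  then show ?thesis
  proof
    assume "l > n"
    then show ?thesis by (simp add: slope_def amplitude_def)
  next
    assume l: "l = 0"
    define K where "K = n div 2"
    have K: "1 \<le> K" "K + 1 \<le> n" using n by (auto simp: K_def)
    have m0: "mass n 0 c = (if 1 \<le> c \<and> c \<le> K then 1 / real K else 0)" for c
      by (auto simp: mass_def K_def)
    \<comment> \<open>The values \<open>m = n - 1\<close> and \<open>m = n - K - 1\<close>
      correspond to \<open>c = 1\<close> and \<open>c = K + 1\<close>, the two ends where the
      uniform distribution on \<open>1..K\<close> and its translate disagree.\<close>
    have "(slope n 0 m)\<^sup>2 \<le> (if m = n - 1 then 1 / real K else 0) + (if m = n - K - 1 then 1 / real K else 0)"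
      if "m \<le> n" for m
    proof (cases "m = n - 1 \<or> m = n - K - 1")
      case True
      have "(slope n 0 m)\<^sup>2 \<le> \<bar>mass n 0 (n - m) - (if m + 1 \<le> n then mass n 0 (n - (m + 1)) else 0)\<bar>"
        using sqrt_diff_sq_le[OF mass_nonneg mass_nonneg, of n 0 "n - m" n 0 "n - (m + 1)"] that
        by (cases "m + 1 \<le> n") (simp_all add: slope_def amplitude_def mass_nonneg)
      also have "\<dots> \<le> 1 / real K" by (auto simp: m0)
      also have "\<dots> \<le> (if m = n - 1 then 1 / real K else 0) + (if m = n - K - 1 then 1 / real K else 0)"
        using True by auto
      finally show ?thesis .
    next
      case False
      then have "slope n 0 m = 0"
        using K that by (auto simp: slope_def amplitude_def m0)
      then show ?thesis by simp
    qed
    then have "(\<Sum>m\<le>n. (slope n 0 m)\<^sup>2) \<le>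
        (\<Sum>m\<le>n. (if m = n - 1 then 1 / real K else 0) + (if m = n - K - 1 then 1 / real K else 0))"
      by (intro sum_mono) auto
    also have "\<dots> = 2 / real K"
      unfolding sum.distrib using K by simp
    finally show ?thesis by (simp add: l K_def)
  qed
qed

text \<open>The index \<open>N ^ (n - m) - Suc k\<close> is that of \<open>k\<close> with its \<open>n - m\<close> digits reflected.\<close>

definition weighted_copies :: "nat \<Rightarrow> nat \<Rightarrow> (nat \<Rightarrow> nat \<Rightarrow> real) \<Rightarrow> l2 \<Rightarrow>\<^sub>L l2 ell2"
  where "weighted_copies N n h = Blinfun (\<lambda>x. \<Sum>m\<le>n. ell2_single m
    (\<Sum>k<N ^ (n - m). ell2_single k
      (of_real (h (N ^ (n - m) - Suc k) m) * ell2_nth x (N ^ (n - m) - Suc k))))"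

lemma weighted_copies_nth:
  "ell2_nth (ell2_nth (weighted_copies N n h x) m) k =
    (if m \<le> n \<and> k < N ^ (n - m)
     then of_real (h (N ^ (n - m) - Suc k) m) * ell2_nth x (N ^ (n - m) - Suc k) else 0)"
proof -
  have "bounded_linear (\<lambda>x. \<Sum>m\<le>n. ell2_single m
    (\<Sum>k<N ^ (n - m). ell2_single k
      (of_real (h (N ^ (n - m) - Suc k) m) * ell2_nth x (N ^ (n - m) - Suc k)) :: l2))"
    by (intro bounded_linear_sum bounded_linear_compose[OF bounded_linear_ell2_single]
        bounded_linear_compose[OF bounded_linear_mult_right] bounded_linear_ell2_nth)
  then show ?thesis
    unfolding weighted_copies_def
    by (simp add: bounded_linear_Blinfun_apply ell2_nth_sum ell2_single.rep_eq if_distrib[of "\<lambda>x. ell2_nth x k"]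
        zero_ell2.rep_eq if_distribR cong: if_cong)
qed

text \<open>For fixed \<open>m\<close> the reflection is injective on indices, so no two entries of
  \<open>x\<close> meet in one coordinate and there are no cross terms. The support condition
  ensures that copy \<open>m\<close> omits no index with nonzero weight.\<close>

lemma norm_weighted_copies:
  assumes N: "N \<ge> 1" and supp: "\<And>I m. m \<le> n \<Longrightarrow> N ^ (n - m) \<le> I \<Longrightarrow> h I m = 0"
  shows "(norm (weighted_copies N n h x))\<^sup>2
    = (\<Sum>I<N ^ n. (\<Sum>m\<le>n. (h I m)\<^sup>2) * (norm (ell2_nth x I))\<^sup>2)"
proof -
  let ?y = "weighted_copies N n h x"
  have inner: "(norm (ell2_nth ?y m))\<^sup>2 = (\<Sum>I<N ^ n. (h I m)\<^sup>2 * (norm (ell2_nth x I))\<^sup>2)" if m: "m \<le> n" for m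
  proof -
    have "(norm (ell2_nth ?y m))\<^sup>2 = (\<Sum>k<N ^ (n - m). (norm (ell2_nth (ell2_nth ?y m) k))\<^sup>2)"
      by (rule norm_ell2_finite) (simp add: weighted_copies_nth)
    also have "\<dots> = (\<Sum>k<N ^ (n - m). (h (N ^ (n - m) - Suc k) m)\<^sup>2 * (norm (ell2_nth x (N ^ (n - m) - Suc k)))\<^sup>2)"
      using m by (intro sum.cong) (auto simp: weighted_copies_nth norm_mult power_mult_distrib)
    also have "\<dots> = (\<Sum>I<N ^ (n - m). (h I m)\<^sup>2 * (norm (ell2_nth x I))\<^sup>2)"
      by (rule sum.nat_diff_reindex)
    also have "\<dots> = (\<Sum>I<N ^ n. (h I m)\<^sup>2 * (norm (ell2_nth x I))\<^sup>2)"
    proof (rule sum.mono_neutral_left)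
      have "N ^ (n - m) \<le> N ^ n" using N by (intro power_increasing) auto
      then show "{..<N ^ (n - m)} \<subseteq> {..<N ^ n}" by auto
    qed (use supp m in auto)
    finally show ?thesis .
  qed
  have "(norm ?y)\<^sup>2 = (\<Sum>m\<le>n. (norm (ell2_nth ?y m))\<^sup>2)"
    unfolding lessThan_Suc_atMost[symmetric]
    by (rule norm_ell2_finite) (auto intro!: ell2_eqI simp: weighted_copies_nth zero_ell2.rep_eq)
  also have "\<dots> = (\<Sum>m\<le>n. \<Sum>I<N ^ n. (h I m)\<^sup>2 * (norm (ell2_nth x I))\<^sup>2)"
    by (simp add: inner)
  also have "\<dots> = (\<Sum>I<N ^ n. (\<Sum>m\<le>n. (h I m)\<^sup>2) * (norm (ell2_nth x I))\<^sup>2)"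
    by (subst sum.swap) (simp add: sum_distrib_right)
  finally show ?thesis .
qed

lemma norm_weighted_copies_le:
  assumes "N \<ge> 1" "\<And>I m. m \<le> n \<Longrightarrow> N ^ (n - m) \<le> I \<Longrightarrow> h I m = 0"
    and le: "\<And>I. I < N ^ n \<Longrightarrow> (\<Sum>m\<le>n. (h I m)\<^sup>2) \<le> d\<^sup>2" and "0 \<le> d"
  shows "norm (weighted_copies N n h x) \<le> d * norm x"
proof (rule power2_le_imp_le)
  have "(norm (weighted_copies N n h x))\<^sup>2 \<le> (\<Sum>I<N ^ n. d\<^sup>2 * (norm (ell2_nth x I))\<^sup>2)"
    by (subst norm_weighted_copies) (use assms in \<open>auto intro!: sum_mono mult_right_mono\<close>)
  also have "\<dots> \<le> d\<^sup>2 * (norm x)\<^sup>2"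
    unfolding sum_distrib_left[symmetric] by (intro mult_left_mono sum_norm_sq_le) auto
  finally show "(norm (weighted_copies N n h x))\<^sup>2 \<le> (d * norm x)\<^sup>2"
    by (simp add: power_mult_distrib)
qed (use \<open>0 \<le> d\<close> in simp)

section \<open>The isometries and the shifts they almost intertwine\<close>

definition spread :: "nat \<Rightarrow> nat \<Rightarrow> l2 \<Rightarrow>\<^sub>L l2 ell2"
  where "spread N n = weighted_copies N n (\<lambda>I m. amplitude n (digits N I) m)"

lemma spread_nth:
  "ell2_nth (ell2_nth (spread N n x) m) k =
    (if m \<le> n \<and> k < N ^ (n - m)
     then of_real (amplitude n (digits N (N ^ (n - m) - Suc k)) m) * ell2_nth x (N ^ (n - m) - Suc k) else 0)"
  unfolding spread_def by (rule weighted_copies_nth)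

lemma amplitude_digits_support:
  assumes "N \<ge> 2" "N ^ (n - m) \<le> I"
  shows "amplitude n (digits N I) m = 0"
  using assms digits_le_iff[of N I "n - m"] by (auto simp: amplitude_def)

text \<open>Isometric on truncated vectors because the squared amplitudes of each index sum to one;
  \<open>n \<ge> 2\<close> makes \<open>n div 2\<close> positive, so that the uniform distribution
  exists.\<close>

lemma norm_spread:
  assumes N: "N \<ge> 2" and n: "n \<ge> 2"
  shows "norm (spread N n x) = norm (trunc (N ^ n) x)"
proof -
  have "(norm (spread N n x))\<^sup>2
      = (\<Sum>I<N ^ n. (\<Sum>m\<le>n. (amplitude n (digits N I) m)\<^sup>2) * (norm (ell2_nth x I))\<^sup>2)"
    unfolding spread_def
    by (rule norm_weighted_copies) (use N amplitude_digits_support in auto)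
  also have "\<dots> = (\<Sum>I<N ^ n. (norm (ell2_nth (trunc (N ^ n) x) I))\<^sup>2)"
    using N n by (intro sum.cong) (auto simp: sum_amplitude_sq digits_le_iff trunc_nth)
  also have "\<dots> = (norm (trunc (N ^ n) x))\<^sup>2"
    by (rule norm_ell2_finite[symmetric]) (simp add: trunc_nth)
  finally show ?thesis by (simp add: power2_eq_iff_nonneg)
qed

lemma spread_trunc:
  assumes "N \<ge> 1"
  shows "spread N n o\<^sub>L trunc (N ^ n) = spread N n"
proof (intro blinfun_eqI ell2_eqI)
  fix x m k
  have "N ^ (n - m) - Suc k < N ^ n" if "k < N ^ (n - m)"
  proof -
    have "N ^ (n - m) \<le> N ^ n" using assms by (intro power_increasing) auto
    then show ?thesis using that by linarith
  qed
  then show "ell2_nth (ell2_nth ((spread N n o\<^sub>L trunc (N ^ n)) x) m) k = ell2_nth (ell2_nth (spread N n x) m) k"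
    by (auto simp: spread_nth trunc_nth)
qed

lemma norm_spread_le:
  assumes "N \<ge> 2" "n \<ge> 2"
  shows "norm (spread N n) \<le> 1"
  by (rule norm_blinfun_bound) (use assms norm_apply_le[OF norm_trunc_le] in \<open>auto simp: norm_spread\<close>)

text \<open>Used with \<open>V = cuntz_isom N (N - 1 - i)\<close>: reflecting a word turns its last
  digit \<open>i\<close> into \<open>N - 1 - i\<close>.\<close>

lemma shift_left_exists:
  fixes V :: "'a::complex_normed_vector \<Rightarrow>\<^sub>L 'a"
  assumes V: "V \<in> bounded_ops" "norm V \<le> 1"
  shows "\<exists>T\<in>bounded_ops. \<forall>y m. ell2_nth (blinfun_apply T y) m = V (ell2_nth y (Suc m))"
proof -
  have "\<exists>T :: 'a ell2 \<Rightarrow>\<^sub>L 'a ell2. norm T \<le> 1 \<and> (\<forall>y m. ell2_nth (blinfun_apply T y) m = V (ell2_nth y (Suc m)))"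
  proof (rule blinfun_ell2_exists)
    fix y :: "'a ell2" and n
    have "(\<Sum>m<n. (norm (V (ell2_nth y (Suc m))))\<^sup>2) \<le> (\<Sum>m<n. (norm (ell2_nth y (Suc m)))\<^sup>2)"
      using norm_apply_le[OF V(2)] by (intro sum_mono power_mono) auto
    also have "\<dots> = (\<Sum>m\<in>Suc ` {..<n}. (norm (ell2_nth y m))\<^sup>2)"
      by (simp add: sum.reindex)
    also have "\<dots> \<le> (1 * norm y)\<^sup>2" using sum_norm_sq_le[of "Suc ` {..<n}" y] by simp
    finally show "(\<Sum>m<n. (norm (V (ell2_nth y (Suc m))))\<^sup>2) \<le> (1 * norm y)\<^sup>2" .
  qed (auto simp: ell2_nth_simps blinfun.add_right blinfun.scaleR_right)
  then obtain T where T: "\<And>y m. ell2_nth (blinfun_apply T y) m = V (ell2_nth y (Suc m))" by blast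
  moreover have "T \<in> bounded_ops"
    by (intro bounded_opsI ell2_eqI) (simp add: T ell2_nth_simps bounded_opsD[OF V(1)])
  ultimately show ?thesis by blast
qed

text \<open>Used with the adjoint of \<open>cuntz_isom N (N - 1 - i)\<close>. Outer index 0 receives
  nothing, which is what the left shift loses.\<close>

lemma shift_right_exists:
  fixes V :: "'a::complex_normed_vector \<Rightarrow>\<^sub>L 'a"
  assumes V: "V \<in> bounded_ops" "norm V \<le> 1"
  shows "\<exists>T\<in>bounded_ops. \<forall>y m. ell2_nth (blinfun_apply T y) m = (if m = 0 then 0 else V (ell2_nth y (m - 1)))"
proof -
  have "\<exists>T :: 'a ell2 \<Rightarrow>\<^sub>L 'a ell2. norm T \<le> 1 \<and>
      (\<forall>y m. ell2_nth (blinfun_apply T y) m = (if m = 0 then 0 else V (ell2_nth y (m - 1))))"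
  proof (rule blinfun_ell2_exists)
    fix y :: "'a ell2" and n :: nat
    have "(\<Sum>m<n. (norm (if m = 0 then 0 else V (ell2_nth y (m - 1))))\<^sup>2)
        \<le> (\<Sum>m<Suc n. (norm (if m = 0 then 0 else V (ell2_nth y (m - 1))))\<^sup>2)"
      by simp
    also have "\<dots> = (\<Sum>m<n. (norm (V (ell2_nth y m)))\<^sup>2)"
      by (subst sum.lessThan_Suc_shift) simp
    also have "\<dots> \<le> (\<Sum>m<n. (norm (ell2_nth y m))\<^sup>2)"
      using norm_apply_le[OF V(2)] by (intro sum_mono power_mono) auto
    also have "\<dots> \<le> (1 * norm y)\<^sup>2" using sum_norm_sq_le[of "{..<n}" y] by simp
    finally show "(\<Sum>m<n. (norm (if m = 0 then 0 else V (ell2_nth y (m - 1))))\<^sup>2) \<le> (1 * norm y)\<^sup>2" .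
  qed (auto simp: ell2_nth_simps blinfun.add_right blinfun.scaleR_right)
  then obtain T where T: "\<And>y m. ell2_nth (blinfun_apply T y) m = (if m = 0 then 0 else V (ell2_nth y (m - 1)))" by blast
  moreover have "T \<in> bounded_ops"
    by (intro bounded_opsI ell2_eqI) (simp add: T ell2_nth_simps bounded_opsD[OF V(1)])
  ultimately show ?thesis by blast
qed

text \<open>The difference can be computed exactly: appending the digit and reflecting agree on both
  sides, so only the weights differ, and the error consists of weighted copies of
  \<open>cuntz_isom N i x\<close> with weights \<open>slope\<close>. Its norm is then governed by
  \<open>sum_slope_sq\<close>.\<close>

lemma spread_cuntz_isom:
  assumes N: "N \<ge> 2" and n: "n \<ge> 2" and i: "i < N"
    and T: "\<And>y m. ell2_nth (blinfun_apply T y) m = cuntz_isom N (N - 1 - i) (ell2_nth y (Suc m))"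
  shows "norm ((spread N n o\<^sub>L compressions N (cuntz_isom N i) n) - (T o\<^sub>L spread N n)) \<le> sqrt (2 / real (n div 2))"
proof (rule norm_blinfun_bound)
  fix x
  let ?h = "\<lambda>I m. slope n (digits N I) m"
  have "((spread N n o\<^sub>L compressions N (cuntz_isom N i) n) - (T o\<^sub>L spread N n)) x
      = weighted_copies N n ?h (cuntz_isom N i x)"
  proof (intro ell2_eqI)
    fix m k
    let ?I = "N ^ (n - m) - Suc k"
    have comp: "ell2_nth (compressions N (cuntz_isom N i) n x) I = ell2_nth (cuntz_isom N i x) I" if "I < N ^ n" for I
    proof -
      have "I div N \<le> I" by simp
      then have "I div N < N ^ n" using that by linarith
      then show ?thesis using that by (simp add: compressions_def trunc_nth cuntz_isom_nth)
    qed
    have le: "N ^ (n - m) \<le> N ^ n" using N by (intro power_increasing) auto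
    have lhs: "ell2_nth (ell2_nth (((spread N n o\<^sub>L compressions N (cuntz_isom N i) n) - (T o\<^sub>L spread N n)) x) m) k
      = (if m \<le> n \<and> k < N ^ (n - m) then of_real (amplitude n (digits N ?I) m) * ell2_nth (cuntz_isom N i x) ?I else 0)
      - (if k mod N = N - 1 - i then ell2_nth (ell2_nth (spread N n x) (Suc m)) (k div N) else 0)"
    proof (cases "m \<le> n \<and> k < N ^ (n - m)")
      case True
      then have "?I < N ^ n" using le by linarith
      then show ?thesis
        using True by (simp add: blinfun.diff_left ell2_nth_simps T cuntz_isom_nth[of N "N - Suc i"] comp
          spread_nth[of N n "compressions N (cuntz_isom N i) n x"])
    next
      case False
      then show ?thesis
        by (auto simp: blinfun.diff_left ell2_nth_simps T cuntz_isom_nth[of N "N - Suc i"]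
          spread_nth[of N n "compressions N (cuntz_isom N i) n x"])
    qed
    have "(if k mod N = N - 1 - i then ell2_nth (ell2_nth (spread N n x) (Suc m)) (k div N) else 0)
      = (if m \<le> n \<and> k < N ^ (n - m)
         then of_real (amplitude n (digits N ?I - 1) (Suc m)) * ell2_nth (cuntz_isom N i x) ?I else 0)"
    proof (cases "m < n \<and> k < N ^ (n - m)")
      case True
      then obtain p where p: "n - m = Suc p" by (metis Suc_diff_Suc)
      define q r where "q = k div N" and "r = k mod N"
      have k: "k = q * N + r" and r: "r < N" using N by (auto simp: q_def r_def)
      have q: "q < N ^ p"
        using True N unfolding q_def p by (simp add: div_less_iff_less_mult mult.commute)
      \<comment> \<open>Reflection acts digit by digit: the prefix \<open>q\<close> becomes
        \<open>N ^ p - 1 - q\<close> and the last digit \<open>r\<close> becomes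
        \<open>N - 1 - r\<close>. Writing the complements as \<open>d\<close> and \<open>e\<close>
        avoids truncated subtraction.\<close>
      have I: "?I = (N ^ p - Suc q) * N + (N - Suc r)"
      proof -
        obtain d where d: "N ^ p = Suc q + d" using q by (metis Suc_leI le_Suc_ex)
        obtain e where e: "N = Suc r + e" using r by (metis Suc_leI le_Suc_ex)
        have "N ^ (n - m) = (Suc q + d) * N" by (simp add: p d mult.commute)
        also have "\<dots> = Suc k + (d * N + e)" by (simp add: k algebra_simps) (simp add: e)
        finally show ?thesis by (simp add: d) (simp add: e)
      qed
      have Id: "?I div N = N ^ p - Suc q" "?I mod N = N - Suc r"
      proof -
        define s where "s = N - Suc r"
        have "s < N" using r by (simp add: s_def)
        then show "?I div N = N ^ p - Suc q" "?I mod N = N - Suc r"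
          unfolding I s_def[symmetric] by auto
      qed
      have ri: "r = N - 1 - i \<longleftrightarrow> N - Suc r = i" using r i by auto
      have "n - Suc m = p" using p by auto
      moreover have "digits N ?I - Suc 0 = digits N (N ^ p - Suc q)"
        using digits_div[OF N, of ?I] Id(1) by simp
      ultimately show ?thesis
        using True q ri by (simp add: spread_nth cuntz_isom_nth Id flip: q_def r_def)
    next
      case False
      show ?thesis
      proof (cases "m < n")
        case True
        then have "\<not> k div N < N ^ (n - Suc m)"
          using False N div_less_iff_less_mult[of N k "N ^ (n - Suc m)"]
            power_Suc2[of N "n - Suc m"] by (auto simp: Suc_diff_Suc)
        then show ?thesis using True False by (simp add: spread_nth)
      next
        case False
        then show ?thesis by (auto simp: spread_nth amplitude_def)
      qed
    qed
    then show "ell2_nth (ell2_nth (((spread N n o\<^sub>L compressions N (cuntz_isom N i) n) - (T o\<^sub>L spread N n)) x) m) k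
        = ell2_nth (ell2_nth (weighted_copies N n ?h (cuntz_isom N i x)) m) k"
      unfolding lhs by (auto simp: weighted_copies_nth slope_def algebra_simps)
  qed
  also have "norm \<dots> \<le> sqrt (2 / real (n div 2)) * norm (cuntz_isom N i x)"
  proof (rule norm_weighted_copies_le)
    fix I m assume m: "m \<le> n" "N ^ (n - m) \<le> I"
    have "N ^ (n - Suc m) \<le> I div N" if "m < n"
      using m(2) that N by (simp add: less_eq_div_iff_mult_less_eq mult.commute Suc_diff_Suc flip: power_Suc)
    then have "amplitude n (digits N (I div N)) (Suc m) = 0"
      using amplitude_digits_support[OF N, of n "Suc m" "I div N"] m(1)
      by (cases "m < n") (auto simp: amplitude_def)
    then show "slope n (digits N I) m = 0"
      using amplitude_digits_support[OF N m(2)] by (simp add: slope_def digits_div[OF N])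
  qed (use N n sum_slope_sq in auto)
  finally show "norm (((spread N n o\<^sub>L compressions N (cuntz_isom N i) n) - (T o\<^sub>L spread N n)) x)
      \<le> sqrt (2 / real (n div 2)) * norm x"
    by (simp add: norm_cuntz_isom[OF i])
qed simp

text \<open>Taking adjoints in the estimate for \<open>cuntz_isom N i\<close> would give a relation
  for the adjoint of \<open>spread\<close>, which is not enough unless \<open>spread\<close> is
  onto. The error is therefore computed again: it vanishes at outer index 0, and elsewhere it is
  minus the slope at the preceding outer index.\<close>

lemma spread_cuntz_adj:
  assumes N: "N \<ge> 2" and n: "n \<ge> 2" and i: "i < N"
    and T: "\<And>y m. ell2_nth (blinfun_apply T y) m
        = (if m = 0 then 0 else adj (cuntz_isom N (N - 1 - i)) (ell2_nth y (m - 1)))"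
  shows "norm ((spread N n o\<^sub>L compressions N (adj (cuntz_isom N i)) n) - (T o\<^sub>L spread N n)) \<le> sqrt (2 / real (n div 2))"
proof (rule norm_blinfun_bound)
  fix x
  let ?h = "\<lambda>I m. if m = 0 then 0 else - slope n (digits N (I * N + i)) (m - 1)"
  let ?z = "adj (cuntz_isom N i) (trunc (N ^ n) x)"
  have i': "N - 1 - i < N" using N by simp
  have dig: "digits N (I * N + i) - Suc 0 = digits N I" for I
    using digits_div[OF N, of "I * N + i"] i by simp
  have "((spread N n o\<^sub>L compressions N (adj (cuntz_isom N i)) n) - (T o\<^sub>L spread N n)) x
      = weighted_copies N n ?h ?z"
  proof (intro ell2_eqI)
    fix m k
    let ?I = "N ^ (n - m) - Suc k"
    have z: "compressions N (adj (cuntz_isom N i)) n x = ?z"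
      unfolding compressions_def trunc_cuntz_adj by simp
    have lhs: "ell2_nth (ell2_nth (((spread N n o\<^sub>L compressions N (adj (cuntz_isom N i)) n) - (T o\<^sub>L spread N n)) x) m) k
      = (if m \<le> n \<and> k < N ^ (n - m) then of_real (amplitude n (digits N ?I) m) * ell2_nth ?z ?I else 0)
      - (if m = 0 then 0 else ell2_nth (ell2_nth (spread N n x) (m - 1)) (k * N + (N - 1 - i)))"
      using cuntz_adj_nth[OF i'] by (auto simp: blinfun.diff_left ell2_nth_simps T
        spread_nth[of N n ?z] z)
    show "ell2_nth (ell2_nth (((spread N n o\<^sub>L compressions N (adj (cuntz_isom N i)) n) - (T o\<^sub>L spread N n)) x) m) k
        = ell2_nth (ell2_nth (weighted_copies N n ?h ?z) m) k"
    proof (cases "m = 0")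
      case True
      \<comment> \<open>Either the index \<open>?I * N + i\<close> is removed by the truncation, or
        \<open>?I\<close> has fewer than \<open>n\<close> digits and hence a leading zero, which
        \<open>spread\<close> always cuts off.\<close>
      have "amplitude n (digits N ?I) 0 * ell2_nth ?z ?I = 0" if "k < N ^ n"
      proof (cases "?I * N + i < N ^ n")
        case True
        then have "?I * N + i < N ^ (n - 1) * N"
          using n by (cases n) (auto simp: mult.commute)
        then have "?I * N < N ^ (n - 1) * N" by (rule add_lessD1)
        then have "?I < N ^ (n - 1)" by simp
        then have "digits N ?I \<le> n - 1"
          using N by (simp add: digits_le_iff \<open>m = 0\<close>)
        then have "digits N ?I < n" using n by linarith
        then show ?thesis using n amplitude_0 by simp
      qed (use i in \<open>simp add: cuntz_adj_nth trunc_nth \<open>m = 0\<close>\<close>)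
      then show ?thesis unfolding lhs using True by (auto simp: weighted_copies_nth)
    next
      case False
      then obtain m' where m': "m = Suc m'" by (cases m) auto
      have bound: "k * N + (N - 1 - i) < N ^ Suc p \<longleftrightarrow> k < N ^ p" for p
      proof -
        have "(k * N + (N - 1 - i)) div N = k" using i' by simp
        then show ?thesis
          using N div_less_iff_less_mult[of N "k * N + (N - 1 - i)" "N ^ p"] by (simp add: mult.commute)
      qed
      have "ell2_nth (ell2_nth (spread N n x) m') (k * N + (N - 1 - i)) =
          (if m \<le> n \<and> k < N ^ (n - m) then of_real (amplitude n (digits N (?I * N + i)) m') * ell2_nth ?z ?I else 0)"
      proof (cases "m \<le> n")
        case True
        then have p: "n - m' = Suc (n - m)" by (simp add: m')
        show ?thesis
        proof (cases "k < N ^ (n - m)")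
          case True
          obtain d where d: "N ^ (n - m) = Suc k + d" using True by (metis Suc_leI le_Suc_ex)
          obtain e where e: "N = Suc i + e" using i by (metis Suc_leI le_Suc_ex)
          have Np: "N ^ (n - m') = (Suc k + d) * N" by (simp only: p power_Suc d mult.commute)
          have "(Suc k + d) * N = Suc (k * N + (N - 1 - i)) + (d * N + i)"
            by (simp add: algebra_simps) (simp add: e)
          then have J: "N ^ (n - m') - Suc (k * N + (N - 1 - i)) = ?I * N + i"
            unfolding Np by (simp add: d)
          have "N ^ (n - m') \<le> N ^ n" using N by (intro power_increasing) auto
          then have "?I * N + i < N ^ n" unfolding J[symmetric]
            by (intro less_le_trans[OF diff_less]) (use N in auto)
          moreover have "N * N ^ (n - Suc m') - Suc (k * N + (N - Suc i)) = ?I * N + i"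
            using J by (simp add: p) (simp add: m')
          ultimately show ?thesis
            using bound[of "n - m"] True p \<open>m \<le> n\<close>
            by (simp add: spread_nth m' cuntz_adj_nth[OF i] trunc_nth)
        next
          case False
          then show ?thesis using bound[of "n - m"] p by (simp add: spread_nth)
        qed
      next
        case False
        then show ?thesis
          \<comment> \<open>For \<open>m' = n\<close> the only possible entry comes from the zero
            word with every zero cut off, and this case has mass 0.\<close>
          by (cases "m' = n") (auto simp: spread_nth m' amplitude_def mass_def dest!: le_neq_implies_less)
      qed
      then show ?thesis
        unfolding lhs by (auto simp: weighted_copies_nth slope_def m' dig left_diff_distrib)
    qed
  qed
  also have "norm \<dots> \<le> sqrt (2 / real (n div 2)) * norm ?z"
  proof (rule norm_weighted_copies_le)
    fix I m assume m: "m \<le> n" "N ^ (n - m) \<le> I"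
    show "?h I m = 0"
    proof (cases m)
      case (Suc m')
      have "N ^ (n - m') = N ^ (n - m) * N" using m(1) by (simp add: Suc Suc_diff_Suc flip: power_Suc2)
      also have "\<dots> \<le> I * N" using m(2) by (rule mult_right_mono) simp
      finally have "N ^ (n - m') \<le> I * N + i" by simp
      then show ?thesis
        using amplitude_digits_support[OF N m(2)] amplitude_digits_support[OF N, of n m' "I * N + i"]
        by (simp add: slope_def dig Suc)
    qed simp
  next
    fix I
    have "(\<Sum>m\<le>n. (?h I m)\<^sup>2) = (\<Sum>m<n. (slope n (digits N (I * N + i)) m)\<^sup>2)"
      by (subst sum.atMost_shift) simp
    also have "\<dots> \<le> (\<Sum>m\<le>n. (slope n (digits N (I * N + i)) m)\<^sup>2)"
      by (intro sum_mono2) auto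
    also have "\<dots> \<le> (sqrt (2 / real (n div 2)))\<^sup>2"
      using sum_slope_sq[OF n] by simp
    finally show "(\<Sum>m\<le>n. (?h I m)\<^sup>2) \<le> (sqrt (2 / real (n div 2)))\<^sup>2" .
  qed (use N in auto)
  also have "norm ?z \<le> 1 * (1 * norm x)"
    by (intro order_trans[OF norm_apply_le[OF norm_cuntz_adj_le[OF i]]] mult_left_mono norm_apply_le norm_trunc_le) simp
  finally show "norm (((spread N n o\<^sub>L compressions N (adj (cuntz_isom N i)) n) - (T o\<^sub>L spread N n)) x)
      \<le> sqrt (2 / real (n div 2)) * norm x"
    by (simp add: mult_left_mono)
qed simp

section \<open>Sequences with a limit intertwined by the isometries\<close>

lemma trunc_eq_sum: "trunc n x = (\<Sum>j<n. ell2_single j (ell2_nth x j))"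
  by (rule ell2_eqI) (auto simp: trunc_nth ell2_nth_sum ell2_single.rep_eq)

lemma trunc_tendsto:
  assumes "filterlim b at_top F"
  shows "((\<lambda>n. trunc (b n) x) \<longlongrightarrow> x) F"
  using filterlim_compose[OF ell2_single_sums[of x, unfolded sums_def] assms]
  by (simp add: trunc_eq_sum)

text \<open>Places \<open>v\<close> in reversed order on the indices from \<open>N ^ p\<close> to
  \<open>N ^ Suc p - 1\<close>, the words of exactly \<open>p + 1\<close> digits. There
  \<open>spread\<close> does not smear anything, so this is an explicit inverse on one outer
  index.\<close>

definition top_block :: "nat \<Rightarrow> nat \<Rightarrow> op"
  where "top_block N p = reflection (N ^ Suc p) - (trunc (N ^ p) o\<^sub>L reflection (N ^ Suc p))"

lemma top_block_nth:
  "ell2_nth (top_block N p v) I = (if N ^ p \<le> I \<and> I < N ^ Suc p then ell2_nth v (N ^ Suc p - 1 - I) else 0)"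
  by (auto simp: top_block_def blinfun.diff_left ell2_nth_simps trunc_nth reflection_nth)

text \<open>All indices involved have \<open>n - j\<close> digits, at least
  \<open>n - n div 2\<close>, so their whole amplitude sits at \<open>m = j\<close>. The truncation
  counts the words of that length, and it exhausts \<open>v\<close> as \<open>p\<close>
  grows.\<close>

lemma spread_top_block:
  assumes N: "N \<ge> 2" and n: "n \<ge> 2" and j: "j + p + 1 = n" "j \<le> n div 2"
  shows "spread N n (top_block N p v) = ell2_single j (trunc (N ^ Suc p - N ^ p) v)"
proof (intro ell2_eqI)
  fix m k
  let ?I = "N ^ (n - m) - Suc k"
  have p: "n - j = Suc p" using j by simp
  show "ell2_nth (ell2_nth (spread N n (top_block N p v)) m) k
      = ell2_nth (ell2_nth (ell2_single j (trunc (N ^ Suc p - N ^ p) v)) m) k"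
  proof (cases "m \<le> n \<and> k < N ^ (n - m)")
    case True
    show ?thesis
    proof (cases "N ^ p \<le> ?I \<and> ?I < N ^ Suc p")
      case I: True
      have "digits N ?I = n - j"
        using I digits_le_iff[OF N, of ?I p] digits_le_iff[OF N, of ?I "Suc p"] p by linarith
      then have "amplitude n (digits N ?I) m = (if m = j then 1 else 0)"
        using amplitude_top[OF n, of "n - j" m] j by simp
      then show ?thesis
        using True I p by (auto simp: spread_nth top_block_nth ell2_single.rep_eq trunc_nth zero_ell2.rep_eq)
    next
      case I: False
      have "m = j \<longrightarrow> \<not> k < N ^ Suc p - N ^ p"
        using I True p by auto
      then show ?thesis
        using I by (auto simp: spread_nth top_block_nth ell2_single.rep_eq trunc_nth zero_ell2.rep_eq)
    qed
  next
    case False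
    then show ?thesis
      using p j by (auto simp: spread_nth ell2_single.rep_eq trunc_nth zero_ell2.rep_eq)
  qed
qed

lemma block_size_at_top:
  fixes N :: nat
  assumes "N \<ge> 2"
  shows "filterlim (\<lambda>p. N ^ Suc p - N ^ p) at_top sequentially"
proof (rule filterlim_at_top_mono[where f = "\<lambda>p. p"])
  have "p \<le> N ^ Suc p - N ^ p" for p
  proof -
    have "p \<le> N ^ p" using less_exp[of p] power_mono[OF assms, of p] by linarith
    moreover have "2 * N ^ p \<le> N ^ Suc p" using assms by simp
    ultimately show ?thesis by linarith
  qed
  then show "\<forall>\<^sub>F p in sequentially. p \<le> N ^ Suc p - N ^ p" by simp
qed (rule filterlim_ident)

lemma spread_top_block_tendsto:
  assumes N: "N \<ge> 2"
  shows "(\<lambda>n. spread N n (top_block N (n - j - 1) v)) \<longlonglongrightarrow> ell2_single j v"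
proof -
  have "filterlim (\<lambda>n. n - (j + 1)) at_top sequentially"
    by (rule filterlim_minus_const_nat_at_top)
  then have "(\<lambda>n. trunc (N ^ Suc (n - j - 1) - N ^ (n - j - 1)) v) \<longlonglongrightarrow> v"
    by (intro trunc_tendsto filterlim_compose[OF block_size_at_top[OF N]]) simp
  then have "(\<lambda>n. ell2_single j (trunc (N ^ Suc (n - j - 1) - N ^ (n - j - 1)) v)) \<longlonglongrightarrow> ell2_single j v"
    by (rule bounded_linear.tendsto[OF bounded_linear_ell2_single])
  moreover have "\<forall>\<^sub>F n in sequentially. ell2_single j (trunc (N ^ Suc (n - j - 1) - N ^ (n - j - 1)) v)
      = spread N n (top_block N (n - j - 1) v)"
    using eventually_ge_at_top[of "2 * j + 2"]
    by eventually_elim (rule spread_top_block[OF N, symmetric], auto)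
  ultimately show ?thesis by (rule Lim_transform_eventually)
qed

text \<open>Each finite partial sum of \<open>x\<close> is approximated inside the ranges once
  \<open>n\<close> is large. Stating this as convergence of the distances to 0 makes a diagonal
  choice unnecessary.\<close>

lemma spread_approximants:
  assumes N: "N \<ge> 2"
  shows "\<exists>y. (\<forall>n. trunc (N ^ n) (y n) = y n) \<and> (\<lambda>n. spread N n (y n)) \<longlonglongrightarrow> x"
proof -
  let ?d = "\<lambda>n. infdist x (range (spread N n))"
  have "?d \<longlonglongrightarrow> 0"
  proof (rule tendstoI)
    fix e :: real assume e: "e > 0"
    obtain J where J: "dist (\<Sum>j<J. ell2_single j (ell2_nth x j)) x < e / 2"
      using tendstoD[OF ell2_single_sums[of x, unfolded sums_def], of "e / 2"] e
      by (auto simp: eventually_sequentially)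
    have "(\<lambda>n. \<Sum>j<J. spread N n (top_block N (n - j - 1) (ell2_nth x j)))
        \<longlonglongrightarrow> (\<Sum>j<J. ell2_single j (ell2_nth x j))"
      by (intro tendsto_sum spread_top_block_tendsto N)
    then have "\<forall>\<^sub>F n in sequentially. dist (\<Sum>j<J. spread N n (top_block N (n - j - 1) (ell2_nth x j)))
        (\<Sum>j<J. ell2_single j (ell2_nth x j)) < e / 2"
      by (rule tendstoD) (use e in simp)
    then show "\<forall>\<^sub>F n in sequentially. dist (?d n) 0 < e"
    proof eventually_elim
      case (elim n)
      have "(\<Sum>j<J. spread N n (top_block N (n - j - 1) (ell2_nth x j))) \<in> range (spread N n)"
        by (simp flip: blinfun.sum_right)
      then have "?d n \<le> dist x (\<Sum>j<J. spread N n (top_block N (n - j - 1) (ell2_nth x j)))"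
        by (rule infdist_le)
      also have "\<dots> < e"
      proof (rule dist_triangle_half_l)
        show "dist x (\<Sum>j<J. ell2_single j (ell2_nth x j)) < e / 2"
          using J by (simp only: dist_commute)
      qed (rule elim)
      finally show ?case by (simp add: infdist_nonneg)
    qed
  qed
  moreover have "(\<lambda>n. inverse (real (Suc n))) \<longlonglongrightarrow> 0" by (rule LIMSEQ_inverse_real_of_nat)
  ultimately have lim: "(\<lambda>n. ?d n + inverse (real (Suc n))) \<longlonglongrightarrow> 0"
    by (rule tendsto_add_zero)
  \<comment> \<open>The extra \<open>inverse (real (Suc n))\<close> leaves room for a vector that
    nearly attains the infimum.\<close>
  have "\<exists>y. dist x (spread N n y) \<le> ?d n + inverse (real (Suc n))" for n
  proof -
    have "(INF a\<in>range (spread N n). dist x a) < ?d n + inverse (real (Suc n))"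
      by (subst infdist_notempty[symmetric]) auto
    then show ?thesis
      by (subst (asm) cINF_less_iff) (auto intro!: bdd_belowI2[of _ 0] less_imp_le)
  qed
  then obtain y where y: "\<And>n. dist x (spread N n (y n)) \<le> ?d n + inverse (real (Suc n))" by metis
  have "(\<lambda>n. spread N n (y n)) \<longlonglongrightarrow> x"
    unfolding tendsto_dist_iff[of _ x]
    by (rule tendsto_sandwich[OF _ _ tendsto_const lim]) (use y in \<open>auto simp: dist_commute\<close>)
  moreover have "spread N n (trunc (N ^ n) (y n)) = spread N n (y n)" for n
    using spread_trunc[of N n] N by (metis blinfun_apply_blinfun_compose le_trans one_le_numeral)
  moreover have "trunc (N ^ n) (trunc (N ^ n) (y n)) = trunc (N ^ n) (y n)" for n
    using trunc_idem[of "N ^ n"] by (metis blinfun_apply_blinfun_compose)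
  ultimately show ?thesis by (intro exI[of _ "\<lambda>n. trunc (N ^ n) (y n)"]) simp
qed

section \<open>Matrices as corners, and bounded sequences of matrices\<close>

lemma zero_matrix_ops: "0 \<in> matrix_ops m"
  by (auto simp: matrix_ops_def zero_bounded_ops intro: blinfun_eqI)

lemma matrix_ops_trunc:
  assumes "A \<in> matrix_ops m"
  shows "trunc m o\<^sub>L A = A" "A o\<^sub>L trunc m = A"
proof -
  have A: "trunc m o\<^sub>L A o\<^sub>L trunc m = A" using assms by (simp add: matrix_ops_def)
  have "trunc m o\<^sub>L (trunc m o\<^sub>L A o\<^sub>L trunc m) = (trunc m o\<^sub>L trunc m) o\<^sub>L A o\<^sub>L trunc m"
    by (simp only: blinfun_compose_assoc)
  then show "trunc m o\<^sub>L A = A" by (simp only: A trunc_idem)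
  have "(trunc m o\<^sub>L A o\<^sub>L trunc m) o\<^sub>L trunc m = trunc m o\<^sub>L A o\<^sub>L (trunc m o\<^sub>L trunc m)"
    by (simp only: blinfun_compose_assoc)
  then show "A o\<^sub>L trunc m = A" by (simp only: A trunc_idem)
qed

lemma matrix_opsI: "A \<in> bounded_ops \<Longrightarrow> trunc m o\<^sub>L A = A \<Longrightarrow> A o\<^sub>L trunc m = A \<Longrightarrow> A \<in> matrix_ops m"
  by (simp add: matrix_ops_def)

lemma matrix_ops_bounded_ops: "A \<in> matrix_ops m \<Longrightarrow> A \<in> bounded_ops"
  by (simp add: matrix_ops_def)

lemma matrix_ops_add: "A \<in> matrix_ops m \<Longrightarrow> B \<in> matrix_ops m \<Longrightarrow> A + B \<in> matrix_ops m"
  by (rule matrix_opsI)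
    (auto simp: matrix_ops_bounded_ops add_bounded_ops blinfun_compose_add_left blinfun_compose_add_right matrix_ops_trunc)

lemma matrix_ops_compose:
  assumes "A \<in> matrix_ops m" "B \<in> matrix_ops m"
  shows "A o\<^sub>L B \<in> matrix_ops m"
proof (rule matrix_opsI)
  show "A o\<^sub>L B \<in> bounded_ops"
    using assms by (simp add: matrix_ops_bounded_ops compose_bounded_ops)
  show "trunc m o\<^sub>L (A o\<^sub>L B) = A o\<^sub>L B"
    using assms by (simp add: matrix_ops_trunc flip: blinfun_compose_assoc)
  show "A o\<^sub>L B o\<^sub>L trunc m = A o\<^sub>L B"
    using assms by (simp add: matrix_ops_trunc blinfun_compose_assoc)
qed

lemma matrix_ops_scale: "A \<in> matrix_ops m \<Longrightarrow> op_scaleC c A \<in> matrix_ops m"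
  by (rule matrix_opsI)
    (auto simp: matrix_ops_bounded_ops scaleC_bounded_ops op_scaleC_compose_left op_scaleC_compose_right
      trunc_bounded_ops matrix_ops_trunc)

lemma matrix_ops_adj:
  assumes "A \<in> matrix_ops m"
  shows "adj A \<in> matrix_ops m"
  using assms arg_cong[OF matrix_ops_trunc(1)[OF assms], of adj] arg_cong[OF matrix_ops_trunc(2)[OF assms], of adj]
  by (intro matrix_opsI) (auto simp: matrix_ops_bounded_ops adj_bounded_ops adj_compose adj_trunc trunc_bounded_ops)

lemma compression_matrix_ops:
  assumes "A \<in> bounded_ops"
  shows "compressions N A n \<in> matrix_ops (N ^ n)"
proof (rule matrix_opsI)
  show "compressions N A n \<in> bounded_ops"
    using assms by (simp add: compressions_def compose_bounded_ops trunc_bounded_ops)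
  show "trunc (N ^ n) o\<^sub>L compressions N A n = compressions N A n"
    by (simp add: compressions_def trunc_idem flip: blinfun_compose_assoc)
  show "compressions N A n o\<^sub>L trunc (N ^ n) = compressions N A n"
    by (simp add: compressions_def trunc_idem blinfun_compose_assoc)
qed

lemma matrix_ops_limit:
  assumes "\<And>k. B k \<in> matrix_ops m" "B \<longlonglongrightarrow> A"
  shows "A \<in> matrix_ops m"
proof -
  have "A \<in> bounded_ops"
    using closed_bounded_ops assms matrix_ops_bounded_ops unfolding closed_sequential_limits by blast
  moreover have "(\<lambda>k. trunc m o\<^sub>L B k o\<^sub>L trunc m) \<longlonglongrightarrow> (trunc m o\<^sub>L A o\<^sub>L trunc m)"
    by (intro bounded_bilinear.tendsto[OF bounded_bilinear_blinfun_compose] tendsto_const assms(2))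
  then have "B \<longlonglongrightarrow> (trunc m o\<^sub>L A o\<^sub>L trunc m)"
    using assms(1) by (simp add: matrix_ops_def)
  then have "trunc m o\<^sub>L A o\<^sub>L trunc m = A" using assms(2) by (rule LIMSEQ_unique)
  ultimately show ?thesis by (simp add: matrix_ops_def)
qed

lemma F_etaI: "(\<And>n. A n \<in> matrix_ops (N ^ n)) \<Longrightarrow> (\<And>n. norm (A n) \<le> C) \<Longrightarrow> A \<in> F_eta N"
  by (auto simp: F_eta_def bounded_iff)

lemma F_eta_matrix: "A \<in> F_eta N \<Longrightarrow> A n \<in> matrix_ops (N ^ n)"
  by (simp add: F_eta_def)

lemma F_eta_bounded_ops: "A \<in> F_eta N \<Longrightarrow> A n \<in> bounded_ops"
  by (rule matrix_ops_bounded_ops[OF F_eta_matrix])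

lemma F_eta_bound:
  assumes "A \<in> F_eta N"
  obtains C where "C \<ge> 0" "\<And>n. norm (A n) \<le> C"
  using assms by (auto simp: F_eta_def bounded_iff) (meson norm_ge_zero order_trans)

lemma
  assumes A: "A \<in> F_eta N" and B: "B \<in> F_eta N"
  shows F_eta_add: "(\<lambda>n. A n + B n) \<in> F_eta N"
    and F_eta_mult: "(\<lambda>n. A n o\<^sub>L B n) \<in> F_eta N"
proof -
  obtain C where C: "\<And>n. norm (A n) \<le> C" using F_eta_bound[OF A] by blast
  obtain D where D: "\<And>n. norm (B n) \<le> D" using F_eta_bound[OF B] by blast
  show "(\<lambda>n. A n + B n) \<in> F_eta N"
  proof (rule F_etaI)
    show "A n + B n \<in> matrix_ops (N ^ n)" for n
      by (rule matrix_ops_add[OF F_eta_matrix[OF A] F_eta_matrix[OF B]])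
    show "norm (A n + B n) \<le> C + D" for n
      by (rule norm_triangle_mono[OF C D])
  qed
  show "(\<lambda>n. A n o\<^sub>L B n) \<in> F_eta N"
  proof (rule F_etaI)
    show "A n o\<^sub>L B n \<in> matrix_ops (N ^ n)" for n
      by (rule matrix_ops_compose[OF F_eta_matrix[OF A] F_eta_matrix[OF B]])
    show "norm (A n o\<^sub>L B n) \<le> C * D" for n
      by (rule norm_compose_le[OF C D])
  qed
qed

lemma F_eta_scale:
  assumes "A \<in> F_eta N"
  shows "(\<lambda>n. op_scaleC c (A n)) \<in> F_eta N"
proof -
  obtain C where "\<And>n. norm (A n) \<le> C" using F_eta_bound[OF assms] by blast
  then have "norm (op_scaleC c (A n)) \<le> cmod c * C" for n
    by (intro order_trans[OF norm_op_scaleC_le] mult_left_mono) auto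
  then show ?thesis
    by (rule F_etaI[OF matrix_ops_scale[OF F_eta_matrix[OF assms]]])
qed

lemma F_eta_adj:
  assumes "A \<in> F_eta N"
  shows "(\<lambda>n. adj (A n)) \<in> F_eta N"
proof -
  obtain C where "\<And>n. norm (A n) \<le> C" using F_eta_bound[OF assms] by blast
  then have "norm (adj (A n)) \<le> C" for n
    using norm_adj_le[OF F_eta_bounded_ops[OF assms]] order_trans by blast
  then show ?thesis
    by (rule F_etaI[OF matrix_ops_adj[OF F_eta_matrix[OF assms]]])
qed

lemma F_eta_compression: "A \<in> bounded_ops \<Longrightarrow> compressions N A \<in> F_eta N"
  by (rule F_etaI[OF compression_matrix_ops norm_compression_le])

lemma F_eta_limit:
  assumes B: "\<And>k. B k \<in> F_eta N" and lim: "uniform_limit UNIV B A sequentially"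
  shows "A \<in> F_eta N"
proof -
  have "\<forall>\<^sub>F k in sequentially. \<forall>n\<in>UNIV. dist (B k n) (A n) < 1"
    using lim by (rule uniform_limitD) simp
  then obtain k where k: "\<And>n. dist (B k n) (A n) < 1" by (auto simp: eventually_sequentially)
  obtain C where C: "\<And>n. norm (B k n) \<le> C" using F_eta_bound[OF B] by blast
  show ?thesis
  proof (rule F_etaI)
    show "A n \<in> matrix_ops (N ^ n)" for n
    proof (rule matrix_ops_limit)
      show "B k n \<in> matrix_ops (N ^ n)" for k by (rule F_eta_matrix[OF B])
      show "(\<lambda>k. B k n) \<longlonglongrightarrow> A n" by (rule tendsto_uniform_limitI[OF lim UNIV_I])
    qed
    show "norm (A n) \<le> C + 1" for n
      using k[of n] C[of n] norm_triangle_ineq2[of "A n" "B k n"] by (simp add: dist_norm norm_minus_commute)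
  qed
qed

section \<open>Intertwined limits under algebraic operations and uniform limits\<close>

definition intertwined :: "nat \<Rightarrow> (nat \<Rightarrow> op) \<Rightarrow> (l2 ell2 \<Rightarrow>\<^sub>L l2 ell2) \<Rightarrow> bool"
  where "intertwined N A X \<longleftrightarrow> X \<in> bounded_ops \<and>
    (\<lambda>n. norm ((spread N n o\<^sub>L A n) - (X o\<^sub>L spread N n))) \<longlonglongrightarrow> 0"

lemma intertwinedI:
  assumes "X \<in> bounded_ops" "f \<longlonglongrightarrow> 0"
    and "\<forall>\<^sub>F n in sequentially. norm ((spread N n o\<^sub>L A n) - (X o\<^sub>L spread N n)) \<le> f n"
  shows "intertwined N A X"
  unfolding intertwined_def
  using assms by (auto intro!: tendsto_sandwich[OF _ assms(3) tendsto_const assms(2)])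

lemma intertwinedD:
  assumes "intertwined N A X"
  shows "X \<in> bounded_ops" "(\<lambda>n. norm ((spread N n o\<^sub>L A n) - (X o\<^sub>L spread N n))) \<longlonglongrightarrow> 0"
  using assms by (simp_all add: intertwined_def)

context
  fixes N :: nat
  assumes N: "N \<ge> 2"
begin

lemma intertwined_add:
  assumes "intertwined N A X" "intertwined N B Y"
  shows "intertwined N (\<lambda>n. A n + B n) (X + Y)"
proof (rule intertwinedI)
  show "(\<lambda>n. norm ((spread N n o\<^sub>L A n) - (X o\<^sub>L spread N n)) + norm ((spread N n o\<^sub>L B n) - (Y o\<^sub>L spread N n))) \<longlonglongrightarrow> 0"
    by (intro tendsto_add_zero intertwinedD assms)
  have "(spread N n o\<^sub>L (A n + B n)) - ((X + Y) o\<^sub>L spread N n)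
      = ((spread N n o\<^sub>L A n) - (X o\<^sub>L spread N n)) + ((spread N n o\<^sub>L B n) - (Y o\<^sub>L spread N n))" for n
    by (simp add: blinfun_compose_add_left blinfun_compose_add_right)
  then show "\<forall>\<^sub>F n in sequentially. norm ((spread N n o\<^sub>L (A n + B n)) - ((X + Y) o\<^sub>L spread N n))
      \<le> norm ((spread N n o\<^sub>L A n) - (X o\<^sub>L spread N n)) + norm ((spread N n o\<^sub>L B n) - (Y o\<^sub>L spread N n))"
    by (simp add: norm_triangle_ineq)
qed (use assms in \<open>simp add: intertwined_def add_bounded_ops\<close>)

lemma spread_scaleC: "spread N n (c *\<^sub>C x) = c *\<^sub>C spread N n x"
  by (intro ell2_eqI) (auto simp: spread_nth ell2_nth_simps scaleC_complex_def)

lemma intertwined_scale: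
  assumes "intertwined N A X"
  shows "\<exists>Y. intertwined N (\<lambda>n. op_scaleC c (A n)) Y"
proof -
  have X: "X \<in> bounded_ops" using assms by (simp add: intertwined_def)
  define Y where "Y = Blinfun (\<lambda>x. c *\<^sub>C X x)"
  have Y: "Y x = c *\<^sub>C X x" for x
    unfolding Y_def using bounded_linear_compose[OF bounded_linear_scaleC blinfun.bounded_linear_right[of X]]
    by (simp add: bounded_linear_Blinfun_apply)
  have "intertwined N (\<lambda>n. op_scaleC c (A n)) Y"
  proof (rule intertwinedI)
    show "Y \<in> bounded_ops"
      by (rule bounded_opsI) (simp add: Y bounded_opsD[OF X] scaleC_scaleC mult.commute)
    show "(\<lambda>n. cmod c * norm ((spread N n o\<^sub>L A n) - (X o\<^sub>L spread N n))) \<longlonglongrightarrow> 0"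
      by (intro tendsto_mult_right_zero intertwinedD assms)
    have "norm ((spread N n o\<^sub>L op_scaleC c (A n)) - (Y o\<^sub>L spread N n))
        \<le> cmod c * norm ((spread N n o\<^sub>L A n) - (X o\<^sub>L spread N n))" for n
    proof (rule norm_blinfun_bound)
      fix x
      have "((spread N n o\<^sub>L op_scaleC c (A n)) - (Y o\<^sub>L spread N n)) x
          = c *\<^sub>C ((spread N n o\<^sub>L A n) - (X o\<^sub>L spread N n)) x"
        by (simp add: blinfun.diff_left op_scaleC_apply spread_scaleC Y
            linear_diff[OF bounded_linear.linear[OF bounded_linear_scaleC]])
      then show "norm (((spread N n o\<^sub>L op_scaleC c (A n)) - (Y o\<^sub>L spread N n)) x)
          \<le> cmod c * norm ((spread N n o\<^sub>L A n) - (X o\<^sub>L spread N n)) * norm x"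
        using mult_left_mono[OF norm_blinfun, of "cmod c"] by (simp add: norm_scaleC mult.assoc)
    qed simp
    then show "\<forall>\<^sub>F n in sequentially. norm ((spread N n o\<^sub>L op_scaleC c (A n)) - (Y o\<^sub>L spread N n))
        \<le> cmod c * norm ((spread N n o\<^sub>L A n) - (X o\<^sub>L spread N n))" by simp
  qed
  then show ?thesis by blast
qed

lemma intertwined_diff:
  assumes "intertwined N A X" "intertwined N B Y"
  shows "intertwined N (\<lambda>n. A n - B n) (X - Y)"
proof (rule intertwinedI)
  show "(\<lambda>n. norm ((spread N n o\<^sub>L A n) - (X o\<^sub>L spread N n)) + norm ((spread N n o\<^sub>L B n) - (Y o\<^sub>L spread N n))) \<longlonglongrightarrow> 0"
    by (intro tendsto_add_zero intertwinedD assms)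
  have "(spread N n o\<^sub>L (A n - B n)) - ((X - Y) o\<^sub>L spread N n)
      = ((spread N n o\<^sub>L A n) - (X o\<^sub>L spread N n)) - ((spread N n o\<^sub>L B n) - (Y o\<^sub>L spread N n))" for n
    by (simp add: blinfun_compose_diff_left blinfun_compose_diff_right)
  then show "\<forall>\<^sub>F n in sequentially. norm ((spread N n o\<^sub>L (A n - B n)) - ((X - Y) o\<^sub>L spread N n))
      \<le> norm ((spread N n o\<^sub>L A n) - (X o\<^sub>L spread N n)) + norm ((spread N n o\<^sub>L B n) - (Y o\<^sub>L spread N n))"
    by (simp add: norm_triangle_ineq4)
qed (use assms in \<open>simp add: intertwined_def diff_bounded_ops\<close>)

lemma intertwined_mult:
  assumes A: "intertwined N A X" and B: "intertwined N B Y" "B \<in> F_eta N"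
  shows "intertwined N (\<lambda>n. A n o\<^sub>L B n) (X o\<^sub>L Y)"
proof -
  obtain C where C: "\<And>n. norm (B n) \<le> C" using F_eta_bound[OF B(2)] by blast
  let ?a = "\<lambda>n. (spread N n o\<^sub>L A n) - (X o\<^sub>L spread N n)" and ?b = "\<lambda>n. (spread N n o\<^sub>L B n) - (Y o\<^sub>L spread N n)"
  show ?thesis
  proof (rule intertwinedI)
    have "(\<lambda>n. norm (?a n) * C + norm X * norm (?b n)) \<longlonglongrightarrow> 0 * C + norm X * 0"
      using A B(1) unfolding intertwined_def by (intro tendsto_intros) auto
    then show "(\<lambda>n. norm (?a n) * C + norm X * norm (?b n)) \<longlonglongrightarrow> 0" by simp
    \<comment> \<open>The mixed term \<open>X o\<^sub>L spread N n o\<^sub>L B n\<close> is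
      inserted; boundedness of \<open>B\<close> controls the first summand.\<close>
    have "(spread N n o\<^sub>L (A n o\<^sub>L B n)) - ((X o\<^sub>L Y) o\<^sub>L spread N n) = (?a n o\<^sub>L B n) + (X o\<^sub>L ?b n)" for n
      by (simp add: blinfun_compose_diff_left blinfun_compose_diff_right blinfun_compose_assoc)
    then have "norm ((spread N n o\<^sub>L (A n o\<^sub>L B n)) - ((X o\<^sub>L Y) o\<^sub>L spread N n))
        \<le> norm (?a n) * C + norm X * norm (?b n)" for n
      by (simp add: norm_triangle_mono norm_compose_le C)
    then show "\<forall>\<^sub>F n in sequentially. norm ((spread N n o\<^sub>L (A n o\<^sub>L B n)) - ((X o\<^sub>L Y) o\<^sub>L spread N n))
        \<le> norm (?a n) * C + norm X * norm (?b n)" by simp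
  qed (use A B in \<open>simp add: intertwined_def compose_bounded_ops\<close>)
qed

lemma intertwined_tendsto:
  assumes A: "intertwined N A X" and y: "\<And>n. norm (y n) \<le> C" "(\<lambda>n. spread N n (y n)) \<longlonglongrightarrow> x"
  shows "(\<lambda>n. spread N n (A n (y n))) \<longlonglongrightarrow> X x"
proof -
  let ?a = "\<lambda>n. (spread N n o\<^sub>L A n) - (X o\<^sub>L spread N n)"
  have "(\<lambda>n. norm (?a n) * C) \<longlonglongrightarrow> 0"
    by (intro tendsto_mult_left_zero intertwinedD A)
  moreover have "norm (?a n (y n)) \<le> norm (?a n) * C" for n
    by (rule order_trans[OF norm_blinfun mult_left_mono]) (auto intro: y)
  ultimately have "(\<lambda>n. ?a n (y n)) \<longlonglongrightarrow> 0"
    by (intro Lim_null_comparison[of "\<lambda>n. ?a n (y n)" "\<lambda>n. norm (?a n) * C"]) auto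
  moreover have "(\<lambda>n. X (spread N n (y n))) \<longlonglongrightarrow> X x"
    by (intro blinfun.tendsto tendsto_const y)
  ultimately have "(\<lambda>n. ?a n (y n) + X (spread N n (y n))) \<longlonglongrightarrow> 0 + X x"
    by (rule tendsto_add)
  then show ?thesis by (simp add: blinfun.diff_left)
qed

lemma approximants:
  "\<exists>y C. (\<forall>n. trunc (N ^ n) (y n) = y n) \<and> (\<lambda>n. spread N n (y n)) \<longlonglongrightarrow> x \<and>
    (\<forall>n. norm (y n) \<le> C) \<and> (\<lambda>n. norm (y n)) \<longlonglongrightarrow> norm x"
proof -
  obtain y where y: "\<And>n. trunc (N ^ n) (y n) = y n" "(\<lambda>n. spread N n (y n)) \<longlonglongrightarrow> x"
    using spread_approximants[OF N, of x] by blast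
  have "\<forall>\<^sub>F n in sequentially. norm (spread N n (y n)) = norm (y n)"
    using eventually_ge_at_top[of 2] by eventually_elim (simp add: norm_spread[OF N] y)
  with tendsto_norm[OF y(2)] have lim: "(\<lambda>n. norm (y n)) \<longlonglongrightarrow> norm x"
    by (rule Lim_transform_eventually)
  then have "Bseq (\<lambda>n. norm (y n))" by (rule convergent_imp_Bseq[OF convergentI])
  then obtain C where "\<And>n. norm (y n) \<le> C" by (auto simp: Bseq_def)
  with y lim show ?thesis by (intro exI[of _ y] exI[of _ C]) simp
qed

text \<open>Every \<open>x\<close> is a limit of spread vectors with converging norms, and along
  them \<open>X\<close> is approximated by the action of the matrices. Applied to differences, the
  estimate makes the limits of a uniformly convergent family Cauchy.\<close>

lemma intertwined_norm_le:
  assumes A: "intertwined N A X" and C: "\<And>n. norm (A n) \<le> C"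
  shows "norm X \<le> C"
proof (rule norm_blinfun_bound)
  show "0 \<le> C" using C[of 0] norm_ge_zero order_trans by blast
  fix x
  obtain y D where y: "(\<lambda>n. spread N n (y n)) \<longlonglongrightarrow> x"
    "\<And>n. norm (y n) \<le> D" "(\<lambda>n. norm (y n)) \<longlonglongrightarrow> norm x"
    using approximants[of x] by blast
  have l1: "(\<lambda>n. norm (spread N n (A n (y n)))) \<longlonglongrightarrow> norm (X x)"
    by (intro tendsto_norm intertwined_tendsto[OF A y(2) y(1)])
  have l2: "(\<lambda>n. C * norm (y n)) \<longlonglongrightarrow> C * norm x"
    by (intro tendsto_intros y)
  have le: "\<forall>\<^sub>F n in sequentially. norm (spread N n (A n (y n))) \<le> C * norm (y n)"
    using eventually_ge_at_top[of 2]
  proof eventually_elim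
    case (elim n)
    then show ?case
      using norm_apply_le[OF norm_spread_le[OF N elim], of "A n (y n)"] norm_apply_le[OF C, of n "y n"] by simp
  qed
  show "norm (X x) \<le> C * norm x"
    by (rule tendsto_le[OF trivial_limit_sequentially l2 l1 le])
qed

text \<open>The operators belonging to the \<open>B k\<close> form a Cauchy sequence by
  \<open>intertwined_norm_le\<close>, and their limit \<open>Y\<close> is intertwined with
  \<open>A\<close> by a three-term estimate.\<close>

lemma intertwined_limit:
  assumes B: "\<And>k. \<exists>X. intertwined N (B k) X" and lim: "uniform_limit UNIV B A sequentially"
  shows "\<exists>X. intertwined N A X"
proof -
  have "\<forall>k. \<exists>X. intertwined N (B k) X" using B by blast
  from choice[OF this] obtain X where X: "\<And>k. intertwined N (B k) (X k)" by blast
  have close: "norm (X k - X l) \<le> e + e"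
    if "\<And>n. dist (B k n) (A n) < e" "\<And>n. dist (B l n) (A n) < e" for k l e
  proof (rule intertwined_norm_le[OF intertwined_diff[OF X X]])
    show "norm (B k n - B l n) \<le> e + e" for n
      using dist_triangle2[of "B k n" "B l n" "A n"] that[of n] by (simp add: dist_norm)
  qed
  have "Cauchy X"
  proof (rule CauchyI)
    fix e :: real assume e: "e > 0"
    then have "\<forall>\<^sub>F k in sequentially. \<forall>n\<in>UNIV. dist (B k n) (A n) < e / 3"
      by (intro uniform_limitD[OF lim]) simp
    then obtain M where M: "\<And>k n. k \<ge> M \<Longrightarrow> dist (B k n) (A n) < e / 3"
      by (auto simp: eventually_sequentially)
    have "norm (X k - X l) < e" if "k \<ge> M" "l \<ge> M" for k l
      using close[OF M M, OF that] e by linarith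
    then show "\<exists>M. \<forall>m\<ge>M. \<forall>n\<ge>M. norm (X m - X n) < e" by blast
  qed
  then obtain Y where Y: "X \<longlonglongrightarrow> Y" by (auto simp: Cauchy_convergent_iff convergent_def)
  have Yb: "Y \<in> bounded_ops"
    using closed_bounded_ops Y X unfolding closed_sequential_limits intertwined_def by blast
  have "(\<lambda>n. norm ((spread N n o\<^sub>L A n) - (Y o\<^sub>L spread N n))) \<longlonglongrightarrow> 0"
  proof (rule tendstoI)
    fix e :: real assume e: "e > 0"
    have "\<forall>\<^sub>F k in sequentially. (\<forall>n\<in>UNIV. dist (B k n) (A n) < e / 3) \<and> dist (X k) Y < e / 3"
      using e by (intro eventually_conj uniform_limitD[OF lim] tendstoD[OF Y]) auto
    then obtain k where k: "\<And>n. norm (A n - B k n) \<le> e / 3" "norm (X k - Y) \<le> e / 3"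
      by (fastforce simp: eventually_sequentially dist_norm norm_minus_commute intro: less_imp_le)
    have "\<forall>\<^sub>F n in sequentially. dist (norm ((spread N n o\<^sub>L B k n) - (X k o\<^sub>L spread N n))) 0 < e / 3"
      using X[of k] e unfolding intertwined_def by (intro tendstoD[of _ 0]) auto
    then show "\<forall>\<^sub>F n in sequentially. dist (norm ((spread N n o\<^sub>L A n) - (Y o\<^sub>L spread N n))) 0 < e"
      using eventually_ge_at_top[of 2]
    proof eventually_elim
      case (elim n)
      \<comment> \<open>With \<open>k\<close> fixed, \<open>?u\<close> is small uniformly in
        \<open>n\<close> by uniform convergence, \<open>?v\<close> is small for large
        \<open>n\<close>, and \<open>?w\<close> is small because \<open>X k\<close> is close to
        \<open>Y\<close>.\<close>
      let ?u = "spread N n o\<^sub>L (A n - B k n)" and ?v = "(spread N n o\<^sub>L B k n) - (X k o\<^sub>L spread N n)"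
        and ?w = "(X k - Y) o\<^sub>L spread N n"
      have "(spread N n o\<^sub>L A n) - (Y o\<^sub>L spread N n) = (?u + ?v) + ?w"
        by (simp add: blinfun_compose_diff_left blinfun_compose_diff_right)
      moreover have "norm ?u \<le> 1 * (e / 3)" "norm ?w \<le> e / 3 * 1"
        by (intro norm_compose_le k norm_spread_le[OF N elim(2)])+
      ultimately show ?case
        using elim(1) norm_triangle_ineq[of ?u ?v] norm_triangle_ineq[of "?u + ?v" ?w] by simp
    qed
  qed
  with Yb show ?thesis by (auto simp: intertwined_def)
qed

lemma sqrt_rate: "(\<lambda>n. sqrt (2 / real (n div 2))) \<longlonglongrightarrow> 0"
proof -
  have "filterlim (\<lambda>n::nat. n div 2) at_top sequentially"
    unfolding filterlim_at_top
  proof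
    fix Z :: nat
    show "\<forall>\<^sub>F n in sequentially. Z \<le> n div 2"
      using eventually_ge_at_top[of "2 * Z"] by eventually_elim auto
  qed
  then have "filterlim (\<lambda>n::nat. real (n div 2)) at_top sequentially"
    by (rule filterlim_compose[OF filterlim_real_sequentially])
  then have "(\<lambda>n. 2 / real (n div 2)) \<longlonglongrightarrow> 0"
    by (intro tendsto_divide_0[OF tendsto_const] filterlim_at_top_imp_at_infinity)
  then show ?thesis using tendsto_real_sqrt by fastforce
qed

lemma intertwined_cuntz_isom:
  assumes "i < N"
    and "T \<in> bounded_ops" "\<And>y m. ell2_nth (blinfun_apply T y) m = cuntz_isom N (N - 1 - i) (ell2_nth y (Suc m))"
  shows "intertwined N (compressions N (cuntz_isom N i)) T"
  using assms
  by (intro intertwinedI[OF _ sqrt_rate] eventually_mono[OF eventually_ge_at_top[of 2]]) (auto intro!: spread_cuntz_isom N)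

lemma intertwined_cuntz_adj:
  assumes "i < N"
    and "T \<in> bounded_ops" "\<And>y m. ell2_nth (blinfun_apply T y) m
        = (if m = 0 then 0 else adj (cuntz_isom N (N - 1 - i)) (ell2_nth y (m - 1)))"
  shows "intertwined N (compressions N (adj (cuntz_isom N i))) T"
  using assms
  by (intro intertwinedI[OF _ sqrt_rate] eventually_mono[OF eventually_ge_at_top[of 2]]) (auto intro!: spread_cuntz_adj N)

lemma intertwined_id: "intertwined N (compressions N id_blinfun) id_blinfun"
proof (rule intertwinedI[OF id_bounded_ops tendsto_const])
  have "N \<ge> 1" using N by simp
  then show "\<forall>\<^sub>F n in sequentially. norm ((spread N n o\<^sub>L compressions N id_blinfun n) - (id_blinfun o\<^sub>L spread N n)) \<le> 0"
    by (simp add: compressions_def trunc_idem spread_trunc)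
qed

text \<open>The limit belonging to the adjoint sequence is only there to make the set closed under
  adjoints; that it is the adjoint of the first one is never needed.\<close>

lemma S_eta_intertwined_F:
  "S_eta N \<subseteq> {A \<in> F_eta N. (\<exists>X. intertwined N A X) \<and> (\<exists>X. intertwined N (\<lambda>n. adj (A n)) X)}" (is "_ \<subseteq> ?Y")
proof (rule S_eta_least)
  show "seq_cstar_subalgebra N ?Y"
    unfolding seq_cstar_subalgebra_def
  proof (intro conjI ballI allI impI)
    show "?Y \<subseteq> F_eta N" by blast
    have zero: "intertwined N (\<lambda>n. 0) 0"
      by (rule intertwinedI[OF zero_bounded_ops tendsto_const]) simp
    then show "(\<lambda>n. 0) \<in> ?Y"
      by (auto simp: adj_zero intro!: F_etaI[of _ _ 0] zero_matrix_ops)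
  next
    fix A B assume A: "A \<in> ?Y" and B: "B \<in> ?Y"
    then have b: "A n \<in> bounded_ops" "B n \<in> bounded_ops" for n
      by (auto intro: F_eta_bounded_ops)
    show "(\<lambda>n. A n + B n) \<in> ?Y"
      using A B intertwined_add by (simp add: F_eta_add adj_add b) blast
    show "(\<lambda>n. A n o\<^sub>L B n) \<in> ?Y"
      using A B intertwined_mult F_eta_adj by (simp add: F_eta_mult adj_compose b) blast
  next
    fix c A assume A: "A \<in> ?Y"
    then have b: "A n \<in> bounded_ops" for n
      by (auto intro: F_eta_bounded_ops)
    show "(\<lambda>n. op_scaleC c (A n)) \<in> ?Y"
      using A intertwined_scale by (simp add: F_eta_scale adj_scaleC b) blast
  next
    fix A assume A: "A \<in> ?Y"
    then have b: "A n \<in> bounded_ops" for n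
      by (auto intro: F_eta_bounded_ops)
    show "(\<lambda>n. adj (A n)) \<in> ?Y"
      using A by (simp add: F_eta_adj adj_adj b)
  next
    fix B A assume *: "(\<forall>k. B k \<in> ?Y) \<and> uniform_limit UNIV B A sequentially"
    then have lim: "uniform_limit UNIV B A sequentially" and B: "\<And>k. B k \<in> F_eta N" by auto
    have A: "A \<in> F_eta N" using B lim by (rule F_eta_limit)
    have "norm (adj (B k n) - adj (A n)) \<le> norm (B k n - A n)" for k n
      using norm_adj_le[of "B k n - A n"] F_eta_bounded_ops[OF B, of k n] F_eta_bounded_ops[OF A, of n]
      by (simp add: adj_diff diff_bounded_ops)
    then have le: "dist (adj (B k n)) (adj (A n)) \<le> dist (B k n) (A n)" for k n
      by (simp add: dist_norm)
    have lim': "uniform_limit UNIV (\<lambda>k n. adj (B k n)) (\<lambda>n. adj (A n)) sequentially"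
    proof (rule uniform_limitI)
      fix e :: real assume "e > 0"
      then have "\<forall>\<^sub>F k in sequentially. \<forall>n\<in>UNIV. dist (B k n) (A n) < e"
        by (rule uniform_limitD[OF lim])
      then show "\<forall>\<^sub>F k in sequentially. \<forall>n\<in>UNIV. dist (adj (B k n)) (adj (A n)) < e"
        by eventually_elim (meson le order_le_less_trans)
    qed
    show "A \<in> ?Y"
      using A * intertwined_limit[OF _ lim] intertwined_limit[OF _ lim'] by simp
  qed
  show "compressions N id_blinfun \<in> ?Y"
    using intertwined_id by (auto simp: F_eta_compression id_bounded_ops adj_compression adj_id)
  fix i assume i: "i < N"
  have i': "N - 1 - i < N" using N by simp
  obtain T where "T \<in> bounded_ops" "\<And>y m. ell2_nth (blinfun_apply T y) m = cuntz_isom N (N - 1 - i) (ell2_nth y (Suc m))"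
    using shift_left_exists[OF cuntz_isom_bounded_ops norm_cuntz_isom_le[OF i']] by blast
  then have 1: "intertwined N (compressions N (cuntz_isom N i)) T"
    by (rule intertwined_cuntz_isom[OF i])
  obtain T' where "T' \<in> bounded_ops" "\<And>y m. ell2_nth (blinfun_apply T' y) m
      = (if m = 0 then 0 else adj (cuntz_isom N (N - 1 - i)) (ell2_nth y (m - 1)))"
    using shift_right_exists[OF adj_bounded_ops[OF cuntz_isom_bounded_ops] norm_cuntz_adj_le[OF i']] by blast
  then have 2: "intertwined N (compressions N (adj (cuntz_isom N i))) T'"
    by (rule intertwined_cuntz_adj[OF i])
  show "compressions N (cuntz_isom N i) \<in> ?Y"
    using 1 2 by (auto simp: F_eta_compression cuntz_isom_bounded_ops adj_compression)
qed

lemma S_eta_F_eta: "A \<in> S_eta N \<Longrightarrow> A \<in> F_eta N"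
  using S_eta_intertwined_F by blast

lemma S_eta_intertwined: "A \<in> S_eta N \<Longrightarrow> \<exists>X. intertwined N A X"
  using S_eta_intertwined_F by blast

end

section \<open>The quotient algebra\<close>

lemma op_scaleC_minus_one: "op_scaleC (-1) A = - A"
  by (rule blinfun_eqI) (simp add: op_scaleC_apply scaleC_minus_one blinfun.minus_left)

lemma F_eta_diff:
  assumes "A \<in> F_eta N" "B \<in> F_eta N"
  shows "(\<lambda>n. A n - B n) \<in> F_eta N"
  using F_eta_add[OF assms(1) F_eta_scale[OF assms(2), of "-1"]] by (simp add: op_scaleC_minus_one)

lemma G_eta_iff: "A \<in> G_eta N \<longleftrightarrow> A \<in> F_eta N \<and> A \<longlonglongrightarrow> 0"
  by (simp add: G_eta_def tendsto_norm_zero_iff)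

lemma seq_class_collect: "seq_class N A = {B. \<exists>h\<in>G_eta N. B = (\<lambda>n. h n + A n)}"
  by (auto simp: seq_class_def a_r_coset_def' S_eta_ring_def)

lemma mem_seq_class:
  assumes A: "A \<in> F_eta N"
  shows "B \<in> seq_class N A \<longleftrightarrow> B \<in> F_eta N \<and> (\<lambda>n. B n - A n) \<longlonglongrightarrow> 0"
proof
  assume "B \<in> seq_class N A"
  then obtain h where "h \<in> F_eta N" "h \<longlonglongrightarrow> 0" and B: "B = (\<lambda>n. h n + A n)"
    by (auto simp: seq_class_collect G_eta_iff)
  then show "B \<in> F_eta N \<and> (\<lambda>n. B n - A n) \<longlonglongrightarrow> 0"
    using F_eta_add[OF _ A] by simp
next
  assume "B \<in> F_eta N \<and> (\<lambda>n. B n - A n) \<longlonglongrightarrow> 0"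
  then have "(\<lambda>n. B n - A n) \<in> G_eta N" using F_eta_diff[OF _ A] by (simp add: G_eta_iff)
  then show "B \<in> seq_class N A"
    unfolding seq_class_collect by (intro CollectI bexI[of _ "\<lambda>n. B n - A n"]) auto
qed

lemma seq_class_eq_iff:
  assumes A: "A \<in> F_eta N" and B: "B \<in> F_eta N"
  shows "seq_class N A = seq_class N B \<longleftrightarrow> (\<lambda>n. A n - B n) \<longlonglongrightarrow> 0"
proof
  assume "seq_class N A = seq_class N B"
  moreover have "A \<in> seq_class N A" using A by (simp add: mem_seq_class)
  ultimately show "(\<lambda>n. A n - B n) \<longlonglongrightarrow> 0" using mem_seq_class[OF B] by blast
next
  assume AB: "(\<lambda>n. A n - B n) \<longlonglongrightarrow> 0"
  have "(\<lambda>n. C n - A n) \<longlonglongrightarrow> 0 \<longleftrightarrow> (\<lambda>n. C n - B n) \<longlonglongrightarrow> 0" for C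
    using tendsto_add_zero[OF _ AB, of "\<lambda>n. C n - A n"] tendsto_diff[OF _ AB, of "\<lambda>n. C n - B n" 0] by auto
  then show "seq_class N A = seq_class N B"
    by (auto simp: mem_seq_class[OF A] mem_seq_class[OF B])
qed

text \<open>The coset product is a union of the classes of all products of representatives. A null
  sequence times a bounded one is null, so these classes coincide and the union collapses.\<close>

lemma seq_class_mult:
  assumes A: "A \<in> F_eta N" and B: "B \<in> F_eta N"
  shows "seq_class N A \<otimes>\<^bsub>S_quot N\<^esub> seq_class N B = seq_class N (\<lambda>n. A n o\<^sub>L B n)"
proof -
  have "seq_class N (\<lambda>n. a n o\<^sub>L b n) = seq_class N (\<lambda>n. A n o\<^sub>L B n)"
    if "a \<in> seq_class N A" "b \<in> seq_class N B" for a b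
  proof -
    have a: "a \<in> F_eta N" "(\<lambda>n. a n - A n) \<longlonglongrightarrow> 0" and b: "b \<in> F_eta N" "(\<lambda>n. b n - B n) \<longlonglongrightarrow> 0"
      using that mem_seq_class A B by blast+
    obtain C where C: "\<And>n. norm (b n) \<le> C" using F_eta_bound[OF b(1)] by blast
    obtain D where D: "\<And>n. norm (A n) \<le> D" using F_eta_bound[OF A] by blast
    have "(\<lambda>n. norm (a n - A n) * C + D * norm (b n - B n)) \<longlonglongrightarrow> 0"
      using a(2) b(2)
      by (intro tendsto_add_zero tendsto_mult_left_zero tendsto_mult_right_zero tendsto_norm_zero)
    moreover have le: "norm ((a n o\<^sub>L b n) - (A n o\<^sub>L B n)) \<le> norm (a n - A n) * C + D * norm (b n - B n)" for n
    proof -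
      have "(a n o\<^sub>L b n) - (A n o\<^sub>L B n) = ((a n - A n) o\<^sub>L b n) + (A n o\<^sub>L (b n - B n))"
        by (simp add: blinfun_compose_diff_left blinfun_compose_diff_right)
      then show ?thesis
        using norm_triangle_mono[OF norm_compose_le[OF order_refl C] norm_compose_le[OF D order_refl]] by simp
    qed
    ultimately have "(\<lambda>n. (a n o\<^sub>L b n) - (A n o\<^sub>L B n)) \<longlonglongrightarrow> 0"
      by (intro Lim_null_comparison[OF always_eventually[OF allI[OF le]]])
    then show ?thesis
      using F_eta_mult[OF a(1) b(1)] F_eta_mult[OF A B] by (simp add: seq_class_eq_iff)
  qed
  moreover have "A \<in> seq_class N A" "B \<in> seq_class N B" using A B by (simp_all add: mem_seq_class)
  moreover have "seq_class N A \<otimes>\<^bsub>S_quot N\<^esub> seq_class N B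
      = (\<Union>a\<in>seq_class N A. \<Union>b\<in>seq_class N B. seq_class N (\<lambda>n. a n o\<^sub>L b n))"
    by (simp add: S_quot_def FactRing_def rcoset_mult_def) (simp add: seq_class_def S_eta_ring_def)
  ultimately show ?thesis by blast
qed

lemma seq_class_add:
  assumes A: "A \<in> F_eta N" and B: "B \<in> F_eta N"
  shows "seq_class N A \<oplus>\<^bsub>S_quot N\<^esub> seq_class N B = seq_class N (\<lambda>n. A n + B n)"
proof -
  have eq: "seq_class N A \<oplus>\<^bsub>S_quot N\<^esub> seq_class N B
      = (\<Union>a\<in>seq_class N A. \<Union>b\<in>seq_class N B. {\<lambda>n. a n + b n})"
    by (simp add: S_quot_def FactRing_def set_add_def' S_eta_ring_def)
  have "(\<lambda>n. a n + b n) \<in> seq_class N (\<lambda>n. A n + B n)" if "a \<in> seq_class N A" "b \<in> seq_class N B" for a b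
    using that tendsto_add_zero[of "\<lambda>n. a n - A n" _ "\<lambda>n. b n - B n"]
    by (auto simp: mem_seq_class A B F_eta_add algebra_simps)
  moreover have "c \<in> (\<Union>a\<in>seq_class N A. \<Union>b\<in>seq_class N B. {\<lambda>n. a n + b n})"
    if c: "c \<in> seq_class N (\<lambda>n. A n + B n)" for c
  proof -
    \<comment> \<open>The whole null sequence is put into the first summand and \<open>B\<close>
      itself represents the second.\<close>
    have "(\<lambda>n. c n - B n) \<in> seq_class N A"
      using c by (auto simp: mem_seq_class A B F_eta_add F_eta_diff algebra_simps)
    moreover have "B \<in> seq_class N B" using B by (simp add: mem_seq_class)
    moreover have "c = (\<lambda>n. (c n - B n) + B n)" by simp
    ultimately show ?thesis by blast
  qed
  ultimately show ?thesis unfolding eq by blast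
qed

section \<open>Representatives of powers, adjoints and the corner projection\<close>

context
  fixes N :: nat
  assumes N: "N \<ge> 2"
begin

lemma id_cuntz: "id_blinfun \<in> cuntz_algebra N"
  using cuntz_isom_algebra(2)[of 0 N] N by simp

abbreviation "compress \<equiv> compressions N"

lemma compress_id: "compress id_blinfun = (\<lambda>n. trunc (N ^ n))"
  by (simp add: fun_eq_iff compressions_def trunc_idem)

lemma one_S_quot: "\<one>\<^bsub>S_quot N\<^esub> = seq_class N (compress id_blinfun)"
  by (simp add: S_quot_def FactRing_def seq_class_def compress_id) (simp add: S_eta_ring_def)

text \<open>The additive inverse unfolds to a definite description over the carrier, so existence
  and uniqueness are both verified on classes.\<close>

lemma uminus_seq_class:
  assumes A: "A \<in> S_eta N"
  shows "\<ominus>\<^bsub>S_quot N\<^esub> seq_class N A = seq_class N (\<lambda>n. - A n)"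
proof -
  have mA: "(\<lambda>n. - A n) \<in> S_eta N"
    using S_eta_scale[OF A, of "-1"] by (simp add: op_scaleC_minus_one)
  note F = S_eta_F_eta[OF N]
  have zF: "(\<lambda>n. 0) \<in> F_eta N" by (intro F_etaI[of _ _ 0]) (auto simp: zero_matrix_ops)
  have zero: "\<zero>\<^bsub>S_quot N\<^esub> = seq_class N (\<lambda>n. 0)"
    by (simp add: S_quot_def FactRing_def seq_class_collect)
  have carrier: "carrier (S_quot N) = seq_class N ` S_eta N"
    by (auto simp: S_quot_def FactRing_def A_RCOSETS_def' seq_class_def S_eta_ring_def)
  have "(THE y. y \<in> seq_class N ` S_eta N \<and>
      seq_class N A \<oplus>\<^bsub>S_quot N\<^esub> y = seq_class N (\<lambda>n. 0) \<and>
      y \<oplus>\<^bsub>S_quot N\<^esub> seq_class N A = seq_class N (\<lambda>n. 0)) = seq_class N (\<lambda>n. - A n)"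
  proof (rule the_equality)
    show "seq_class N (\<lambda>n. - A n) \<in> seq_class N ` S_eta N \<and>
      seq_class N A \<oplus>\<^bsub>S_quot N\<^esub> seq_class N (\<lambda>n. - A n) = seq_class N (\<lambda>n. 0) \<and>
      seq_class N (\<lambda>n. - A n) \<oplus>\<^bsub>S_quot N\<^esub> seq_class N A = seq_class N (\<lambda>n. 0)"
      using mA by (simp add: seq_class_add F A)
    fix y assume y: "y \<in> seq_class N ` S_eta N \<and>
      seq_class N A \<oplus>\<^bsub>S_quot N\<^esub> y = seq_class N (\<lambda>n. 0) \<and>
      y \<oplus>\<^bsub>S_quot N\<^esub> seq_class N A = seq_class N (\<lambda>n. 0)"
    then obtain C where C: "C \<in> S_eta N" "y = seq_class N C" by blast
    then have "seq_class N (\<lambda>n. C n + A n) = seq_class N (\<lambda>n. 0)"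
      using y by (simp add: seq_class_add F A)
    then have "(\<lambda>n. C n - - A n) \<longlonglongrightarrow> 0"
      using F_eta_add[OF F[OF C(1)] F[OF A]] zF by (simp add: seq_class_eq_iff)
    then show "y = seq_class N (\<lambda>n. - A n)"
      unfolding C(2) using F[OF C(1)] F[OF mA] by (simp add: seq_class_eq_iff)
  qed
  then show ?thesis
    by (simp add: a_inv_def m_inv_def carrier zero)
qed

text \<open>Adjoints do not increase norms, so differences that tend to 0 keep doing so; being
  involutive, the adjoint maps one class onto the whole other class.\<close>

lemma quot_adj_seq_class:
  assumes A: "A \<in> F_eta N"
  shows "quot_adj (seq_class N A) = seq_class N (\<lambda>n. adj (A n))"
proof -
  have adj_mem: "(\<lambda>n. adj (B n)) \<in> seq_class N (\<lambda>n. adj (C n))"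
    if C: "C \<in> F_eta N" and "B \<in> seq_class N C" for B C
  proof -
    have B: "B \<in> F_eta N" "(\<lambda>n. B n - C n) \<longlonglongrightarrow> 0" using that mem_seq_class by blast+
    have "norm (adj (B n) - adj (C n)) \<le> norm (B n - C n)" for n
      using norm_adj_le[of "B n - C n"] F_eta_bounded_ops[OF B(1), of n] F_eta_bounded_ops[OF C, of n]
      by (simp add: adj_diff diff_bounded_ops)
    then have "(\<lambda>n. adj (B n) - adj (C n)) \<longlonglongrightarrow> 0"
      by (rule Lim_null_comparison[OF always_eventually[OF allI] tendsto_norm_zero[OF B(2)]])
    then show ?thesis using B C by (simp add: mem_seq_class F_eta_adj)
  qed
  have adj2: "(\<lambda>n. adj (adj (B n))) = B" if "B \<in> F_eta N" for B
    using F_eta_bounded_ops[OF that] by (simp add: adj_adj)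
  have "B \<in> quot_adj (seq_class N A)" if B: "B \<in> seq_class N (\<lambda>n. adj (A n))" for B
  proof -
    have "B \<in> F_eta N" using B mem_seq_class F_eta_adj[OF A] by blast
    moreover have "(\<lambda>n. adj (B n)) \<in> seq_class N A"
      using adj_mem[OF F_eta_adj[OF A] B] by (simp add: adj2[OF A])
    ultimately show ?thesis
      unfolding quot_adj_def using adj2 by (intro image_eqI[of _ _ "\<lambda>n. adj (B n)"]) simp_all
  qed
  then show ?thesis using adj_mem[OF A] unfolding quot_adj_def by blast
qed

text \<open>Follows the recursion of the power in the quotient, with new factors on the right, so
  that its class is the power of the class.\<close>

definition seq_pow :: "(nat \<Rightarrow> op) \<Rightarrow> nat \<Rightarrow> nat \<Rightarrow> op"
  where "seq_pow A i = rec_nat (compress id_blinfun) (\<lambda>_ B n. B n o\<^sub>L A n) i"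

lemma seq_pow_simps:
  "seq_pow A 0 = compress id_blinfun" "seq_pow A (Suc i) = (\<lambda>n. seq_pow A i n o\<^sub>L A n)"
  by (simp_all add: seq_pow_def)

lemma seq_pow_S_eta: "A \<in> S_eta N \<Longrightarrow> seq_pow A i \<in> S_eta N"
  by (induction i) (auto simp: seq_pow_simps compression_S_eta id_cuntz S_eta_mult)

lemma seq_class_pow:
  assumes "A \<in> S_eta N"
  shows "seq_class N A [^]\<^bsub>S_quot N\<^esub> i = seq_class N (seq_pow A i)"
  by (induction i)
    (auto simp: nat_pow_def one_S_quot seq_pow_simps seq_class_mult S_eta_F_eta[OF N] assms seq_pow_S_eta)

lemma op_pow_apply: "blinfun_apply (op_pow A i) = (blinfun_apply A ^^ i)"
  by (induction i) (auto simp: op_pow_def fun_eq_iff)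

lemma intertwined_pow:
  assumes "A \<in> S_eta N" "intertwined N A X"
  shows "intertwined N (seq_pow A i) (op_pow X i)"
proof (induction i)
  case 0
  then show ?case using intertwined_id[OF N] by (simp add: seq_pow_simps op_pow_def)
next
  case (Suc i)
  \<comment> \<open>\<open>op_pow\<close> multiplies on the left but \<open>seq_pow\<close> on the
    right; powers of a single operator commute.\<close>
  have "op_pow X (Suc i) = op_pow X i o\<^sub>L X"
    by (rule blinfun_eqI) (simp add: op_pow_apply funpow_swap1)
  then show ?case
    using intertwined_mult[OF N Suc assms(2)] S_eta_F_eta[OF N assms(1)] by (simp add: seq_pow_simps)
qed

definition q1_seq :: "nat \<Rightarrow> op"
  where "q1_seq = (\<lambda>n. compress id_blinfun n - (compress (adj (cuntz_isom N 0)) n o\<^sub>L compress (cuntz_isom N 0) n))"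

lemma S_eta_gens:
  shows "compress (cuntz_isom N 0) \<in> S_eta N" "compress (adj (cuntz_isom N 0)) \<in> S_eta N"
proof -
  show "compress (cuntz_isom N 0) \<in> S_eta N"
    using N by (intro compression_S_eta cuntz_isom_algebra) simp
  from S_eta_adj[OF this] show "compress (adj (cuntz_isom N 0)) \<in> S_eta N"
    by (simp add: adj_compression cuntz_isom_bounded_ops)
qed

lemma S_eta_uminus: "A \<in> S_eta N \<Longrightarrow> (\<lambda>n. - A n) \<in> S_eta N"
  using S_eta_scale[of A N "-1"] by (simp add: op_scaleC_minus_one)

lemma q1_seq_S_eta: "q1_seq \<in> S_eta N"
  using S_eta_add[OF compression_S_eta[OF id_cuntz] S_eta_uminus[OF S_eta_mult[OF S_eta_gens(2,1)]]]
  by (simp add: q1_seq_def)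

lemma s0_star: "quot_adj (s0 N) = seq_class N (compress (adj (cuntz_isom N 0)))"
  by (simp add: s0_def quot_adj_seq_class S_eta_F_eta[OF N] S_eta_gens adj_compression cuntz_isom_bounded_ops)

lemma q1_eq: "q1 N = seq_class N q1_seq"
proof -
  let ?p = "\<lambda>n. compress (adj (cuntz_isom N 0)) n o\<^sub>L compress (cuntz_isom N 0) n"
  have "p1 N = seq_class N ?p"
    unfolding p1_def s0_star unfolding s0_def by (simp add: seq_class_mult S_eta_F_eta[OF N] S_eta_gens)
  moreover have "?p \<in> S_eta N" by (intro S_eta_mult S_eta_gens)
  ultimately have "q1 N = seq_class N (\<lambda>n. compress id_blinfun n + - ?p n)"
    unfolding q1_def a_minus_def
    by (simp only: one_S_quot uminus_seq_class seq_class_add S_eta_F_eta[OF N] S_eta_uminus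
        compression_S_eta[OF id_cuntz])
  then show ?thesis by (simp add: q1_seq_def)
qed

text \<open>Appending a zero survives the truncation exactly for indices below \<open>N ^ p\<close>.
  Hence the corner projection selects the words whose leading digit is not zero.\<close>

lemma q1_seq_Suc: "q1_seq (Suc p) = trunc (N ^ Suc p) - trunc (N ^ p)"
proof -
  have "compress (adj (cuntz_isom N 0)) (Suc p) o\<^sub>L compress (cuntz_isom N 0) (Suc p) = trunc (N ^ p)"
  proof (intro blinfun_eqI ell2_eqI)
    fix x k
    have "k * N < N ^ Suc p \<longleftrightarrow> k < N ^ p" using N by simp
    moreover have "k < N ^ Suc p" if "k < N ^ p"
      using that N by (meson le_trans less_le_trans one_le_numeral power_increasing le_SucI order_refl)
    ultimately show "ell2_nth ((compress (adj (cuntz_isom N 0)) (Suc p) o\<^sub>L compress (cuntz_isom N 0) (Suc p)) x) k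
        = ell2_nth (trunc (N ^ p) x) k"
      using N by (auto simp: compressions_def trunc_nth cuntz_adj_nth cuntz_isom_nth)
  qed
  then show ?thesis by (simp only: q1_seq_def compress_id)
qed

lemma q1_seq_reflection: "q1_seq (Suc p) o\<^sub>L reflection (N ^ Suc p) = top_block N p"
proof -
  have "trunc (N ^ Suc p) o\<^sub>L reflection (N ^ Suc p) = reflection (N ^ Suc p)"
    by (intro blinfun_eqI ell2_eqI) (simp add: trunc_nth reflection_nth)
  then show ?thesis by (simp only: q1_seq_Suc top_block_def blinfun_compose_diff_left)
qed

text \<open>A word with nonzero leading digit has nothing to cut off and goes entirely to outer
  index 0, whereas every other word avoids that index. So outer coordinate 0 of
  \<open>spread\<close> is the reflected corner from which \<open>W00\<close> is defined;
  \<open>p \<ge> 1\<close> provides the length 2 that the weights require.\<close>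

lemma reflection_q1_seq:
  assumes p: "p \<ge> 1"
  shows "reflection (N ^ Suc p) (q1_seq (Suc p) z) = ell2_nth (spread N (Suc p) z) 0"
proof (rule ell2_eqI)
  fix k
  let ?I = "N ^ Suc p - Suc k"
  show "ell2_nth (reflection (N ^ Suc p) (q1_seq (Suc p) z)) k = ell2_nth (ell2_nth (spread N (Suc p) z) 0) k"
  proof (cases "k < N ^ Suc p")
    case k: True
    then have I: "digits N ?I \<le> Suc p" using N by (simp only: digits_le_iff)
    have "amplitude (Suc p) (digits N ?I) 0 = (if ?I < N ^ p then 0 else 1)"
    proof (cases "?I < N ^ p")
      case True
      then have "digits N ?I \<le> p" using N by (simp only: digits_le_iff)
      then show ?thesis using True amplitude_0[of "Suc p" "digits N ?I"] p by simp
    next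
      case False
      then have "digits N ?I = Suc p" using I digits_le_iff[OF N, of ?I p] by linarith
      then show ?thesis using False amplitude_top[of "Suc p" "Suc p" 0] p by simp
    qed
    then show ?thesis
      using k by (simp add: reflection_nth q1_seq_Suc blinfun.diff_left ell2_nth_simps trunc_nth spread_nth del: power_Suc)
  qed (simp add: reflection_nth spread_nth del: power_Suc)
qed

lemma norm_reflection_le: "norm (reflection n) \<le> 1"
proof (rule norm_blinfun_bound)
  fix x
  have "(norm (reflection n x))\<^sup>2 = (\<Sum>k<n. (norm (ell2_nth x (n - Suc k)))\<^sup>2)"
    by (subst norm_ell2_finite[of n]) (auto simp: reflection_nth)
  also have "\<dots> = (\<Sum>k<n. (norm (ell2_nth x k))\<^sup>2)" by (rule sum.nat_diff_reindex)
  also have "\<dots> \<le> (norm x)\<^sup>2" by (rule sum_norm_sq_le) simp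
  finally have "norm (reflection n x) \<le> norm x" by (rule power2_le_imp_le) simp
  then show "norm (reflection n x) \<le> 1 * norm x" by simp
qed simp

section \<open>The representation \<open>W\<close>\<close>

lemma slim_eqI:
  assumes "\<And>x. (\<lambda>n. blinfun_apply (A n) x) \<longlonglongrightarrow> blinfun_apply V x"
  shows "slim A = V"
  unfolding slim_def
proof (rule the_equality)
  fix V' :: op assume V': "\<forall>x. (\<lambda>n. A n x) \<longlonglongrightarrow> V' x"
  show "V' = V"
  proof (rule blinfun_eqI)
    show "V' x = V x" for x using V' assms LIMSEQ_unique by blast
  qed
qed (use assms in blast)

text \<open>The inner corner and reflection form the top block for outer index 0, whose spread tends
  to \<open>ell2_single 0 x\<close>; the outer ones read coordinate 0 of the result.\<close>

lemma reflected_limit: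
  assumes B: "B \<in> S_eta N" "intertwined N B Y"
  shows "(\<lambda>n. reflection (N ^ n) (q1_seq n (B n (q1_seq n (reflection (N ^ n) x)))))
    \<longlonglongrightarrow> ell2_nth (Y (ell2_single 0 x)) 0"
proof -
  have bound: "norm (top_block N (n - 1) x) \<le> 2 * norm x" for n
  proof -
    have "norm (top_block N (n - 1)) \<le> 1 + 1 * 1"
      unfolding top_block_def
      by (intro order_trans[OF norm_triangle_ineq4 add_mono] norm_reflection_le norm_compose_le norm_trunc_le)
    then show ?thesis by (intro norm_apply_le) simp
  qed
  have "(\<lambda>n. spread N n (B n (top_block N (n - 1) x))) \<longlonglongrightarrow> Y (ell2_single 0 x)"
    using spread_top_block_tendsto[OF N, of 0 x] by (intro intertwined_tendsto[OF N B(2) bound]) simp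
  then have "(\<lambda>n. ell2_nth (spread N n (B n (top_block N (n - 1) x))) 0) \<longlonglongrightarrow> ell2_nth (Y (ell2_single 0 x)) 0"
    by (rule ell2_nth_tendsto)
  moreover have "\<forall>\<^sub>F n in sequentially. ell2_nth (spread N n (B n (top_block N (n - 1) x))) 0
      = reflection (N ^ n) (q1_seq n (B n (q1_seq n (reflection (N ^ n) x))))"
    using eventually_ge_at_top[of 2]
  proof eventually_elim
    case (elim n)
    then obtain p where p: "n = Suc p" "p \<ge> 1" by (cases n) auto
    have "q1_seq (Suc p) (reflection (N ^ Suc p) x) = top_block N p x"
      using q1_seq_reflection[of p] by (metis blinfun_apply_blinfun_compose)
    then show ?case using reflection_q1_seq[OF p(2)] by (simp add: p(1) del: power_Suc)
  qed
  ultimately show ?thesis by (rule Lim_transform_eventually)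
qed

text \<open>\<open>W00\<close> is the entry at (0, 0) of the intertwined operator. Whatever
  representative is chosen, it differs from \<open>Q\<close> by a null sequence, and conjugation
  with contractive reflections keeps it null.\<close>

lemma W00_apply:
  assumes B: "B \<in> S_eta N" "intertwined N B Y"
  shows "W00 N (seq_class N B) x = ell2_nth (Y (ell2_single 0 x)) 0"
proof -
  note F = S_eta_F_eta[OF N]
  define V :: op where "V = Blinfun (\<lambda>x. ell2_nth (Y (ell2_single 0 x)) 0)"
  have V: "V x = ell2_nth (Y (ell2_single 0 x)) 0" for x
  proof -
    have "bounded_linear (\<lambda>x. ell2_nth (Y (ell2_single 0 x)) 0)"
      using bounded_linear_compose[OF bounded_linear_ell2_nth[of 0]
          bounded_linear_compose[OF blinfun.bounded_linear_right[of Y] bounded_linear_ell2_single[of 0]]] .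
    then show ?thesis unfolding V_def by (simp only: bounded_linear_Blinfun_apply)
  qed
  define Q where "Q = (\<lambda>n. q1_seq n o\<^sub>L B n o\<^sub>L q1_seq n)"
  have Q: "Q \<in> S_eta N"
    unfolding Q_def by (intro S_eta_mult[OF S_eta_mult[OF q1_seq_S_eta B(1)] q1_seq_S_eta])
  have q: "q1 N \<otimes>\<^bsub>S_quot N\<^esub> seq_class N B \<otimes>\<^bsub>S_quot N\<^esub> q1 N = seq_class N Q"
    unfolding q1_eq Q_def
    by (simp add: seq_class_mult F q1_seq_S_eta B(1) F_eta_mult)
  define A where "A = (SOME A. A \<in> S_eta N \<and>
      seq_class N A = q1 N \<otimes>\<^bsub>S_quot N\<^esub> seq_class N B \<otimes>\<^bsub>S_quot N\<^esub> q1 N)"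
  have "A \<in> S_eta N \<and> seq_class N A = q1 N \<otimes>\<^bsub>S_quot N\<^esub> seq_class N B \<otimes>\<^bsub>S_quot N\<^esub> q1 N"
    unfolding A_def q by (rule someI[of _ Q]) (simp add: Q)
  then have A: "A \<in> S_eta N" "seq_class N A = seq_class N Q" by (simp_all add: q)
  then have AQ: "(\<lambda>n. A n - Q n) \<longlonglongrightarrow> 0"
    using seq_class_eq_iff[OF F[OF A(1)] F[OF Q]] by simp
  have "slim (\<lambda>n. reflection (N ^ n) o\<^sub>L A n o\<^sub>L reflection (N ^ n)) = V"
  proof (rule slim_eqI)
    fix x :: l2
    let ?R = "\<lambda>n. reflection (N ^ n)"
    have lim: "(\<lambda>n. norm (A n - Q n) * norm x) \<longlonglongrightarrow> 0"
      by (intro tendsto_mult_left_zero tendsto_norm_zero AQ)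
    have le: "norm (?R n ((A n - Q n) (?R n x))) \<le> norm (A n - Q n) * norm x" for n
      using norm_apply_le[OF norm_compose_le[OF norm_compose_le[OF norm_reflection_le order_refl] norm_reflection_le],
          of "N ^ n" "A n - Q n" "N ^ n" x] by simp
    have "(\<lambda>n. ?R n ((A n - Q n) (?R n x))) \<longlonglongrightarrow> 0"
      by (rule Lim_null_comparison[OF always_eventually[OF allI[OF le]] lim])
    moreover have "(\<lambda>n. ?R n (Q n (?R n x))) \<longlonglongrightarrow> V x"
      using reflected_limit[OF B, of x] by (simp add: Q_def V)
    ultimately have sum: "(\<lambda>n. ?R n ((A n - Q n) (?R n x)) + ?R n (Q n (?R n x))) \<longlonglongrightarrow> 0 + V x"
      by (rule tendsto_add)
    have "?R n ((A n - Q n) (?R n x)) + ?R n (Q n (?R n x)) = (?R n o\<^sub>L A n o\<^sub>L ?R n) x" for n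
      by (simp only: blinfun.diff_left blinfun.diff_right blinfun_apply_blinfun_compose diff_add_cancel)
    with sum show "(\<lambda>n. (?R n o\<^sub>L A n o\<^sub>L ?R n) x) \<longlonglongrightarrow> V x"
      by (simp only: add_0)
  qed
  moreover have "W00 N (seq_class N B) = slim (\<lambda>n. reflection (N ^ n) o\<^sub>L A n o\<^sub>L reflection (N ^ n))"
    unfolding W00_def A_def Let_def by (rule refl)
  ultimately have "W00 N (seq_class N B) = V" by (rule trans[rotated])
  then show ?thesis using V by (rule ssubst)
qed

text \<open>The powers of \<open>s0\<close> bring outer coordinate \<open>i\<close> to 0 and apply
  \<open>S\<close> to it \<open>i\<close> times; those of its adjoint bring coordinate 0 to
  \<open>j\<close> and apply \<open>adj S\<close> to it \<open>j\<close> times. The outer factors in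
  the definition of \<open>W\<close> cancel exactly these powers, as \<open>adj S\<close> is a left
  inverse of \<open>S\<close>. What is left is the matrix entry of \<open>X\<close>.\<close>

lemma W_apply:
  assumes A: "A \<in> S_eta N" "intertwined N A X"
  shows "W N i j (seq_class N A) v = ell2_nth (X (ell2_single j v)) i"
proof -
  note F = S_eta_F_eta[OF N]
  define S where "S = cuntz_isom N (N - 1)"
  have N1: "N - 1 < N" "0 < N" using N by auto
  have SS: "adj S (S x) = x" for x
    using arg_cong[OF cuntz_adj_isom[OF N1(1) N1(1)], of "\<lambda>B. blinfun_apply B x"] by (simp add: S_def)
  have S: "S \<in> bounded_ops" "norm S \<le> 1" "adj S \<in> bounded_ops" "norm (adj S) \<le> 1"
    unfolding S_def using N1
    by (auto intro: cuntz_isom_bounded_ops adj_bounded_ops norm_cuntz_isom_le norm_cuntz_adj_le)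
  obtain T where T: "T \<in> bounded_ops" "\<And>y m. ell2_nth (blinfun_apply T y) m = S (ell2_nth y (Suc m))"
    using shift_left_exists[OF S(1,2)] by blast
  obtain T' where T': "T' \<in> bounded_ops"
    "\<And>y m. ell2_nth (blinfun_apply T' y) m = (if m = 0 then 0 else adj S (ell2_nth y (m - 1)))"
    using shift_right_exists[OF S(3,4)] by blast
  let ?s = "compress (cuntz_isom N 0)" and ?s' = "compress (adj (cuntz_isom N 0))"
  have iT: "intertwined N ?s T"
    using T N1 by (intro intertwined_cuntz_isom[OF N]) (auto simp: S_def)
  have iT': "intertwined N ?s' T'"
    using T' N1 by (intro intertwined_cuntz_adj[OF N]) (auto simp: S_def)
  define E where "E = id_blinfun - (T' o\<^sub>L T)"
  have iE: "intertwined N q1_seq E"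
    unfolding q1_seq_def E_def
    by (intro intertwined_diff[OF N] intertwined_id[OF N] intertwined_mult[OF N] iT iT' F S_eta_gens)
  have E: "ell2_nth (E z) m = (if m = 0 then ell2_nth z 0 else 0)" for z m
    by (simp add: E_def blinfun.diff_left ell2_nth_simps T T' SS)
  define B where "B = (\<lambda>n. q1_seq n o\<^sub>L seq_pow ?s i n o\<^sub>L A n o\<^sub>L seq_pow ?s' j n o\<^sub>L q1_seq n)"
  define Y where "Y = E o\<^sub>L op_pow T i o\<^sub>L X o\<^sub>L op_pow T' j o\<^sub>L E"
  note mem = q1_seq_S_eta seq_pow_S_eta[OF S_eta_gens(1)] seq_pow_S_eta[OF S_eta_gens(2)] A(1)
  have B: "B \<in> S_eta N"
    unfolding B_def by (intro S_eta_mult mem)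
  have iB: "intertwined N B Y"
    unfolding B_def Y_def
    by (intro intertwined_mult[OF N] iE intertwined_pow S_eta_gens iT iT' A(2) F mem)
  have cls: "q1 N \<otimes>\<^bsub>S_quot N\<^esub> (s0 N [^]\<^bsub>S_quot N\<^esub> i) \<otimes>\<^bsub>S_quot N\<^esub> seq_class N A
      \<otimes>\<^bsub>S_quot N\<^esub> (quot_adj (s0 N) [^]\<^bsub>S_quot N\<^esub> j) \<otimes>\<^bsub>S_quot N\<^esub> q1 N = seq_class N B"
    unfolding B_def s0_star unfolding s0_def q1_eq
    by (simp add: seq_class_pow S_eta_gens seq_class_mult F mem F_eta_mult)
  have Tpow: "ell2_nth ((blinfun_apply T ^^ i) z) m = (blinfun_apply S ^^ i) (ell2_nth z (m + i))" for i m z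
    by (induction i arbitrary: z m) (simp_all add: T funpow_swap1)
  have T'1: "T' (ell2_single m x) = ell2_single (Suc m) (adj S x)" for m x
    by (rule ell2_eqI) (auto simp: T' ell2_single.rep_eq)
  have T'pow: "(blinfun_apply T' ^^ j) (ell2_single 0 x) = ell2_single j ((blinfun_apply (adj S) ^^ j) x)" for j x
    by (induction j) (simp_all add: T'1)
  have E0: "E (ell2_single 0 x) = ell2_single 0 x" for x
    by (rule ell2_eqI) (simp add: E ell2_single.rep_eq)
  have cancel: "(blinfun_apply (adj S) ^^ k) ((blinfun_apply S ^^ k) x) = x" for k x
    by (induction k arbitrary: x) (simp_all add: funpow_swap1[of "blinfun_apply (adj S)"] SS)
  have "W00 N (seq_class N B) x = (blinfun_apply S ^^ i) (ell2_nth (X (ell2_single j ((blinfun_apply (adj S) ^^ j) x))) i)" for x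
    unfolding W00_apply[OF B iB] Y_def by (simp add: E E0 op_pow_apply Tpow T'pow)
  moreover have "W N i j (seq_class N A) v = op_pow (adj S) i (W00 N (seq_class N B) (op_pow S j v))"
    unfolding W_def cls S_def by (simp only: blinfun_apply_blinfun_compose)
  ultimately show ?thesis
    by (simp only: op_pow_apply cancel)
qed

text \<open>A bounded operator is determined by its matrix, since each vector is the norm-convergent
  sum of its single entries; this settles existence and uniqueness in the description of
  \<open>W_tilde\<close>.\<close>

lemma W_tilde_eq:
  assumes A: "A \<in> S_eta N" "intertwined N A X"
  shows "W_tilde N (seq_class N A) = X"
proof -
  have sums: "(\<lambda>j. W N i j (seq_class N A) (ell2_nth x j)) sums ell2_nth (X x) i" for x i
    unfolding W_apply[OF A]
    by (intro bounded_linear.sums[OF bounded_linear_ell2_nth] bounded_linear.sums[OF blinfun.bounded_linear_right]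
        ell2_single_sums)
  show ?thesis
    unfolding W_tilde_def
  proof (rule the_equality)
    fix T :: "l2 ell2 \<Rightarrow>\<^sub>L l2 ell2"
    assume T: "\<forall>x i. (\<lambda>j. W N i j (seq_class N A) (ell2_nth x j)) sums ell2_nth (T x) i"
    show "T = X"
      by (intro blinfun_eqI ell2_eqI sums_unique2[OF T[rule_format] sums])
  qed (use sums in blast)
qed

end

section \<open>Stability\<close>

lemma inverse_exists:
  fixes X :: "'a::complex_normed_vector \<Rightarrow>\<^sub>L 'a"
  assumes X: "X \<in> bounded_ops" and below: "\<And>x. norm x \<le> M * norm (X x)" and surj: "\<And>z. \<exists>x. X x = z"
  shows "invertible_op X"
proof -
  have inj: "x = y" if "X x = X y" for x y
    using below[of "x - y"] that by (simp add: blinfun.diff_right)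
  obtain g where g: "\<And>z. X (g z) = z" using surj by metis
  have bl: "bounded_linear g"
  proof (rule bounded_linear_intro[of _ M])
    show "g (x + y) = g x + g y" for x y by (rule inj) (simp add: g blinfun.add_right)
    show "g (r *\<^sub>R x) = r *\<^sub>R g x" for r x by (rule inj) (simp add: g blinfun.scaleR_right)
    show "norm (g x) \<le> norm x * M" for x using below[of "g x"] by (simp add: g mult.commute)
  qed
  have gX: "g (X x) = x" for x by (rule inj) (rule g)
  show ?thesis
    unfolding invertible_op_def
  proof (intro bexI[of _ "Blinfun g"] conjI)
    show "X o\<^sub>L Blinfun g = id_blinfun" "Blinfun g o\<^sub>L X = id_blinfun"
      by (rule blinfun_eqI, simp add: bounded_linear_Blinfun_apply[OF bl] g gX)+
    show "Blinfun g \<in> bounded_ops"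
    proof (rule bounded_opsI)
      show "Blinfun g (c *\<^sub>C x) = c *\<^sub>C Blinfun g x" for c x
        unfolding bounded_linear_Blinfun_apply[OF bl] by (rule inj) (simp add: g bounded_opsD[OF X])
    qed
  qed
qed

text \<open>The span is taken over the reals, so each complex coordinate needs two generators, with
  entries 1 and \<i>.\<close>

lemma range_trunc_finite_span:
  "\<exists>D. finite D \<and> (\<forall>x. trunc m x = x \<longrightarrow> x \<in> span D)"
proof (intro exI[of _ "(\<lambda>k. ell2_single k 1) ` {..<m} \<union> (\<lambda>k. ell2_single k \<i>) ` {..<m}"] conjI allI impI)
  let ?D = "(\<lambda>k. ell2_single k 1) ` {..<m} \<union> (\<lambda>k. ell2_single k \<i>) ` {..<m}"
  fix x :: l2 assume x: "trunc m x = x"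
  have "ell2_single k (ell2_nth x k)
      = Re (ell2_nth x k) *\<^sub>R ell2_single k 1 + Im (ell2_nth x k) *\<^sub>R ell2_single k \<i>" for k
    by (rule ell2_eqI) (simp add: ell2_single.rep_eq ell2_nth_simps complex_eq_iff)
  then have "trunc m x = (\<Sum>k<m. Re (ell2_nth x k) *\<^sub>R ell2_single k 1 + Im (ell2_nth x k) *\<^sub>R ell2_single k \<i>)"
    by (simp add: trunc_eq_sum)
  also have "\<dots> \<in> span ?D"
    by (intro span_sum span_add span_scale span_base) auto
  finally show "x \<in> span ?D" by (simp only: x)
qed simp

text \<open>Dimension count: the image of a basis of \<open>V\<close> is independent, and a vector
  of \<open>V\<close> outside its span would enlarge it to too many independent vectors in
  \<open>span B\<close>.\<close>

lemma linear_inj_on_subspace_surj: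
  fixes f :: "'a::real_vector \<Rightarrow> 'a"
  assumes f: "linear f" and V: "subspace V" "f ` V \<subseteq> V" and inj: "inj_on f V"
    and D: "finite D" "V \<subseteq> span D"
  shows "f ` V = V"
proof -
  obtain B where B: "B \<subseteq> V" "independent B" "V \<subseteq> span B" by (rule maximal_independent_subset)
  have VB: "span B = V" using B V(1) by (simp add: span_minimal subset_antisym)
  have finB: "finite B" using independent_span_bound[OF D(1) B(2)] B(1) D(2) by blast
  have ind: "independent (f ` B)"
    by (rule linear_independent_injective_image[OF f B(2)]) (simp add: VB inj)
  have card: "card (f ` B) = card B" by (rule card_image[OF inj_on_subset[OF inj B(1)]])
  have "v \<in> span (f ` B)" if v: "v \<in> V" for v
  proof (rule ccontr)
    assume nv: "v \<notin> span (f ` B)"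
    then have "independent (insert v (f ` B))" using ind by (rule independent_insertI)
    moreover have "insert v (f ` B) \<subseteq> span B" using v B(1) V(2) unfolding VB by blast
    ultimately have "card (insert v (f ` B)) \<le> card B" using independent_span_bound[OF finB] by simp
    moreover have "v \<notin> f ` B" using nv span_base[of v "f ` B"] by auto
    ultimately show False using finB card by simp
  qed
  then have "V \<subseteq> f ` V" unfolding linear_span_image[OF f, of B] VB by (rule subsetI)
  with V(2) show ?thesis by (rule subset_antisym)
qed

text \<open>A lower bound gives injectivity, which in finite dimension gives bijectivity; the bound
  on the inverse does not depend on the size \<open>m\<close>, as uniform boundedness
  requires.\<close>

lemma matrix_inverse_exists:
  assumes A: "A \<in> matrix_ops m" and c: "c > 0"
    and below: "\<And>x. trunc m x = x \<Longrightarrow> c * norm x \<le> norm (A x)"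
  shows "\<exists>B. matrix_inverse m A B \<and> norm B \<le> 1 / c"
proof -
  let ?V = "{x. trunc m x = x}"
  have PP: "trunc m (trunc m x) = trunc m x" for x
    using trunc_idem[of m] by (metis blinfun_apply_blinfun_compose)
  have PA: "trunc m (A x) = A x" and AP: "A (trunc m x) = A x" for x
    using matrix_ops_trunc[OF A] by (metis blinfun_apply_blinfun_compose)+
  have inj: "x = y" if "trunc m x = x" "trunc m y = y" "A x = A y" for x y
    using below[of "x - y"] that c by (simp add: blinfun.diff_right mult_le_0_iff)
  obtain D where D: "finite D" "?V \<subseteq> span D" using range_trunc_finite_span[of m] by blast
  have "A ` ?V = ?V"
  proof (rule linear_inj_on_subspace_surj[OF _ _ _ _ D])
    show "linear A" by (rule bounded_linear.linear[OF blinfun.bounded_linear_right])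
    show "subspace ?V" by (auto simp: subspace_def blinfun.add_right blinfun.scaleR_right)
    show "A ` ?V \<subseteq> ?V" by (auto simp: PA)
    show "inj_on A ?V" using inj by (auto simp: inj_on_def)
  qed
  then have "\<exists>x. trunc m x = x \<and> A x = trunc m z" for z
    using PP[of z] by (metis (mono_tags, lifting) imageE mem_Collect_eq)
  \<comment> \<open>\<open>g\<close> inverts \<open>A\<close> on the corner and vanishes on the
    complement, because it solves for \<open>trunc m z\<close>.\<close>
  then obtain g where g: "\<And>z. trunc m (g z) = g z" "\<And>z. A (g z) = trunc m z" by metis
  have bound: "norm (g z) \<le> 1 / c * norm z" for z
  proof -
    have "c * norm (g z) \<le> norm (trunc m z)" using below[OF g(1)[of z]] by (simp add: g(2))
    also have "\<dots> \<le> norm z" using norm_apply_le[OF norm_trunc_le, of m z] by simp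
    finally show ?thesis using c by (simp add: field_simps)
  qed
  have bl: "bounded_linear g"
  proof (rule bounded_linear_intro[of _ "1 / c"])
    show "g (x + y) = g x + g y" for x y
      by (rule inj) (simp_all add: g blinfun.add_right)
    show "g (r *\<^sub>R x) = r *\<^sub>R g x" for r x
      by (rule inj) (simp_all add: g blinfun.scaleR_right)
    show "norm (g x) \<le> norm x * (1 / c)" for x using bound[of x] by simp
  qed
  note app = bounded_linear_Blinfun_apply[OF bl]
  have "Blinfun g \<in> matrix_ops m"
  proof (rule matrix_opsI)
    show "Blinfun g \<in> bounded_ops"
    proof (rule bounded_opsI)
      show "Blinfun g (a *\<^sub>C x) = a *\<^sub>C Blinfun g x" for a x
        unfolding app
        by (rule inj) (simp_all add: g bounded_opsD[OF trunc_bounded_ops] bounded_opsD[OF matrix_ops_bounded_ops[OF A]])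
    qed
    show "trunc m o\<^sub>L Blinfun g = Blinfun g" by (rule blinfun_eqI) (simp add: app g)
    show "Blinfun g o\<^sub>L trunc m = Blinfun g"
    proof (rule blinfun_eqI)
      fix z
      have "g (trunc m z) = g z" by (rule inj) (simp_all add: g PP)
      then show "(Blinfun g o\<^sub>L trunc m) z = Blinfun g z" by (simp add: app)
    qed
  qed
  moreover have "A o\<^sub>L Blinfun g = trunc m" by (rule blinfun_eqI) (simp add: app g)
  moreover have "Blinfun g o\<^sub>L A = trunc m"
  proof (rule blinfun_eqI)
    fix z
    have "g (A z) = trunc m z" by (rule inj) (simp_all add: g PP PA AP)
    then show "(Blinfun g o\<^sub>L A) z = trunc m z" by (simp add: app)
  qed
  moreover have "norm (Blinfun g) \<le> 1 / c"
    using c bound by (intro norm_blinfun_bound) (simp_all add: app)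
  ultimately show ?thesis unfolding matrix_inverse_def by (intro exI[of _ "Blinfun g"] conjI)
qed

section \<open>The two implications\<close>

context
  fixes N :: nat and A :: "nat \<Rightarrow> op" and X
  assumes N: "N \<ge> 2" and A: "A \<in> F_eta N" and iX: "intertwined N A X"
begin

lemma norm_spread_matrix:
  assumes "n \<ge> 2" "trunc (N ^ n) y = y"
  shows "norm (spread N n y) = norm y"
  using norm_spread[OF N assms(1), of y] assms(2) by simp

lemma trunc_A: "trunc (N ^ n) (A n y) = A n y"
  using matrix_ops_trunc(1)[OF F_eta_matrix[OF A]] by (metis blinfun_apply_blinfun_compose)

lemma stable_if_invertible:
  assumes "invertible_op X"
  shows "stable_seq N A"
proof -
  obtain Y where Y: "Y o\<^sub>L X = id_blinfun" using assms unfolding invertible_op_def by blast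
  \<comment> \<open>Adding 1 makes \<open>b\<close> positive, so that dividing by it needs no
    argument about \<open>Y\<close>.\<close>
  define b where "b = norm Y + 1"
  have b: "b > 0" by (simp add: b_def add_nonneg_pos)
  have below: "norm x / b \<le> norm (X x)" for x
  proof -
    have "norm x = norm (Y (X x))" using Y by (metis blinfun_apply_blinfun_compose id_blinfun.rep_eq)
    also have "\<dots> \<le> b * norm (X x)" by (rule norm_apply_le) (simp add: b_def)
    finally show ?thesis using b by (simp add: field_simps)
  qed
  let ?a = "\<lambda>n. (spread N n o\<^sub>L A n) - (X o\<^sub>L spread N n)"
  \<comment> \<open>Half of the lower bound \<open>1 / b\<close> is spent on the intertwining error.
    The other half remains for \<open>A n\<close> and bounds the inverses by
    \<open>2 * b\<close>.\<close>
  have "\<forall>\<^sub>F n in sequentially. norm (?a n) < 1 / (2 * b)"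
    using intertwinedD(2)[OF iX] b by (intro order_tendstoD(2)[of _ 0]) auto
  then have "\<forall>\<^sub>F n in sequentially. \<exists>B. matrix_inverse (N ^ n) (A n) B \<and> norm B \<le> 1 / (1 / (2 * b))"
    using eventually_ge_at_top[of 2]
  proof eventually_elim
    case (elim n)
    show ?case
    proof (rule matrix_inverse_exists[OF F_eta_matrix[OF A]])
      show "0 < 1 / (2 * b)" using b by simp
      fix x assume x: "trunc (N ^ n) x = x"
      have "X (spread N n x) = spread N n (A n x) - ?a n x" by (simp add: blinfun.diff_left)
      then have "norm (X (spread N n x)) \<le> norm (spread N n (A n x)) + norm (?a n x)"
        by (metis norm_triangle_ineq4)
      moreover have "norm (spread N n (A n x)) = norm (A n x)"
        by (rule norm_spread_matrix[OF elim(2) trunc_A])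
      moreover have "norm (?a n x) \<le> 1 / (2 * b) * norm x"
        using elim(1) by (intro norm_apply_le) simp
      moreover have "norm x / b \<le> norm (X (spread N n x))"
        using below[of "spread N n x"] norm_spread_matrix[OF elim(2) x] by simp
      moreover have "norm x / b = 1 / (2 * b) * norm x + 1 / (2 * b) * norm x"
        using b by (simp add: field_simps)
      ultimately show "1 / (2 * b) * norm x \<le> norm (A n x)" by linarith
    qed
  qed
  then show ?thesis unfolding stable_seq_def eventually_sequentially by blast
qed

lemma invertible_if_stable:
  assumes "stable_seq N A"
  shows "invertible_op X"
proof -
  obtain n0 M0 where "\<forall>n\<ge>n0. \<exists>B. matrix_inverse (N ^ n) (A n) B \<and> norm B \<le> M0"
    using assms unfolding stable_seq_def by blast
  then obtain B where B: "\<And>n. n \<ge> n0 \<Longrightarrow> matrix_inverse (N ^ n) (A n) (B n) \<and> norm (B n) \<le> M0"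
    by metis
  define M where "M = max M0 0"
  have AB: "A n (B n x) = trunc (N ^ n) x" and BA: "B n (A n x) = trunc (N ^ n) x"
    and nB: "norm (B n x) \<le> M * norm x" if "n \<ge> n0" for n x
  proof -
    have mi: "matrix_inverse (N ^ n) (A n) (B n)" and "norm (B n) \<le> M"
      using B[OF that] by (auto simp: M_def)
    then show "norm (B n x) \<le> M * norm x" by (intro norm_apply_le)
    show "A n (B n x) = trunc (N ^ n) x" "B n (A n x) = trunc (N ^ n) x"
      using mi unfolding matrix_inverse_def by (metis blinfun_apply_blinfun_compose)+
  qed
  have M: "M \<ge> 0" by (simp add: M_def)
  have below: "norm x \<le> M * norm (X x)" for x
  proof -
    obtain y C where y: "\<And>n. trunc (N ^ n) (y n) = y n" "(\<lambda>n. spread N n (y n)) \<longlonglongrightarrow> x"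
      "\<And>n. norm (y n) \<le> C" "(\<lambda>n. norm (y n)) \<longlonglongrightarrow> norm x"
      using approximants[OF N, of x] by blast
    have lim: "(\<lambda>n. M * norm (spread N n (A n (y n)))) \<longlonglongrightarrow> M * norm (X x)"
      by (intro tendsto_intros intertwined_tendsto[OF N iX y(3,2)])
    have "\<forall>\<^sub>F n in sequentially. norm (y n) \<le> M * norm (spread N n (A n (y n)))"
      using eventually_ge_at_top[of 2] eventually_ge_at_top[of n0]
    proof eventually_elim
      case (elim n)
      have "norm (y n) = norm (B n (A n (y n)))" by (simp add: BA[OF elim(2)] y(1))
      also have "\<dots> \<le> M * norm (A n (y n))" by (rule nB[OF elim(2)])
      finally show ?case by (simp add: norm_spread_matrix[OF elim(1) trunc_A])
    qed
    then show ?thesis by (rule tendsto_le[OF trivial_limit_sequentially lim y(4)])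
  qed
  have surj: "\<exists>x. X x = z" for z
  proof -
    obtain y C where y: "\<And>n. trunc (N ^ n) (y n) = y n" "(\<lambda>n. spread N n (y n)) \<longlonglongrightarrow> z"
      "\<And>n. norm (y n) \<le> C" "(\<lambda>n. norm (y n)) \<longlonglongrightarrow> norm z"
      using approximants[OF N, of z] by blast
    \<comment> \<open>\<open>B n (y n)\<close> solves the finite equation exactly, so its spread
      solves the equation for \<open>X\<close> and \<open>z\<close> up to the intertwining
      error.\<close>
    define w where "w n = spread N n (B n (y n))" for n
    let ?a = "\<lambda>n. (spread N n o\<^sub>L A n) - (X o\<^sub>L spread N n)"
    have "(\<lambda>n. norm (?a n) * (M * C)) \<longlonglongrightarrow> 0"
      by (intro tendsto_mult_left_zero intertwinedD(2)[OF iX])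
    moreover have "\<forall>\<^sub>F n in sequentially. norm (spread N n (y n) - X (w n)) \<le> norm (?a n) * (M * C)"
      using eventually_ge_at_top[of n0]
    proof eventually_elim
      case (elim n)
      have "spread N n (y n) - X (w n) = ?a n (B n (y n))"
        by (simp add: w_def blinfun.diff_left AB[OF elim] y(1))
      also have "norm \<dots> \<le> norm (?a n) * norm (B n (y n))" by (rule norm_blinfun)
      also have "\<dots> \<le> norm (?a n) * (M * C)"
        using nB[OF elim, of "y n"] mult_left_mono[OF y(3) M, of n] by (intro mult_left_mono) auto
      finally show ?case .
    qed
    ultimately have "(\<lambda>n. spread N n (y n) - X (w n)) \<longlonglongrightarrow> 0"
      by (rule Lim_null_comparison[rotated])
    then have "(\<lambda>n. spread N n (y n) - (spread N n (y n) - X (w n))) \<longlonglongrightarrow> z - 0"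
      by (intro tendsto_diff y(2))
    then have Xw: "(\<lambda>n. X (w n)) \<longlonglongrightarrow> z" by simp
    \<comment> \<open>The images under \<open>X\<close> converge, and the lower bound transfers the
      Cauchy property back to \<open>w\<close>. The divisor \<open>M + 1\<close> below covers the
      case \<open>M = 0\<close>.\<close>
    have "Cauchy w"
    proof (rule CauchyI)
      fix e :: real assume "e > 0"
      then have "e / (M + 1) > 0" using M by simp
      then obtain K where K: "\<And>m n. m \<ge> K \<Longrightarrow> n \<ge> K \<Longrightarrow> norm (X (w m) - X (w n)) < e / (M + 1)"
        using CauchyD[OF LIMSEQ_imp_Cauchy[OF Xw]] by metis
      have "norm (w m - w n) < e" if "m \<ge> K" "n \<ge> K" for m n
      proof -
        have "norm (w m - w n) \<le> M * norm (X (w m) - X (w n))"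
          using below[of "w m - w n"] by (simp add: blinfun.diff_right)
        also have "\<dots> \<le> M * (e / (M + 1))" using K[OF that] M by (intro mult_left_mono) auto
        also have "\<dots> < e" using M \<open>e > 0\<close> by (simp add: field_simps)
        finally show ?thesis .
      qed
      then show "\<exists>K. \<forall>m\<ge>K. \<forall>n\<ge>K. norm (w m - w n) < e" by blast
    qed
    then obtain x where "w \<longlonglongrightarrow> x" by (auto simp: Cauchy_convergent_iff convergent_def)
    then have "(\<lambda>n. X (w n)) \<longlonglongrightarrow> X x" by (intro blinfun.tendsto tendsto_const)
    then show ?thesis using Xw LIMSEQ_unique by blast
  qed
  show ?thesis by (rule inverse_exists[OF intertwinedD(1)[OF iX] below surj])
qed

end

theorem theorem6p18:
  fixes N :: nat and A :: "nat \<Rightarrow> op"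
  assumes "N \<ge> 2"
    and "A \<in> S_eta N"
  shows "stable_seq N A \<longleftrightarrow> invertible_op (W_tilde N (seq_class N A))"
proof -
  obtain X where X: "intertwined N A X" using S_eta_intertwined[OF assms] by blast
  note A = S_eta_F_eta[OF assms]
  show ?thesis
    unfolding W_tilde_eq[OF assms X]
    using stable_if_invertible[OF assms(1) A X] invertible_if_stable[OF assms(1) A X] by blast
qed

end
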